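(* Let $\mathsf{C}=(\mathbb{C},p)$ be a natural model, with $p:\dot{\mathcal U}\to\mathcal U$ regarded as a polynomial from $1$ to $1$ in the presheaf category $\widehat{\mathbb{C}}=\mathbf{Set}^{\mathbb{C}^{\mathrm{op}}}$. (a) $\mathsf{C}$ supports a unit type and dependent sum types if and only if $p$ can be equipped with the structure of a polynomial pseudomonad $\mathbb{P}$ in $\widehat{\mathbb{C}}$ (with underlying object $1$ and underlying polynomial $p$). (b) Given that $p$ is equipped with the structure of a polynomial pseudomonad $\mathbb{P}$ as in (a), $\mathsf{C}$ additionally supports dependent product types if and only if $p$ can be equipped with the structure of a polynomial pseudoalgebra over $\mathbb{P}$ (with underlying polynomial $p$).
   Context: **Natural models.** A natural model is a category $\mathbb{C}$ with a terminal object $\diamond$, a map of presheaves $p:\dot{\mathcal U}\to\mathcal U$ over $\mathbb{C}$, and, for each object $\Gamma$ and each $A\in\mathcal U(\Gamma)$, an object $\Gamma.A$, a morphism $\mathsf p_A:\Gamma.A\to\Gamma$ and an element $\mathsf q_A\in\dot{\mathcal U}(\Gamma.A)$ such that (identifying elements with maps out of representables by Yoneda) the square with top $\mathsf q_A:\mathsf y(\Gamma.A)\to\dot{\mathcal U}$, left $\mathsf y(\mathsf p_A)$, bottom $A:\mathsf y(\Gamma)\to\mathcal U$, right $p$ is a pullback. In the internal language of $\widehat{\mathbb{C}}$, $[A]$ denotes the fibre of $p$ over $A:\mathcal U$. - $\mathsf C$ supports a unit type iff there are $\widehat{\mathbf 1}:1\to\mathcal U$ and $\widehat\star:1\to\dot{\mathcal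 U}$ such that the square with left side $\mathrm{id}_1$, right side $p$, top $\widehat\star$, bottom $\widehat{\mathbf 1}$ is a pullback. - $\mathsf C$ supports dependent sum types iff there are maps $\widehat\Sigma,\widehat{\mathsf{pair}}$ such that the square with left side the projection $\sum_{(A,B):\sum_{A:\mathcal U}\mathcal U^{[A]}}\sum_{a:[A]}[B(a)]\to\sum_{A:\mathcal U}\mathcal U^{[A]}$, right side $p$, top $\widehat{\mathsf{pair}}$, bottom $\widehat\Sigma$ is a pullback. - $\mathsf C$ supports dependent product types iff there are maps $\widehat\Pi,\widehat\lambda$ such that the square with left side $\sum_{A:\mathcal U}p^{[A]}:\sum_{A:\mathcal U}\dot{\mathcal U}^{[A]}\to\sum_{A:\mathcal U}\mathcal U^{[A]}$, right side $p$, top $\widehat\lambda$, bottom $\widehat\Pi$ is a pullback. **Polynomials.** Let $\mathcal E$ be a locally cartesian closed category with terminal object $1$ and chosen pullbacks (here $\mathcal E=\widehat{\mathbb{C}}$). A morphism $f:B\to A$ is regarded as a polynomial $1\to1$. Its extension is the functor $P_f:\mathcal E\to\mathcal E$, $P_f(X)=\sum_{a\in A}X^{B_a}$. The composite $g\cdot f$ of $f:B\to A$ with $g:D\to C$ is the projection $\sum_{(c,m)\in M}\sum_{d\in D_c}B_{m(d)}\to M$, where $M=\sum_{c\in C}A^{D_c}$; one has $P_{g\cdot f}\cong P_g\circ P_f$. The identity polynomial is $i_1=\mathrm{id}_1$. A cartesian morphism of polynomials $\varphi:f\Rightarrow g$ is a pullback square $(\varphi_0:A\to C,\ \varphi_1:B\to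 D)$ from $f$ to $g$; equivalently it is given by $\varphi_0$ together with an isomorphism $\varphi_2:D_\varphi\to B$ over $A$, where $D_\varphi$ is the chosen pullback of $g$ along $\varphi_0$. It induces a cartesian strong natural transformation $P_\varphi:P_f\Rightarrow P_g$. Horizontal composites $\psi\cdot\varphi$ of cartesian morphisms are those corresponding, under extension, to horizontal composites of natural transformations. An adjustment $\alpha:\varphi\Rrightarrow\psi$ between parallel cartesian morphisms is a morphism $\alpha:D_\varphi\to D_\psi$ with $\psi_2\circ\alpha=\varphi_2$. $\mathfrak{Poly}^{\mathrm{cart}}_{\mathcal E}$ denotes the $\mathbf{2Cat}$-enriched bicategory (a weak 3-dimensional category whose homs are 2-categories) with 0-cells the objects of $\mathcal E$, 1-cells polynomials, 2-cells cartesian morphisms of polynomials, 3-cells adjustments; its hom 2-categories are locally codiscrete (exactly one adjustment between any two parallel cartesian morphisms), which determines all operations on 3-cells. Only the part with 0-cell $1$ is needed here: its 1-cells are the morphisms $f:B\to A$ of $\mathcal E$ regarded as polynomials $1\to1$, with composition $(g,f)\mapsto g\cdot f$ and identity $i_1$; its 2-cells $f\Rightarrow g$ are the pullback squares from $f$ to $g$; its 3-cells are the adjustments between these. **Polynomial pseudomonad** (on $1$). It consists of $p:Y\to X$ in $\mathcal E$, cartesian morphisms $\eta:i_1\Rightarrow p$ and $\mu:p\cdot p\Rightarrow p$, and invertible adjustments $\alpha:\mu\circ(p\cdot\mu)\Rrightarrow\mu\circ(\mu\cdot p)$, $\lambda:\mu\circ(p\cdot\eta)\Rrightarrow\mathrm{id}_p$,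 $\rho:\mu\circ(\eta\cdot p)\Rrightarrow\mathrm{id}_p$, such that, suppressing the associativity and unit isomorphisms of polynomial composition: (1) the composite $\mu(p\cdot\mu)(p\cdot p\cdot\mu)\Rrightarrow\mu(p\cdot\mu)(p\cdot\mu\cdot p)\Rrightarrow\mu(\mu\cdot p)(p\cdot\mu\cdot p)\Rrightarrow\mu(\mu\cdot p)(\mu\cdot p\cdot p)$ of $\mu\circ(p\cdot\alpha)$, $\alpha\circ(p\cdot\mu\cdot p)$, $\mu\circ(\alpha\cdot p)$ equals the composite of $\alpha\circ(p\cdot p\cdot\mu)$, the interchange isomorphism $\mu(\mu\cdot p)(p\cdot p\cdot\mu)\cong\mu(p\cdot\mu)(\mu\cdot p\cdot p)$, and $\alpha\circ(\mu\cdot p\cdot p)$; (2) $\alpha\circ(p\cdot\eta\cdot p)$ followed by $\mu\circ(\lambda\cdot p)$ equals $\mu\circ(p\cdot\rho)$. **Lift.** Let $\mathcal K=\mathfrak{Poly}^{\mathrm{cart}}_{\mathcal E}(1,1)$: 0-cells are morphisms of $\mathcal E$, 1-cells pullback squares, 2-cells adjustments. A polynomial pseudomonad $\mathbb P$ on $1$ induces a pseudomonad $\mathbb P^+=(P,h,m,\dots)$ on $\mathcal K$: $P(f)=P_p(f)$, $P$ applies $P_p$ to pullback squares, $h_f:f\Rightarrow P(f)$ is the naturality square of $P_\eta$ at $f$, $m_f:P(P(f))\Rightarrow P(f)$ is the naturality square of $P_\mu$ at $f$ (via $P_{p\cdot p}\cong P_pP_p$); all 2-cell data is the unique possible data. **Polynomial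 pseudoalgebra** over $\mathbb P$. This is a pseudoalgebra over $\mathbb P^+$: a morphism $f:B\to A$ of $\mathcal E$, a cartesian morphism $\zeta:P_p(f)\Rightarrow f$, and invertible adjustments $\sigma:\zeta\circ P(\zeta)\Rrightarrow\zeta\circ m_f$, $\tau:\zeta\circ h_f\Rrightarrow\mathrm{id}_f$ such that, writing $\alpha_f:m_f\circ P(m_f)\Rrightarrow m_f\circ m_{P(f)}$ and $\lambda_f:m_f\circ P(h_f)\Rrightarrow\mathrm{id}$ for the structure 2-cells of $\mathbb P^+$: (1) $\zeta\circ P(\sigma)$ followed by $\sigma\circ P(m_f)$ followed by $\zeta\circ\alpha_f$ equals $\sigma\circ P(P(\zeta))$ followed by the pseudonaturality isomorphism $\zeta m_fP(P(\zeta))\cong\zeta P(\zeta)m_{P(f)}$ followed by $\sigma\circ m_{P(f)}$; (2) $\sigma\circ P(h_f)$ followed by $\zeta\circ\lambda_f$ equals $\zeta\circ P(\tau)$. *)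

theory Defs
  imports Main
begin

text \<open>
  Presheaves over a small category are set-valued, with elements drawn from an arbitrary HOL type.
  HOL has no type that is closed under exponentials, so the element type varies from presheaf to
  presheaf: each construction on presheaves is polymorphic in the element types of its arguments and
  yields a presheaf over a (usually larger) type.  Every family of functions is extensional
  (\<^term>\<open>undefined\<close> off its domain), so that HOL equality is equality of morphisms.
\<close>

record ('o, 'm) cat =
  Obj :: "'o set"
  Arr :: "'m set"
  Src :: "'m \<Rightarrow> 'o"
  Tgt :: "'m \<Rightarrow> 'o"
  Ident :: "'o \<Rightarrow> 'm"
  Comp :: "'m \<Rightarrow> 'm \<Rightarrow> 'm"

definition Hom :: "('o, 'm) cat \<Rightarrow> 'o \<Rightarrow> 'o \<Rightarrow> 'm set" where
  "Hom C \<Delta> \<Gamma> = {\<sigma> \<in> Arr C. Src C \<sigma> = \<Delta> \<and> Tgt C \<sigma> = \<Gamma>}"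

record ('o, 'm, 'x) presheaf =
  El :: "'o \<Rightarrow> 'x set"
  Res :: "'m \<Rightarrow> 'x \<Rightarrow> 'x"

text \<open>A morphism \<open>Map : Tot \<rightarrow> Base\<close> of presheaves, i.e. a polynomial \<open>1 \<rightarrow> 1\<close>.\<close>

record ('o, 'm, 'b, 'a) polynomial =
  Tot :: "('o, 'm, 'b) presheaf"
  Base :: "('o, 'm, 'a) presheaf"
  Map :: "'o \<Rightarrow> 'b \<Rightarrow> 'a"

text \<open>A square from \<open>Dm\<close> to \<open>Cd\<close>: \<open>c0\<close> is the bottom map \<open>\<phi>\<^sub>0\<close>, \<open>c1\<close> the top map \<open>\<phi>\<^sub>1\<close>.\<close>

record ('o, 'm, 'b, 'a, 'd, 'c) cell =
  Dm :: "('o, 'm, 'b, 'a) polynomial"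
  Cd :: "('o, 'm, 'd, 'c) polynomial"
  c0 :: "'o \<Rightarrow> 'a \<Rightarrow> 'c"
  c1 :: "'o \<Rightarrow> 'b \<Rightarrow> 'd"

record ('o, 'm, 'b, 'a, 'd, 'c) adj =
  Dm3 :: "('o, 'm, 'b, 'a, 'd, 'c) cell"
  Cd3 :: "('o, 'm, 'b, 'a, 'd, 'c) cell"
  amap :: "'o \<Rightarrow> 'a \<times> 'd \<Rightarrow> 'a \<times> 'd"

locale category =
  fixes C :: "('o, 'm) cat"
  assumes Src_in: "\<sigma> \<in> Arr C \<Longrightarrow> Src C \<sigma> \<in> Obj C"
    and Tgt_in: "\<sigma> \<in> Arr C \<Longrightarrow> Tgt C \<sigma> \<in> Obj C"
    and Ident_in: "\<Gamma> \<in> Obj C \<Longrightarrow> Ident C \<Gamma> \<in> Hom C \<Gamma> \<Gamma>"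
    and Comp_in: "\<sigma> \<in> Hom C \<Delta> \<Gamma> \<Longrightarrow> \<tau> \<in> Hom C \<Xi> \<Delta> \<Longrightarrow> Comp C \<sigma> \<tau> \<in> Hom C \<Xi> \<Gamma>"
    and Comp_Ident: "\<sigma> \<in> Hom C \<Delta> \<Gamma> \<Longrightarrow> Comp C \<sigma> (Ident C \<Delta>) = \<sigma>"
    and Ident_Comp: "\<sigma> \<in> Hom C \<Delta> \<Gamma> \<Longrightarrow> Comp C (Ident C \<Gamma>) \<sigma> = \<sigma>"
    and Comp_assoc: "\<sigma> \<in> Hom C \<Delta> \<Gamma> \<Longrightarrow> \<tau> \<in> Hom C \<Xi> \<Delta> \<Longrightarrow> \<upsilon> \<in> Hom C \<Theta> \<Xi> \<Longrightarrow>
      Comp C (Comp C \<sigma> \<tau>) \<upsilon> = Comp C \<sigma> (Comp C \<tau> \<upsilon>)"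
begin


section \<open>Presheaves\<close>

definition presheaf :: "('o, 'm, 'x) presheaf \<Rightarrow> bool" where
  "presheaf F \<longleftrightarrow>
    (\<forall>\<Delta> \<Gamma>. \<forall>\<sigma> \<in> Hom C \<Delta> \<Gamma>. \<forall>x \<in> El F \<Gamma>. Res F \<sigma> x \<in> El F \<Delta>) \<and>
    (\<forall>\<Gamma> \<in> Obj C. \<forall>x \<in> El F \<Gamma>. Res F (Ident C \<Gamma>) x = x) \<and>
    (\<forall>\<Xi> \<Delta> \<Gamma>. \<forall>\<sigma> \<in> Hom C \<Delta> \<Gamma>. \<forall>\<tau> \<in> Hom C \<Xi> \<Delta>. \<forall>x \<in> El F \<Gamma>.
      Res F (Comp C \<sigma> \<tau>) x = Res F \<tau> (Res F \<sigma> x))"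

definition nat_trans ::
    "('o, 'm, 'x) presheaf \<Rightarrow> ('o, 'm, 'y) presheaf \<Rightarrow> ('o \<Rightarrow> 'x \<Rightarrow> 'y) \<Rightarrow> bool" where
  "nat_trans F G t \<longleftrightarrow>
    (\<forall>\<Gamma> \<in> Obj C. \<forall>x \<in> El F \<Gamma>. t \<Gamma> x \<in> El G \<Gamma>) \<and>
    (\<forall>\<Delta> \<Gamma>. \<forall>\<sigma> \<in> Hom C \<Delta> \<Gamma>. \<forall>x \<in> El F \<Gamma>. t \<Delta> (Res F \<sigma> x) = Res G \<sigma> (t \<Gamma> x)) \<and>
    (\<forall>\<Gamma> x. \<not> (\<Gamma> \<in> Obj C \<and> x \<in> El F \<Gamma>) \<longrightarrow> t \<Gamma> x = undefined)"

definition on :: "('o, 'm, 'x) presheaf \<Rightarrow> ('o \<Rightarrow> 'x \<Rightarrow> 'y) \<Rightarrow> 'o \<Rightarrow> 'x \<Rightarrow> 'y" where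
  "on F t = (\<lambda>\<Gamma> x. if \<Gamma> \<in> Obj C \<and> x \<in> El F \<Gamma> then t \<Gamma> x else undefined)"

definition ncomp :: "('o, 'm, 'x) presheaf \<Rightarrow> ('o \<Rightarrow> 'y \<Rightarrow> 'z) \<Rightarrow> ('o \<Rightarrow> 'x \<Rightarrow> 'y) \<Rightarrow> 'o \<Rightarrow> 'x \<Rightarrow> 'z"
  where "ncomp F t s = on F (\<lambda>\<Gamma> x. t \<Gamma> (s \<Gamma> x))"

definition nid :: "('o, 'm, 'x) presheaf \<Rightarrow> 'o \<Rightarrow> 'x \<Rightarrow> 'x" where
  "nid F = on F (\<lambda>\<Gamma> x. x)"

definition yo :: "'o \<Rightarrow> ('o, 'm, 'm) presheaf" where
  "yo \<Gamma> = \<lparr>El = (\<lambda>\<Delta>. Hom C \<Delta> \<Gamma>), Res = (\<lambda>\<tau> \<sigma>. Comp C \<sigma> \<tau>)\<rparr>"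

definition yo_map :: "'m \<Rightarrow> 'o \<Rightarrow> 'm \<Rightarrow> 'm" where
  "yo_map \<sigma> = on (yo (Src C \<sigma>)) (\<lambda>\<Delta> \<tau>. Comp C \<sigma> \<tau>)"

text \<open>The map \<open>y(\<Gamma>) \<rightarrow> F\<close> corresponding to \<open>x \<in> F(\<Gamma>)\<close> by Yoneda.\<close>

definition yoneda :: "('o, 'm, 'x) presheaf \<Rightarrow> 'o \<Rightarrow> 'x \<Rightarrow> 'o \<Rightarrow> 'm \<Rightarrow> 'x" where
  "yoneda F \<Gamma> x = on (yo \<Gamma>) (\<lambda>\<Delta> \<sigma>. Res F \<sigma> x)"

definition one :: "('o, 'm, unit) presheaf" where
  "one = \<lparr>El = (\<lambda>_. UNIV), Res = (\<lambda>_ x. x)\<rparr>"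

text \<open>The chosen pullback of a cospan \<open>s : X \<rightarrow> Z \<leftarrow> Y : t\<close>.\<close>

definition pb :: "('o, 'm, 'x) presheaf \<Rightarrow> ('o, 'm, 'y) presheaf \<Rightarrow>
    ('o \<Rightarrow> 'x \<Rightarrow> 'z) \<Rightarrow> ('o \<Rightarrow> 'y \<Rightarrow> 'z) \<Rightarrow> ('o, 'm, 'x \<times> 'y) presheaf" where
  "pb X Y s t = \<lparr>El = (\<lambda>\<Gamma>. {(x, y). x \<in> El X \<Gamma> \<and> y \<in> El Y \<Gamma> \<and> s \<Gamma> x = t \<Gamma> y}),
    Res = (\<lambda>\<sigma> (x, y). (Res X \<sigma> x, Res Y \<sigma> y))\<rparr>"


section \<open>Polynomials and their extensions\<close>

definition polynomial :: "('o, 'm, 'b, 'a) polynomial \<Rightarrow> bool" where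
  "polynomial f \<longleftrightarrow> presheaf (Tot f) \<and> presheaf (Base f) \<and> nat_trans (Tot f) (Base f) (Map f)"

definition pid :: "('o, 'm, unit, unit) polynomial" where
  "pid = \<lparr>Tot = one, Base = one, Map = nid one\<rparr>"

text \<open>The fibre \<open>B\<^sub>a\<close> over \<open>a \<in> A(\<Gamma>)\<close>, as a presheaf over \<open>y(\<Gamma>)\<close>: the pullback of
  \<open>f : B \<rightarrow> A\<close> along \<open>a : y(\<Gamma>) \<rightarrow> A\<close>.\<close>

definition fibre :: "('o, 'm, 'b, 'a) polynomial \<Rightarrow> 'o \<Rightarrow> 'a \<Rightarrow> ('o, 'm, 'm \<times> 'b) presheaf" where
  "fibre f \<Gamma> a = pb (yo \<Gamma>) (Tot f) (yoneda (Base f) \<Gamma> a) (Map f)"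

text \<open>\<open>P\<^sub>f(X) = \<Sum>\<^bsub>a\<in>A\<^esub> X\<^sup>B\<^sub>a\<close>.  By the standard description of exponentials in slices of a presheaf
  category, the elements of \<open>X\<^sup>B\<^sub>a\<close> over \<open>a \<in> A(\<Gamma>)\<close> are the maps \<open>y(\<Gamma>) \<times>\<^sub>A B \<rightarrow> X\<close>.\<close>

definition ext ::
    "('o, 'm, 'b, 'a) polynomial \<Rightarrow> ('o, 'm, 'x) presheaf \<Rightarrow>
     ('o, 'm, 'a \<times> ('o \<Rightarrow> 'm \<times> 'b \<Rightarrow> 'x)) presheaf" where
  "ext f X = \<lparr>El = (\<lambda>\<Gamma>. {(a, m). a \<in> El (Base f) \<Gamma> \<and> nat_trans (fibre f \<Gamma> a) X m}),
    Res = (\<lambda>\<rho> (a, m). (Res (Base f) \<rho> a,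
      on (fibre f (Src C \<rho>) (Res (Base f) \<rho> a)) (\<lambda>\<Delta> (\<sigma>, b). m \<Delta> (Comp C \<rho> \<sigma>, b))))\<rparr>"

text \<open>\<open>P\<^sub>f(h)\<close> for \<open>h\<close> with domain \<open>X\<close>.\<close>

definition ext_map ::
    "('o, 'm, 'b, 'a) polynomial \<Rightarrow> ('o, 'm, 'x) presheaf \<Rightarrow> ('o \<Rightarrow> 'x \<Rightarrow> 'y) \<Rightarrow>
     'o \<Rightarrow> 'a \<times> ('o \<Rightarrow> 'm \<times> 'b \<Rightarrow> 'x) \<Rightarrow> 'a \<times> ('o \<Rightarrow> 'm \<times> 'b \<Rightarrow> 'y)" where
  "ext_map f X h = on (ext f X) (\<lambda>\<Gamma> (a, m). (a, ncomp (fibre f \<Gamma> a) h m))"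

definition ext_poly ::
    "('o, 'm, 'd, 'c) polynomial \<Rightarrow> ('o, 'm, 'b, 'a) polynomial \<Rightarrow>
     ('o, 'm, 'c \<times> ('o \<Rightarrow> 'm \<times> 'd \<Rightarrow> 'b), 'c \<times> ('o \<Rightarrow> 'm \<times> 'd \<Rightarrow> 'a)) polynomial" where
  "ext_poly g f = \<lparr>Tot = ext g (Tot f), Base = ext g (Base f), Map = ext_map g (Tot f) (Map f)\<rparr>"

text \<open>\<open>g \<cdot> f : \<Sum>\<^bsub>(c,m)\<in>M\<^esub> \<Sum>\<^bsub>d\<in>D\<^sub>c\<^esub> B\<^bsub>m(d)\<^esub> \<rightarrow> M\<close> with \<open>M = \<Sum>\<^bsub>c\<in>C\<^esub> A\<^sup>D\<^sub>c\<close>.  An element of the total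
  space is written \<open>((c, m), d, b)\<close>; the value \<open>m(d)\<close> is the component of \<open>m\<close> at the identity.\<close>

definition pcomp (infixr \<open>\<cdot>\<close> 70) where
  "(g :: ('o, 'm, 'd, 'c) polynomial) \<cdot> (f :: ('o, 'm, 'b, 'a) polynomial) =
    (let M = ext g (Base f);
         T = \<lparr>El = (\<lambda>\<Gamma>. {((c, m), d, b). (c, m) \<in> El M \<Gamma> \<and> d \<in> El (Tot g) \<Gamma> \<and> Map g \<Gamma> d = c \<and>
                b \<in> El (Tot f) \<Gamma> \<and> Map f \<Gamma> b = m \<Gamma> (Ident C \<Gamma>, d)}),
              Res = (\<lambda>\<sigma> (e, d, b). (Res M \<sigma> e, Res (Tot g) \<sigma> d, Res (Tot f) \<sigma> b))\<rparr>
     in \<lparr>Tot = T, Base = M, Map = on T (\<lambda>\<Gamma>. fst)\<rparr>)"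

text \<open>The isomorphisms \<open>X \<cong> P\<^bsub>i\<^esub>(X)\<close> and \<open>P\<^sub>g(P\<^sub>f(X)) \<cong> P\<^bsub>g\<cdot>f\<^esub>(X)\<close>.\<close>

definition ext_unit_iso :: "('o, 'm, 'x) presheaf \<Rightarrow>
    'o \<Rightarrow> 'x \<Rightarrow> unit \<times> ('o \<Rightarrow> 'm \<times> unit \<Rightarrow> 'x)" where
  "ext_unit_iso X = on X (\<lambda>\<Gamma> x. ((), on (fibre pid \<Gamma> ()) (\<lambda>\<Delta> (\<sigma>, _). Res X \<sigma> x)))"

definition ext_comp_iso where
  "ext_comp_iso (g :: ('o, 'm, 'd, 'c) polynomial) (f :: ('o, 'm, 'b, 'a) polynomial)
      (X :: ('o, 'm, 'x) presheaf) =
    on (ext g (ext f X)) (\<lambda>\<Gamma> (c, n).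
      let e = (c, on (fibre g \<Gamma> c) (\<lambda>\<Delta> z. fst (n \<Delta> z)))
      in (e, on (fibre (g \<cdot> f) \<Gamma> e) (\<lambda>\<Delta> (\<sigma>, _, d, b). snd (n \<Delta> (\<sigma>, d)) \<Delta> (Ident C \<Delta>, b))))"


section \<open>Cartesian morphisms of polynomials\<close>

definition square :: "('o, 'm, 'b, 'a, 'd, 'c) cell \<Rightarrow> bool" where
  "square \<phi> \<longleftrightarrow> polynomial (Dm \<phi>) \<and> polynomial (Cd \<phi>) \<and>
    nat_trans (Base (Dm \<phi>)) (Base (Cd \<phi>)) (c0 \<phi>) \<and>
    nat_trans (Tot (Dm \<phi>)) (Tot (Cd \<phi>)) (c1 \<phi>) \<and>
    ncomp (Tot (Dm \<phi>)) (c0 \<phi>) (Map (Dm \<phi>)) = ncomp (Tot (Dm \<phi>)) (Map (Cd \<phi>)) (c1 \<phi>)"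

definition cone :: "('o, 'm, 'b, 'a, 'd, 'c) cell \<Rightarrow> ('o, 'm, 'z) presheaf \<Rightarrow>
    ('o \<Rightarrow> 'z \<Rightarrow> 'a) \<Rightarrow> ('o \<Rightarrow> 'z \<Rightarrow> 'd) \<Rightarrow> bool" where
  "cone \<phi> Z h k \<longleftrightarrow> presheaf Z \<and> nat_trans Z (Base (Dm \<phi>)) h \<and> nat_trans Z (Tot (Cd \<phi>)) k \<and>
    ncomp Z (c0 \<phi>) h = ncomp Z (Map (Cd \<phi>)) k"

text \<open>A pullback square.  A quantifier over presheaves has to fix their element type.  The type
  \<^typ>\<open>'m\<close> of arrows chosen here admits the representables as test objects, and by Yoneda the
  universal property then holds against presheaves with elements of any type
  (\<open>cartesian_universal\<close> below).\<close>

definition cartesian :: "('o, 'm, 'b, 'a, 'd, 'c) cell \<Rightarrow> bool" where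
  "cartesian \<phi> \<longleftrightarrow> square \<phi> \<and>
    (\<forall>(Z :: ('o, 'm, 'm) presheaf) h k. cone \<phi> Z h k \<longrightarrow>
      (\<exists>!u. nat_trans Z (Tot (Dm \<phi>)) u \<and>
        ncomp Z (Map (Dm \<phi>)) u = h \<and> ncomp Z (c1 \<phi>) u = k))"

lemma Hom_Obj: "\<sigma> \<in> Hom C \<Delta> \<Gamma> \<Longrightarrow> \<Delta> \<in> Obj C \<and> \<Gamma> \<in> Obj C"
  by (auto simp: Hom_def dest: Src_in Tgt_in)

lemma presheaf_ResD: "presheaf F \<Longrightarrow> \<sigma> \<in> Hom C \<Delta> \<Gamma> \<Longrightarrow> x \<in> El F \<Gamma> \<Longrightarrow> Res F \<sigma> x \<in> El F \<Delta>"
  by (auto simp: presheaf_def)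

lemma presheaf_IdentD: "presheaf F \<Longrightarrow> \<Gamma> \<in> Obj C \<Longrightarrow> x \<in> El F \<Gamma> \<Longrightarrow> Res F (Ident C \<Gamma>) x = x"
  by (auto simp: presheaf_def)

lemma presheaf_CompD: "presheaf F \<Longrightarrow> \<sigma> \<in> Hom C \<Delta> \<Gamma> \<Longrightarrow> \<tau> \<in> Hom C \<Xi> \<Delta> \<Longrightarrow> x \<in> El F \<Gamma> \<Longrightarrow>
    Res F (Comp C \<sigma> \<tau>) x = Res F \<tau> (Res F \<sigma> x)"
  unfolding presheaf_def by blast

lemma nat_trans_in: "nat_trans F G t \<Longrightarrow> \<Gamma> \<in> Obj C \<Longrightarrow> x \<in> El F \<Gamma> \<Longrightarrow> t \<Gamma> x \<in> El G \<Gamma>"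
  by (auto simp: nat_trans_def)

lemma nat_trans_natural: "nat_trans F G t \<Longrightarrow> \<sigma> \<in> Hom C \<Delta> \<Gamma> \<Longrightarrow> x \<in> El F \<Gamma> \<Longrightarrow>
    t \<Delta> (Res F \<sigma> x) = Res G \<sigma> (t \<Gamma> x)"
  by (auto simp: nat_trans_def)

lemma nat_trans_undefined: "nat_trans F G t \<Longrightarrow> \<not> (\<Gamma> \<in> Obj C \<and> x \<in> El F \<Gamma>) \<Longrightarrow> t \<Gamma> x = undefined"
  unfolding nat_trans_def by blast

lemma nat_trans_eqI:
  assumes "nat_trans F G s" "nat_trans F H t"
    and "\<And>\<Gamma> x. \<Gamma> \<in> Obj C \<Longrightarrow> x \<in> El F \<Gamma> \<Longrightarrow> s \<Gamma> x = t \<Gamma> x"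
  shows "s = t"
proof (intro ext)
  fix \<Gamma> x show "s \<Gamma> x = t \<Gamma> x"
    using assms(3)[of \<Gamma> x] nat_trans_undefined[OF assms(1), of \<Gamma> x]
      nat_trans_undefined[OF assms(2), of \<Gamma> x] by (cases "\<Gamma> \<in> Obj C \<and> x \<in> El F \<Gamma>") simp_all
qed

lemma nat_trans_onI:
  assumes "presheaf F" "\<And>\<Gamma> x. \<Gamma> \<in> Obj C \<Longrightarrow> x \<in> El F \<Gamma> \<Longrightarrow> t \<Gamma> x \<in> El G \<Gamma>"
    and "\<And>\<Delta> \<Gamma> \<sigma> x. \<sigma> \<in> Hom C \<Delta> \<Gamma> \<Longrightarrow> x \<in> El F \<Gamma> \<Longrightarrow> t \<Delta> (Res F \<sigma> x) = Res G \<sigma> (t \<Gamma> x)"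
  shows "nat_trans F G (on F t)"
  unfolding nat_trans_def using assms by (auto simp: on_def presheaf_ResD dest: Hom_Obj)

lemma nat_trans_ncomp:
  assumes "presheaf F" "nat_trans F G s" "nat_trans G H t"
  shows "nat_trans F H (ncomp F t s)"
  unfolding ncomp_def
proof (rule nat_trans_onI[OF assms(1)])
  fix \<Gamma> x assume "\<Gamma> \<in> Obj C" "x \<in> El F \<Gamma>"
  then show "t \<Gamma> (s \<Gamma> x) \<in> El H \<Gamma>"
    using nat_trans_in[OF assms(2)] nat_trans_in[OF assms(3)] by blast
next
  fix \<Delta> \<Gamma> \<sigma> x assume s: "\<sigma> \<in> Hom C \<Delta> \<Gamma>" and x: "x \<in> El F \<Gamma>"
  then have "s \<Gamma> x \<in> El G \<Gamma>" using nat_trans_in[OF assms(2)] Hom_Obj by blast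
  then show "t \<Delta> (s \<Delta> (Res F \<sigma> x)) = Res H \<sigma> (t \<Gamma> (s \<Gamma> x))"
    using nat_trans_natural[OF assms(2) s x] nat_trans_natural[OF assms(3) s] by simp
qed

lemma ncomp_eqD: "ncomp F s t = ncomp F s' t' \<Longrightarrow> \<Gamma> \<in> Obj C \<Longrightarrow> x \<in> El F \<Gamma> \<Longrightarrow>
    s \<Gamma> (t \<Gamma> x) = s' \<Gamma> (t' \<Gamma> x)"
  by (drule fun_cong[where x = \<Gamma>], drule fun_cong[where x = x]) (simp add: ncomp_def on_def)

lemma presheaf_yo: "presheaf (yo \<Gamma>)"
  unfolding presheaf_def yo_def by (auto simp: Comp_in Comp_Ident Comp_assoc)

lemma nat_trans_yoneda:
  assumes "presheaf F" "\<Gamma> \<in> Obj C" "x \<in> El F \<Gamma>"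
  shows "nat_trans (yo \<Gamma>) F (yoneda F \<Gamma> x)"
  unfolding yoneda_def
  by (rule nat_trans_onI[OF presheaf_yo])
     (use assms in \<open>auto simp: yo_def presheaf_ResD presheaf_CompD\<close>)

lemma yoneda_Ident: "presheaf F \<Longrightarrow> \<Gamma> \<in> Obj C \<Longrightarrow> x \<in> El F \<Gamma> \<Longrightarrow> yoneda F \<Gamma> x \<Gamma> (Ident C \<Gamma>) = x"
  by (auto simp: yoneda_def yo_def on_def Ident_in presheaf_IdentD)

lemma ncomp_yoneda:
  assumes "presheaf F" "\<Gamma> \<in> Obj C" "x \<in> El F \<Gamma>" "nat_trans F G t"
  shows "ncomp (yo \<Gamma>) t (yoneda F \<Gamma> x) = yoneda G \<Gamma> (t \<Gamma> x)"
  using assms by (auto simp: fun_eq_iff ncomp_def yoneda_def on_def yo_def nat_trans_natural)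

lemma yoneda_eq:
  assumes "presheaf F" "\<Gamma> \<in> Obj C" "nat_trans (yo \<Gamma>) F t"
  shows "t = yoneda F \<Gamma> (t \<Gamma> (Ident C \<Gamma>))" and "t \<Gamma> (Ident C \<Gamma>) \<in> El F \<Gamma>"
proof -
  have I: "Ident C \<Gamma> \<in> El (yo \<Gamma>) \<Gamma>" using assms(2) by (simp add: yo_def Ident_in)
  show 1: "t \<Gamma> (Ident C \<Gamma>) \<in> El F \<Gamma>" using nat_trans_in[OF assms(3,2) I] .
  show "t = yoneda F \<Gamma> (t \<Gamma> (Ident C \<Gamma>))"
  proof (rule nat_trans_eqI[OF assms(3) nat_trans_yoneda[OF assms(1,2) 1]])
    fix \<Delta> \<sigma> assume "\<Delta> \<in> Obj C" and s: "\<sigma> \<in> El (yo \<Gamma>) \<Delta>"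
    then have s': "\<sigma> \<in> Hom C \<Delta> \<Gamma>" by (simp add: yo_def)
    have "t \<Delta> (Res (yo \<Gamma>) \<sigma> (Ident C \<Gamma>)) = Res F \<sigma> (t \<Gamma> (Ident C \<Gamma>))"
      by (rule nat_trans_natural[OF assms(3) s' I])
    then show "t \<Delta> \<sigma> = yoneda F \<Gamma> (t \<Gamma> (Ident C \<Gamma>)) \<Delta> \<sigma>"
      using s s' \<open>\<Delta> \<in> Obj C\<close> by (simp add: yoneda_def on_def yo_def Ident_Comp)
  qed
qed

lemma square_comm: "square \<phi> \<Longrightarrow> \<Gamma> \<in> Obj C \<Longrightarrow> b \<in> El (Tot (Dm \<phi>)) \<Gamma> \<Longrightarrow>
    c0 \<phi> \<Gamma> (Map (Dm \<phi>) \<Gamma> b) = Map (Cd \<phi>) \<Gamma> (c1 \<phi> \<Gamma> b)"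
  unfolding square_def using ncomp_eqD by fastforce

lemma pointwise_universal:
  assumes sq: "square \<phi>"
    and pw: "\<And>\<Gamma> a d. \<Gamma> \<in> Obj C \<Longrightarrow> a \<in> El (Base (Dm \<phi>)) \<Gamma> \<Longrightarrow> d \<in> El (Tot (Cd \<phi>)) \<Gamma> \<Longrightarrow>
      c0 \<phi> \<Gamma> a = Map (Cd \<phi>) \<Gamma> d \<Longrightarrow>
      \<exists>!b. b \<in> El (Tot (Dm \<phi>)) \<Gamma> \<and> Map (Dm \<phi>) \<Gamma> b = a \<and> c1 \<phi> \<Gamma> b = d"
    and cone: "cone \<phi> Z h k"
  shows "\<exists>!u. nat_trans Z (Tot (Dm \<phi>)) u \<and> ncomp Z (Map (Dm \<phi>)) u = h \<and> ncomp Z (c1 \<phi>) u = k"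
proof -
  note sq' = sq[unfolded square_def polynomial_def]
  note co' = cone[unfolded cone_def]
  let ?B = "Tot (Dm \<phi>)"
  let ?P = "\<lambda>\<Gamma> z b. b \<in> El ?B \<Gamma> \<and> Map (Dm \<phi>) \<Gamma> b = h \<Gamma> z \<and> c1 \<phi> \<Gamma> b = k \<Gamma> z"
  have ex: "\<exists>!b. ?P \<Gamma> z b" if "\<Gamma> \<in> Obj C" "z \<in> El Z \<Gamma>" for \<Gamma> z
    using that co' ncomp_eqD[of Z "c0 \<phi>" h "Map (Cd \<phi>)" k \<Gamma> z]
    by (intro pw) (auto intro: nat_trans_in)
  define v where "v = (\<lambda>\<Gamma> z. THE b. ?P \<Gamma> z b)"
  have v: "?P \<Gamma> z (v \<Gamma> z)" if "\<Gamma> \<in> Obj C" "z \<in> El Z \<Gamma>" for \<Gamma> z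
    unfolding v_def by (rule theI'[OF ex[OF that]])
  have nu: "nat_trans Z ?B (on Z v)"
  proof (rule nat_trans_onI)
    show "presheaf Z" using co' by simp
  next
    fix \<Gamma> z assume "\<Gamma> \<in> Obj C" "z \<in> El Z \<Gamma>" then show "v \<Gamma> z \<in> El ?B \<Gamma>" using v by blast
  next
    fix \<Delta> \<Gamma> \<sigma> z assume s: "\<sigma> \<in> Hom C \<Delta> \<Gamma>" and z: "z \<in> El Z \<Gamma>"
    note o = Hom_Obj[OF s]
    have z': "Res Z \<sigma> z \<in> El Z \<Delta>" using co' s z by (blast intro: presheaf_ResD)
    have vz: "?P \<Gamma> z (v \<Gamma> z)" using v o z by blast
    have "?P \<Delta> (Res Z \<sigma> z) (Res ?B \<sigma> (v \<Gamma> z))"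
    proof (intro conjI)
      show "Res ?B \<sigma> (v \<Gamma> z) \<in> El ?B \<Delta>" using sq' s vz by (blast intro: presheaf_ResD)
      have "Map (Dm \<phi>) \<Delta> (Res ?B \<sigma> (v \<Gamma> z)) = Res (Base (Dm \<phi>)) \<sigma> (Map (Dm \<phi>) \<Gamma> (v \<Gamma> z))"
        using sq' s vz by (blast intro: nat_trans_natural)
      also have "\<dots> = h \<Delta> (Res Z \<sigma> z)"
        using vz nat_trans_natural[of Z "Base (Dm \<phi>)" h \<sigma> \<Delta> \<Gamma> z] co' s z by simp
      finally show "Map (Dm \<phi>) \<Delta> (Res ?B \<sigma> (v \<Gamma> z)) = h \<Delta> (Res Z \<sigma> z)" .
      have "c1 \<phi> \<Delta> (Res ?B \<sigma> (v \<Gamma> z)) = Res (Tot (Cd \<phi>)) \<sigma> (c1 \<phi> \<Gamma> (v \<Gamma> z))"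
        using sq' s vz by (blast intro: nat_trans_natural)
      also have "\<dots> = k \<Delta> (Res Z \<sigma> z)"
        using vz nat_trans_natural[of Z "Tot (Cd \<phi>)" k \<sigma> \<Delta> \<Gamma> z] co' s z by simp
      finally show "c1 \<phi> \<Delta> (Res ?B \<sigma> (v \<Gamma> z)) = k \<Delta> (Res Z \<sigma> z)" .
    qed
    then show "v \<Delta> (Res Z \<sigma> z) = Res ?B \<sigma> (v \<Gamma> z)"
      using v[of \<Delta> "Res Z \<sigma> z"] ex[of \<Delta> "Res Z \<sigma> z"] o z' by blast
  qed
  show ?thesis
  proof (rule ex1I[of _ "on Z v"], intro conjI)
    show "nat_trans Z ?B (on Z v)" by (rule nu)
    show "ncomp Z (Map (Dm \<phi>)) (on Z v) = h"
    proof (intro ext)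
      fix \<Gamma> z show "ncomp Z (Map (Dm \<phi>)) (on Z v) \<Gamma> z = h \<Gamma> z"
        using v[of \<Gamma> z] nat_trans_undefined[of Z _ h \<Gamma> z] co' by (auto simp: ncomp_def on_def)
    qed
    show "ncomp Z (c1 \<phi>) (on Z v) = k"
    proof (intro ext)
      fix \<Gamma> z show "ncomp Z (c1 \<phi>) (on Z v) \<Gamma> z = k \<Gamma> z"
        using v[of \<Gamma> z] nat_trans_undefined[of Z _ k \<Gamma> z] co' by (auto simp: ncomp_def on_def)
    qed
  next
    fix u assume u: "nat_trans Z ?B u \<and> ncomp Z (Map (Dm \<phi>)) u = h \<and> ncomp Z (c1 \<phi>) u = k"
    show "u = on Z v"
    proof (rule nat_trans_eqI[of Z ?B u ?B])
      show "nat_trans Z ?B u" using u by simp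
      show "nat_trans Z ?B (on Z v)" by (rule nu)
      fix \<Gamma> z assume g: "\<Gamma> \<in> Obj C" "z \<in> El Z \<Gamma>"
      have "?P \<Gamma> z (u \<Gamma> z)"
        using u g by (auto simp: ncomp_def on_def intro: nat_trans_in)
      then show "u \<Gamma> z = on Z v \<Gamma> z" using v[OF g] ex[OF g] g by (auto simp: on_def)
    qed
  qed
qed

lemma cartesian_pointwise:
  "cartesian \<phi> \<longleftrightarrow> square \<phi> \<and>
    (\<forall>\<Gamma> \<in> Obj C. \<forall>a \<in> El (Base (Dm \<phi>)) \<Gamma>. \<forall>d \<in> El (Tot (Cd \<phi>)) \<Gamma>.
      c0 \<phi> \<Gamma> a = Map (Cd \<phi>) \<Gamma> d \<longrightarrow>
      (\<exists>!b. b \<in> El (Tot (Dm \<phi>)) \<Gamma> \<and> Map (Dm \<phi>) \<Gamma> b = a \<and> c1 \<phi> \<Gamma> b = d))"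
    (is "_ \<longleftrightarrow> square \<phi> \<and> ?pw")
proof
  assume c: "cartesian \<phi>"
  then have sq: "square \<phi>" by (simp add: cartesian_def)
  note sq' = sq[unfolded square_def polynomial_def]
  have ?pw
  proof (intro ballI impI)
    fix \<Gamma> a d
    assume g: "\<Gamma> \<in> Obj C" and a: "a \<in> El (Base (Dm \<phi>)) \<Gamma>" and d: "d \<in> El (Tot (Cd \<phi>)) \<Gamma>"
      and ad: "c0 \<phi> \<Gamma> a = Map (Cd \<phi>) \<Gamma> d"
    let ?h = "yoneda (Base (Dm \<phi>)) \<Gamma> a" and ?k = "yoneda (Tot (Cd \<phi>)) \<Gamma> d"
    have "cone \<phi> (yo \<Gamma>) ?h ?k"
      unfolding cone_def
      using sq' g a d ad by (auto simp: presheaf_yo nat_trans_yoneda ncomp_yoneda)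
    then have ex: "\<exists>!u. nat_trans (yo \<Gamma>) (Tot (Dm \<phi>)) u \<and>
        ncomp (yo \<Gamma>) (Map (Dm \<phi>)) u = ?h \<and> ncomp (yo \<Gamma>) (c1 \<phi>) u = ?k"
      using c by (simp add: cartesian_def)
    then obtain u where u: "nat_trans (yo \<Gamma>) (Tot (Dm \<phi>)) u"
        "ncomp (yo \<Gamma>) (Map (Dm \<phi>)) u = ?h" "ncomp (yo \<Gamma>) (c1 \<phi>) u = ?k" by blast
    let ?b = "u \<Gamma> (Ident C \<Gamma>)"
    have I: "Ident C \<Gamma> \<in> El (yo \<Gamma>) \<Gamma>" using g by (simp add: yo_def Ident_in)
    show "\<exists>!b. b \<in> El (Tot (Dm \<phi>)) \<Gamma> \<and> Map (Dm \<phi>) \<Gamma> b = a \<and> c1 \<phi> \<Gamma> b = d"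
    proof (rule ex1I[of _ ?b], intro conjI)
      show "?b \<in> El (Tot (Dm \<phi>)) \<Gamma>" using nat_trans_in[OF u(1) g I] .
      show "Map (Dm \<phi>) \<Gamma> ?b = a"
        using fun_cong[OF fun_cong[OF u(2)], of \<Gamma> "Ident C \<Gamma>"] sq' g a I
        by (simp add: ncomp_def on_def yoneda_Ident)
      show "c1 \<phi> \<Gamma> ?b = d"
        using fun_cong[OF fun_cong[OF u(3)], of \<Gamma> "Ident C \<Gamma>"] sq' g d I
        by (simp add: ncomp_def on_def yoneda_Ident)
    next
      fix b assume b: "b \<in> El (Tot (Dm \<phi>)) \<Gamma> \<and> Map (Dm \<phi>) \<Gamma> b = a \<and> c1 \<phi> \<Gamma> b = d"
      let ?v = "yoneda (Tot (Dm \<phi>)) \<Gamma> b"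
      have "nat_trans (yo \<Gamma>) (Tot (Dm \<phi>)) ?v"
        "ncomp (yo \<Gamma>) (Map (Dm \<phi>)) ?v = ?h" "ncomp (yo \<Gamma>) (c1 \<phi>) ?v = ?k"
        using sq' g b
          ncomp_yoneda[of "Tot (Dm \<phi>)" \<Gamma> b "Base (Dm \<phi>)" "Map (Dm \<phi>)"]
          ncomp_yoneda[of "Tot (Dm \<phi>)" \<Gamma> b "Tot (Cd \<phi>)" "c1 \<phi>"]
        by (auto simp: nat_trans_yoneda)
      then have "?v = u" using ex u by blast
      then show "b = ?b" using yoneda_Ident[of "Tot (Dm \<phi>)" \<Gamma> b] sq' g b by simp
    qed
  qed
  with sq show "square \<phi> \<and> ?pw" by blast
next
  assume s: "square \<phi> \<and> ?pw"
  show "cartesian \<phi>"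
    unfolding cartesian_def
  proof (intro conjI allI impI)
    show "square \<phi>" using s by simp
    fix Z :: "('o, 'm, 'm) presheaf" and h k assume "cone \<phi> Z h k"
    with s show "\<exists>!u. nat_trans Z (Tot (Dm \<phi>)) u \<and>
        ncomp Z (Map (Dm \<phi>)) u = h \<and> ncomp Z (c1 \<phi>) u = k"
      by (intro pointwise_universal) auto
  qed
qed

lemma cartesian_universal:
  fixes Z :: "('o, 'm, 'z) presheaf"
  assumes "cartesian \<phi>" "cone \<phi> Z h k"
  shows "\<exists>!u. nat_trans Z (Tot (Dm \<phi>)) u \<and> ncomp Z (Map (Dm \<phi>)) u = h \<and> ncomp Z (c1 \<phi>) u = k"
  using assms unfolding cartesian_pointwise by (intro pointwise_universal) auto

text \<open>The chosen pullback \<open>D\<^sub>\<phi>\<close>, and \<open>\<phi>\<^sub>2 : D\<^sub>\<phi> \<rightarrow> B\<close>, inverse to the map \<open>B \<rightarrow> D\<^sub>\<phi>\<close> induced by the square.\<close>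

definition cpb :: "('o, 'm, 'b, 'a, 'd, 'c) cell \<Rightarrow> ('o, 'm, 'a \<times> 'd) presheaf" where
  "cpb \<phi> = pb (Base (Dm \<phi>)) (Tot (Cd \<phi>)) (c0 \<phi>) (Map (Cd \<phi>))"

definition c2 :: "('o, 'm, 'b, 'a, 'd, 'c) cell \<Rightarrow> 'o \<Rightarrow> 'a \<times> 'd \<Rightarrow> 'b" where
  "c2 \<phi> = on (cpb \<phi>) (\<lambda>\<Gamma> (a, d).
    THE b. b \<in> El (Tot (Dm \<phi>)) \<Gamma> \<and> Map (Dm \<phi>) \<Gamma> b = a \<and> c1 \<phi> \<Gamma> b = d)"

definition cid :: "('o, 'm, 'b, 'a) polynomial \<Rightarrow> ('o, 'm, 'b, 'a, 'b, 'a) cell" where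
  "cid f = \<lparr>Dm = f, Cd = f, c0 = nid (Base f), c1 = nid (Tot f)\<rparr>"

definition ccomp :: "('o, 'm, 'd, 'c, 'f, 'e) cell \<Rightarrow> ('o, 'm, 'b, 'a, 'd, 'c) cell \<Rightarrow>
    ('o, 'm, 'b, 'a, 'f, 'e) cell" (infixr \<open>\<odot>\<close> 55) where
  "\<psi> \<odot> \<phi> = \<lparr>Dm = Dm \<phi>, Cd = Cd \<psi>,
    c0 = ncomp (Base (Dm \<phi>)) (c0 \<psi>) (c0 \<phi>), c1 = ncomp (Tot (Dm \<phi>)) (c1 \<psi>) (c1 \<phi>)\<rparr>"

text \<open>The component at \<open>X\<close> of \<open>P\<^sub>\<phi> : P\<^sub>f \<Rightarrow> P\<^sub>g\<close>, which reindexes along the isomorphisms \<open>\<phi>\<^sub>2\<close> of fibres.\<close>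

definition ext_cell ::
    "('o, 'm, 'b, 'a, 'd, 'c) cell \<Rightarrow> ('o, 'm, 'x) presheaf \<Rightarrow>
     'o \<Rightarrow> 'a \<times> ('o \<Rightarrow> 'm \<times> 'b \<Rightarrow> 'x) \<Rightarrow> 'c \<times> ('o \<Rightarrow> 'm \<times> 'd \<Rightarrow> 'x)" where
  "ext_cell \<phi> X = on (ext (Dm \<phi>) X) (\<lambda>\<Gamma> (a, m). (c0 \<phi> \<Gamma> a,
    on (fibre (Cd \<phi>) \<Gamma> (c0 \<phi> \<Gamma> a))
      (\<lambda>\<Delta> (\<sigma>, d). m \<Delta> (\<sigma>, c2 \<phi> \<Delta> (Res (Base (Dm \<phi>)) \<sigma> a, d)))))"

text \<open>The horizontal composite \<open>\<psi> \<cdot> \<phi> : g \<cdot> f \<Rightarrow> g' \<cdot> f'\<close>.  Under \<open>P\<^bsub>g\<cdot>f\<^esub> \<cong> P\<^sub>g P\<^sub>f\<close> its extension is the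
  horizontal composite \<open>P\<^bsub>\<psi>\<^esub> P\<^bsub>f'\<^esub> \<circ> P\<^sub>g P\<^bsub>\<phi>\<^esub>\<close>; the map \<open>c0\<close> is that composite at the terminal object,
  using \<open>P\<^sub>f(1) \<cong> A\<close>.\<close>

definition hcomp (infixr \<open>\<star>\<close> 70) where
  "(\<psi> :: ('o, 'm, 'd, 'c, 'd1, 'c1) cell) \<star> (\<phi> :: ('o, 'm, 'b, 'a, 'b1, 'a1) cell) =
    (let b0 = ncomp (ext (Dm \<psi>) (Base (Dm \<phi>))) (ext_cell \<psi> (Base (Cd \<phi>)))
                (ext_map (Dm \<psi>) (Base (Dm \<phi>)) (c0 \<phi>))
     in \<lparr>Dm = Dm \<psi> \<cdot> Dm \<phi>, Cd = Cd \<psi> \<cdot> Cd \<phi>, c0 = b0,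
         c1 = on (Tot (Dm \<psi> \<cdot> Dm \<phi>)) (\<lambda>\<Gamma> (e, d, b). (b0 \<Gamma> e, c1 \<psi> \<Gamma> d, c1 \<phi> \<Gamma> b))\<rparr>)"

text \<open>Unit and associativity isomorphisms \<open>f \<Rightarrow> i \<cdot> f\<close>, \<open>f \<Rightarrow> f \<cdot> i\<close> and \<open>h \<cdot> (g \<cdot> f) \<Rightarrow> (h \<cdot> g) \<cdot> f\<close>.\<close>

definition lunit where
  "lunit (f :: ('o, 'm, 'b, 'a) polynomial) =
    \<lparr>Dm = f, Cd = pid \<cdot> f, c0 = ext_unit_iso (Base f),
     c1 = on (Tot f) (\<lambda>\<Gamma> b. (ext_unit_iso (Base f) \<Gamma> (Map f \<Gamma> b), (), b))\<rparr>"

definition runit where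
  "runit (f :: ('o, 'm, 'b, 'a) polynomial) =
    (let r = on (Base f) (\<lambda>\<Gamma> a. (a, on (fibre f \<Gamma> a) (\<lambda>_ _. ())))
     in \<lparr>Dm = f, Cd = f \<cdot> pid, c0 = r, c1 = on (Tot f) (\<lambda>\<Gamma> b. (r \<Gamma> (Map f \<Gamma> b), b, ()))\<rparr>)"

definition assoc where
  "assoc (h :: ('o, 'm, 'f, 'e) polynomial) (g :: ('o, 'm, 'd, 'c) polynomial)
      (f :: ('o, 'm, 'b, 'a) polynomial) =
    \<lparr>Dm = h \<cdot> (g \<cdot> f), Cd = (h \<cdot> g) \<cdot> f, c0 = ext_comp_iso h g (Base f),
     c1 = on (Tot (h \<cdot> (g \<cdot> f))) (\<lambda>\<Gamma> (e, x, (_, d, b)).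
       let e' = ext_comp_iso h g (Base f) \<Gamma> e in (e', (fst e', x, d), b))\<rparr>"


section \<open>Adjustments\<close>

definition adjustment :: "('o, 'm, 'b, 'a, 'd, 'c) cell \<Rightarrow> ('o, 'm, 'b, 'a, 'd, 'c) cell \<Rightarrow>
    ('o, 'm, 'b, 'a, 'd, 'c) adj \<Rightarrow> bool" where
  "adjustment \<phi> \<psi> \<alpha> \<longleftrightarrow> Dm3 \<alpha> = \<phi> \<and> Cd3 \<alpha> = \<psi> \<and>
    cartesian \<phi> \<and> cartesian \<psi> \<and> Dm \<phi> = Dm \<psi> \<and> Cd \<phi> = Cd \<psi> \<and>
    nat_trans (cpb \<phi>) (cpb \<psi>) (amap \<alpha>) \<and> ncomp (cpb \<phi>) (c2 \<psi>) (amap \<alpha>) = c2 \<phi>"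

definition aid :: "('o, 'm, 'b, 'a, 'd, 'c) cell \<Rightarrow> ('o, 'm, 'b, 'a, 'd, 'c) adj" where
  "aid \<phi> = \<lparr>Dm3 = \<phi>, Cd3 = \<phi>, amap = nid (cpb \<phi>)\<rparr>"

text \<open>Vertical composition, in diagrammatic order.\<close>

definition athen :: "('o, 'm, 'b, 'a, 'd, 'c) adj \<Rightarrow> ('o, 'm, 'b, 'a, 'd, 'c) adj \<Rightarrow>
    ('o, 'm, 'b, 'a, 'd, 'c) adj" (infixl \<open>\<then>\<close> 50) where
  "\<alpha> \<then> \<beta> = \<lparr>Dm3 = Dm3 \<alpha>, Cd3 = Cd3 \<beta>, amap = ncomp (cpb (Dm3 \<alpha>)) (amap \<beta>) (amap \<alpha>)\<rparr>"

definition inv_adjustment :: "('o, 'm, 'b, 'a, 'd, 'c) cell \<Rightarrow> ('o, 'm, 'b, 'a, 'd, 'c) cell \<Rightarrow>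
    ('o, 'm, 'b, 'a, 'd, 'c) adj \<Rightarrow> bool" where
  "inv_adjustment \<phi> \<psi> \<alpha> \<longleftrightarrow> adjustment \<phi> \<psi> \<alpha> \<and>
    (\<exists>\<beta>. adjustment \<psi> \<phi> \<beta> \<and> (\<alpha> \<then> \<beta>) = aid \<phi> \<and> (\<beta> \<then> \<alpha>) = aid \<psi>)"

text \<open>The hom 2-categories are locally codiscrete (\<open>ex1_adjustment\<close> below), and this determines the
  remaining operations on 3-cells: each is the unique adjustment between the evident 2-cells.\<close>

lemma presheaf_pb:
  assumes "presheaf X" "presheaf Y" "nat_trans X Z s" "nat_trans Y Z t"
  shows "presheaf (pb X Y s t)"
  unfolding presheaf_def[of "pb X Y s t"] unfolding pb_def
  using presheaf_ResD[OF assms(1)] presheaf_ResD[OF assms(2)]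
    presheaf_IdentD[OF assms(1)] presheaf_IdentD[OF assms(2)]
    presheaf_CompD[OF assms(1)] presheaf_CompD[OF assms(2)]
    nat_trans_natural[OF assms(3)] nat_trans_natural[OF assms(4)]
  by simp

lemma presheaf_cpb: "square \<phi> \<Longrightarrow> presheaf (cpb \<phi>)"
  unfolding square_def polynomial_def cpb_def by (blast intro: presheaf_pb)

lemma c2_spec:
  assumes "cartesian \<phi>" "\<Gamma> \<in> Obj C" "(a, d) \<in> El (cpb \<phi>) \<Gamma>"
  shows "c2 \<phi> \<Gamma> (a, d) \<in> El (Tot (Dm \<phi>)) \<Gamma>"
    and "Map (Dm \<phi>) \<Gamma> (c2 \<phi> \<Gamma> (a, d)) = a" and "c1 \<phi> \<Gamma> (c2 \<phi> \<Gamma> (a, d)) = d"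
proof -
  have "\<exists>!b. b \<in> El (Tot (Dm \<phi>)) \<Gamma> \<and> Map (Dm \<phi>) \<Gamma> b = a \<and> c1 \<phi> \<Gamma> b = d"
    using assms unfolding cartesian_pointwise cpb_def pb_def by auto
  from theI'[OF this] show "c2 \<phi> \<Gamma> (a, d) \<in> El (Tot (Dm \<phi>)) \<Gamma>"
    and "Map (Dm \<phi>) \<Gamma> (c2 \<phi> \<Gamma> (a, d)) = a" and "c1 \<phi> \<Gamma> (c2 \<phi> \<Gamma> (a, d)) = d"
    using assms(2,3) by (auto simp: c2_def on_def)
qed

lemma c2_eq:
  assumes "cartesian \<phi>" "\<Gamma> \<in> Obj C" "b \<in> El (Tot (Dm \<phi>)) \<Gamma>"
  shows "(Map (Dm \<phi>) \<Gamma> b, c1 \<phi> \<Gamma> b) \<in> El (cpb \<phi>) \<Gamma>"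
    and "c2 \<phi> \<Gamma> (Map (Dm \<phi>) \<Gamma> b, c1 \<phi> \<Gamma> b) = b"
proof -
  have sq: "square \<phi>" using assms(1) by (simp add: cartesian_def)
  note sq' = sq[unfolded square_def polynomial_def]
  show 1: "(Map (Dm \<phi>) \<Gamma> b, c1 \<phi> \<Gamma> b) \<in> El (cpb \<phi>) \<Gamma>"
    unfolding cpb_def pb_def
    using sq' assms(2,3) square_comm[OF sq assms(2,3)] by (auto intro: nat_trans_in)
  then have "\<exists>!b'. b' \<in> El (Tot (Dm \<phi>)) \<Gamma> \<and> Map (Dm \<phi>) \<Gamma> b' = Map (Dm \<phi>) \<Gamma> b \<and> c1 \<phi> \<Gamma> b' = c1 \<phi> \<Gamma> b"
    using assms unfolding cartesian_pointwise cpb_def pb_def by auto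
  then show "c2 \<phi> \<Gamma> (Map (Dm \<phi>) \<Gamma> b, c1 \<phi> \<Gamma> b) = b"
    using c2_spec[OF assms(1,2) 1] assms(3) by blast
qed

lemma nat_trans_c2:
  assumes "cartesian \<phi>"
  shows "nat_trans (cpb \<phi>) (Tot (Dm \<phi>)) (c2 \<phi>)"
proof -
  have sq: "square \<phi>" using assms(1) by (simp add: cartesian_def)
  note sq' = sq[unfolded square_def polynomial_def]
  have "nat_trans (cpb \<phi>) (Tot (Dm \<phi>)) (on (cpb \<phi>) (c2 \<phi>))"
  proof (rule nat_trans_onI[OF presheaf_cpb[OF sq]])
    fix \<Gamma> x assume "\<Gamma> \<in> Obj C" "x \<in> El (cpb \<phi>) \<Gamma>"
    then show "c2 \<phi> \<Gamma> x \<in> El (Tot (Dm \<phi>)) \<Gamma>" using c2_spec(1)[OF assms] by (cases x) auto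
  next
    fix \<Delta> \<Gamma> \<sigma> x assume s: "\<sigma> \<in> Hom C \<Delta> \<Gamma>" and x: "x \<in> El (cpb \<phi>) \<Gamma>"
    obtain a d where ad: "x = (a, d)" by (cases x)
    note o = Hom_Obj[OF s]
    note sp = c2_spec[OF assms o[THEN conjunct2] x[unfolded ad]]
    let ?b = "Res (Tot (Dm \<phi>)) \<sigma> (c2 \<phi> \<Gamma> x)"
    have b: "?b \<in> El (Tot (Dm \<phi>)) \<Delta>" using sq' s sp(1) ad by (blast intro: presheaf_ResD)
    have "Map (Dm \<phi>) \<Delta> ?b = Res (Base (Dm \<phi>)) \<sigma> a"
      using nat_trans_natural[OF _ s sp(1), of "Base (Dm \<phi>)" "Map (Dm \<phi>)"] sq' sp(2) ad by simp
    moreover have "c1 \<phi> \<Delta> ?b = Res (Tot (Cd \<phi>)) \<sigma> d"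
      using nat_trans_natural[OF _ s sp(1), of "Tot (Cd \<phi>)" "c1 \<phi>"] sq' sp(3) ad by simp
    ultimately show "c2 \<phi> \<Delta> (Res (cpb \<phi>) \<sigma> x) = ?b"
      using c2_eq(2)[OF assms o[THEN conjunct1] b] ad by (simp add: cpb_def pb_def)
  qed
  moreover have "on (cpb \<phi>) (c2 \<phi>) = c2 \<phi>" by (auto simp: c2_def on_def fun_eq_iff)
  ultimately show ?thesis by simp
qed

lemma ex1_adjustment:
  assumes \<phi>: "cartesian \<phi>" and \<psi>: "cartesian \<psi>" and par: "Dm \<phi> = Dm \<psi>" "Cd \<phi> = Cd \<psi>"
  shows "\<exists>!\<alpha>. adjustment \<phi> \<psi> \<alpha>"
proof -
  let ?w = "\<lambda>\<Gamma> b. (Map (Dm \<psi>) \<Gamma> b, c1 \<psi> \<Gamma> b)"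
  let ?t = "\<lambda>\<Gamma> x. ?w \<Gamma> (c2 \<phi> \<Gamma> x)"
  have sq: "square \<phi>" "square \<psi>" using \<phi> \<psi> by (simp_all add: cartesian_def)
  note sq' = sq(2)[unfolded square_def polynomial_def]
  have c2: "nat_trans (cpb \<phi>) (Tot (Dm \<psi>)) (c2 \<phi>)" using nat_trans_c2[OF \<phi>] par by simp
  have nt: "nat_trans (cpb \<phi>) (cpb \<psi>) (on (cpb \<phi>) ?t)"
  proof (rule nat_trans_onI[OF presheaf_cpb[OF sq(1)]])
    fix \<Gamma> x assume "\<Gamma> \<in> Obj C" "x \<in> El (cpb \<phi>) \<Gamma>"
    then show "?t \<Gamma> x \<in> El (cpb \<psi>) \<Gamma>" using c2_eq(1)[OF \<psi>] nat_trans_in[OF c2] by blast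
  next
    fix \<Delta> \<Gamma> \<sigma> x assume s: "\<sigma> \<in> Hom C \<Delta> \<Gamma>" and x: "x \<in> El (cpb \<phi>) \<Gamma>"
    have b: "c2 \<phi> \<Gamma> x \<in> El (Tot (Dm \<psi>)) \<Gamma>" using nat_trans_in[OF c2 _ x] Hom_Obj[OF s] by blast
    have 1: "Map (Dm \<psi>) \<Delta> (Res (Tot (Dm \<psi>)) \<sigma> (c2 \<phi> \<Gamma> x)) =
        Res (Base (Dm \<psi>)) \<sigma> (Map (Dm \<psi>) \<Gamma> (c2 \<phi> \<Gamma> x))"
      using sq' by (intro nat_trans_natural[OF _ s b]) simp
    have 2: "c1 \<psi> \<Delta> (Res (Tot (Dm \<psi>)) \<sigma> (c2 \<phi> \<Gamma> x)) =
        Res (Tot (Cd \<psi>)) \<sigma> (c1 \<psi> \<Gamma> (c2 \<phi> \<Gamma> x))"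
      using sq' by (intro nat_trans_natural[OF _ s b]) simp
    show "?t \<Delta> (Res (cpb \<phi>) \<sigma> x) = Res (cpb \<psi>) \<sigma> (?t \<Gamma> x)"
      using nat_trans_natural[OF c2 s x] 1 2 by (simp add: cpb_def pb_def)
  qed
  have cp: "ncomp (cpb \<phi>) (c2 \<psi>) (on (cpb \<phi>) ?t) = c2 \<phi>"
  proof (rule nat_trans_eqI[OF nat_trans_ncomp[OF presheaf_cpb[OF sq(1)] nt nat_trans_c2[OF \<psi>]] c2])
    fix \<Gamma> x assume g: "\<Gamma> \<in> Obj C" "x \<in> El (cpb \<phi>) \<Gamma>"
    then show "ncomp (cpb \<phi>) (c2 \<psi>) (on (cpb \<phi>) ?t) \<Gamma> x = c2 \<phi> \<Gamma> x"
      using c2_eq(2)[OF \<psi> g(1) nat_trans_in[OF c2 g]] by (simp add: ncomp_def on_def)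
  qed
  show ?thesis
  proof (rule ex1I[of _ "\<lparr>Dm3 = \<phi>, Cd3 = \<psi>, amap = on (cpb \<phi>) ?t\<rparr>"])
    show "adjustment \<phi> \<psi> \<lparr>Dm3 = \<phi>, Cd3 = \<psi>, amap = on (cpb \<phi>) ?t\<rparr>"
      unfolding adjustment_def using \<phi> \<psi> par nt cp by simp
  next
    fix \<alpha> assume a: "adjustment \<phi> \<psi> \<alpha>"
    have "amap \<alpha> = on (cpb \<phi>) ?t"
    proof (rule nat_trans_eqI[OF _ nt])
      show na: "nat_trans (cpb \<phi>) (cpb \<psi>) (amap \<alpha>)" using a by (simp add: adjustment_def)
      fix \<Gamma> x assume g: "\<Gamma> \<in> Obj C" "x \<in> El (cpb \<phi>) \<Gamma>"
      have "ncomp (cpb \<phi>) (c2 \<psi>) (amap \<alpha>) \<Gamma> x = c2 \<phi> \<Gamma> x" using a by (simp add: adjustment_def)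
      then have "c2 \<psi> \<Gamma> (amap \<alpha> \<Gamma> x) = c2 \<phi> \<Gamma> x" using g by (simp add: ncomp_def on_def)
      moreover obtain y z where yz: "amap \<alpha> \<Gamma> x = (y, z)" by (cases "amap \<alpha> \<Gamma> x")
      ultimately show "amap \<alpha> \<Gamma> x = on (cpb \<phi>) ?t \<Gamma> x"
        using c2_spec(2,3)[OF \<psi> g(1), of y z] nat_trans_in[OF na g] g by (auto simp: on_def)
    qed
    then show "\<alpha> = \<lparr>Dm3 = \<phi>, Cd3 = \<psi>, amap = on (cpb \<phi>) ?t\<rparr>"
      using a by (cases \<alpha>) (simp add: adjustment_def)
  qed
qed

definition the_adj :: "('o, 'm, 'b, 'a, 'd, 'c) cell \<Rightarrow> ('o, 'm, 'b, 'a, 'd, 'c) cell \<Rightarrow>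
    ('o, 'm, 'b, 'a, 'd, 'c) adj" where
  "the_adj \<phi> \<psi> = (THE \<alpha>. adjustment \<phi> \<psi> \<alpha>)"

definition lwhisk (infixr \<open>\<circ>\<^sub>l\<close> 60) where
  "\<psi> \<circ>\<^sub>l \<alpha> = the_adj (\<psi> \<odot> Dm3 \<alpha>) (\<psi> \<odot> Cd3 \<alpha>)"

definition rwhisk (infixr \<open>\<circ>\<^sub>r\<close> 60) where
  "\<alpha> \<circ>\<^sub>r \<phi> = the_adj (Dm3 \<alpha> \<odot> \<phi>) (Cd3 \<alpha> \<odot> \<phi>)"

definition hlwhisk (infixr \<open>\<star>\<^sub>l\<close> 75) where
  "g \<star>\<^sub>l \<alpha> = the_adj (cid g \<star> Dm3 \<alpha>) (cid g \<star> Cd3 \<alpha>)"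

definition hrwhisk (infixr \<open>\<star>\<^sub>r\<close> 75) where
  "\<alpha> \<star>\<^sub>r f = the_adj (Dm3 \<alpha> \<star> cid f) (Cd3 \<alpha> \<star> cid f)"


section \<open>The lift to the category of morphisms and pullback squares\<close>

text \<open>For \<open>p\<close>, \<open>\<eta> : i \<Rightarrow> p\<close> and \<open>\<mu> : p \<cdot> p \<Rightarrow> p\<close>, the action of \<open>P = P\<^sub>p\<close> on 1-cells and 2-cells, and the
  1-cells \<open>h\<^sub>f : f \<Rightarrow> P(f)\<close> and \<open>m\<^sub>f : P(P(f)) \<Rightarrow> P(f)\<close>: the naturality squares at \<open>f\<close> of \<open>P\<^bsub>\<eta>\<^esub>\<close> and \<open>P\<^bsub>\<mu>\<^esub>\<close>,
  precomposed with \<open>X \<cong> P\<^bsub>i\<^esub>(X)\<close> and \<open>P\<^sub>p(P\<^sub>p(X)) \<cong> P\<^bsub>p\<cdot>p\<^esub>(X)\<close>.\<close>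

definition lift_cell where
  "lift_cell (p :: ('o, 'm, 't, 'u) polynomial) (\<phi> :: ('o, 'm, 'b, 'a, 'd, 'c) cell) =
    \<lparr>Dm = ext_poly p (Dm \<phi>), Cd = ext_poly p (Cd \<phi>),
     c0 = ext_map p (Base (Dm \<phi>)) (c0 \<phi>), c1 = ext_map p (Tot (Dm \<phi>)) (c1 \<phi>)\<rparr>"

definition lift_adj where
  "lift_adj p \<alpha> = the_adj (lift_cell p (Dm3 \<alpha>)) (lift_cell p (Cd3 \<alpha>))"

definition lift_unit where
  "lift_unit (\<eta> :: ('o, 'm, unit, unit, 't, 'u) cell) (f :: ('o, 'm, 'b, 'a) polynomial) =
    \<lparr>Dm = f, Cd = ext_poly (Cd \<eta>) f,
     c0 = ncomp (Base f) (ext_cell \<eta> (Base f)) (ext_unit_iso (Base f)),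
     c1 = ncomp (Tot f) (ext_cell \<eta> (Tot f)) (ext_unit_iso (Tot f))\<rparr>"

definition lift_mult where
  "lift_mult p \<mu> (f :: ('o, 'm, 'b, 'a) polynomial) =
    \<lparr>Dm = ext_poly p (ext_poly p f), Cd = ext_poly p f,
     c0 = ncomp (ext p (ext p (Base f))) (ext_cell \<mu> (Base f)) (ext_comp_iso p p (Base f)),
     c1 = ncomp (ext p (ext p (Tot f))) (ext_cell \<mu> (Tot f)) (ext_comp_iso p p (Tot f))\<rparr>"

end


section \<open>Polynomial pseudomonads and pseudoalgebras\<close>

text \<open>The suppressed unit and associativity isomorphisms of polynomial composition are written out.
  They are strictly natural and coherent, so that consecutive 3-cells below have equal boundaries.\<close>

locale polynomial_pseudomonad = category C
  for C :: "('o, 'm) cat" +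
  fixes p :: "('o, 'm, 't, 'u) polynomial"
    and \<eta> \<mu> \<alpha> lam rho
  assumes poly_p: "polynomial p"
    and cart_\<eta>: "cartesian \<eta>" "Dm \<eta> = pid" "Cd \<eta> = p"
    and cart_\<mu>: "cartesian \<mu>" "Dm \<mu> = p \<cdot> p" "Cd \<mu> = p"
    and adj_\<alpha>: "inv_adjustment (\<mu> \<odot> (cid p \<star> \<mu>)) (\<mu> \<odot> (\<mu> \<star> cid p) \<odot> assoc p p p) \<alpha>"
    and adj_lam: "inv_adjustment (\<mu> \<odot> (cid p \<star> \<eta>) \<odot> runit p) (cid p) lam"
    and adj_rho: "inv_adjustment (\<mu> \<odot> (\<eta> \<star> cid p) \<odot> lunit p) (cid p) rho"
    and pentagon:
      "(\<mu> \<circ>\<^sub>l (p \<star>\<^sub>l \<alpha>)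
        \<then> \<alpha> \<circ>\<^sub>r ((cid p \<star> (\<mu> \<star> cid p)) \<odot> (cid p \<star> assoc p p p))
        \<then> (\<mu> \<circ>\<^sub>l (\<alpha> \<star>\<^sub>r p)) \<circ>\<^sub>r (assoc p (p \<cdot> p) p \<odot> (cid p \<star> assoc p p p)))
       = (\<alpha> \<circ>\<^sub>r (cid p \<star> (cid p \<star> \<mu>))
        \<then> the_adj (\<mu> \<odot> (\<mu> \<star> cid p) \<odot> (cid (p \<cdot> p) \<star> \<mu>) \<odot> assoc p p (p \<cdot> p))
                (\<mu> \<odot> (cid p \<star> \<mu>) \<odot> (\<mu> \<star> cid (p \<cdot> p)) \<odot> assoc p p (p \<cdot> p))
        \<then> \<alpha> \<circ>\<^sub>r ((\<mu> \<star> cid (p \<cdot> p)) \<odot> assoc p p (p \<cdot> p)))"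
    and triangle:
      "(\<alpha> \<circ>\<^sub>r ((cid p \<star> (\<eta> \<star> cid p)) \<odot> (cid p \<star> lunit p)) \<then> \<mu> \<circ>\<^sub>l (lam \<star>\<^sub>r p))
       = \<mu> \<circ>\<^sub>l (p \<star>\<^sub>l rho)"

text \<open>The structure 2-cells \<open>\<alpha>\<^sub>f\<close>, \<open>\<lambda>\<^sub>f\<close> and the pseudonaturality isomorphism of the lifted pseudomonad
  are the unique possible ones.\<close>

locale polynomial_pseudoalgebra = polynomial_pseudomonad C p \<eta> \<mu> \<alpha> lam rho
  for C :: "('o, 'm) cat" and p :: "('o, 'm, 't, 'u) polynomial" and \<eta> \<mu> \<alpha> lam rho +
  fixes f :: "('o, 'm, 'b, 'a) polynomial"
    and \<zeta> \<sigma> \<tau>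
  assumes poly_f: "polynomial f"
    and cart_\<zeta>: "cartesian \<zeta>" "Dm \<zeta> = ext_poly p f" "Cd \<zeta> = f"
    and adj_\<sigma>: "inv_adjustment (\<zeta> \<odot> lift_cell p \<zeta>) (\<zeta> \<odot> lift_mult p \<mu> f) \<sigma>"
    and adj_\<tau>: "inv_adjustment (\<zeta> \<odot> lift_unit \<eta> f) (cid f) \<tau>"
    and assoc_coherence:
      "(\<zeta> \<circ>\<^sub>l lift_adj p \<sigma>
        \<then> \<sigma> \<circ>\<^sub>r lift_cell p (lift_mult p \<mu> f)
        \<then> \<zeta> \<circ>\<^sub>l the_adj (lift_mult p \<mu> f \<odot> lift_cell p (lift_mult p \<mu> f))
                     (lift_mult p \<mu> f \<odot> lift_mult p \<mu> (ext_poly p f)))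
       = (\<sigma> \<circ>\<^sub>r lift_cell p (lift_cell p \<zeta>)
        \<then> \<zeta> \<circ>\<^sub>l the_adj (lift_mult p \<mu> f \<odot> lift_cell p (lift_cell p \<zeta>))
                     (lift_cell p \<zeta> \<odot> lift_mult p \<mu> (ext_poly p f))
        \<then> \<sigma> \<circ>\<^sub>r lift_mult p \<mu> (ext_poly p f))"
    and unit_coherence:
      "(\<sigma> \<circ>\<^sub>r lift_cell p (lift_unit \<eta> f)
        \<then> \<zeta> \<circ>\<^sub>l the_adj (lift_mult p \<mu> f \<odot> lift_cell p (lift_unit \<eta> f)) (cid (ext_poly p f)))
       = \<zeta> \<circ>\<^sub>l lift_adj p \<tau>"


section \<open>Natural models\<close>

locale natural_model = category C
  for C :: "('o, 'm) cat" +
  fixes dia :: 'o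
    and p :: "('o, 'm, 't, 'u) polynomial"
    and cext :: "'o \<Rightarrow> 'u \<Rightarrow> 'o"
    and cproj :: "'o \<Rightarrow> 'u \<Rightarrow> 'm"
    and cvar :: "'o \<Rightarrow> 'u \<Rightarrow> 't"
  assumes dia_in: "dia \<in> Obj C"
    and dia_terminal: "\<Gamma> \<in> Obj C \<Longrightarrow> \<exists>!\<sigma>. \<sigma> \<in> Hom C \<Gamma> dia"
    and poly_p: "polynomial p"
    and cext_in: "\<Gamma> \<in> Obj C \<Longrightarrow> A \<in> El (Base p) \<Gamma> \<Longrightarrow> cext \<Gamma> A \<in> Obj C"
    and cproj_in: "\<Gamma> \<in> Obj C \<Longrightarrow> A \<in> El (Base p) \<Gamma> \<Longrightarrow> cproj \<Gamma> A \<in> Hom C (cext \<Gamma> A) \<Gamma>"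
    and cvar_in: "\<Gamma> \<in> Obj C \<Longrightarrow> A \<in> El (Base p) \<Gamma> \<Longrightarrow> cvar \<Gamma> A \<in> El (Tot p) (cext \<Gamma> A)"
    and cext_pullback: "\<Gamma> \<in> Obj C \<Longrightarrow> A \<in> El (Base p) \<Gamma> \<Longrightarrow>
      cartesian \<lparr>Dm = \<lparr>Tot = yo (cext \<Gamma> A), Base = yo \<Gamma>, Map = yo_map (cproj \<Gamma> A)\<rparr>, Cd = p,
        c0 = yoneda (Base p) \<Gamma> A, c1 = yoneda (Tot p) (cext \<Gamma> A) (cvar \<Gamma> A)\<rparr>"
begin

definition supports_unit_type :: bool where
  "supports_unit_type \<longleftrightarrow>
    (\<exists>unit_hat star_hat. cartesian \<lparr>Dm = pid, Cd = p, c0 = unit_hat, c1 = star_hat\<rparr>)"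

text \<open>The projection \<open>\<Sum>\<^bsub>(A,B)\<^esub> \<Sum>\<^bsub>a:[A]\<^esub> [B(a)] \<rightarrow> \<Sum>\<^bsub>A:U\<^esub> U\<^bsup>[A]\<^esup>\<close> is literally \<open>p \<cdot> p\<close>, and
  \<open>\<Sum>\<^bsub>A:U\<^esub> p\<^bsup>[A]\<^esup>\<close> is literally \<open>P\<^sub>p(p)\<close>.\<close>

definition supports_sum_types :: bool where
  "supports_sum_types \<longleftrightarrow>
    (\<exists>Sigma_hat pair_hat. cartesian \<lparr>Dm = p \<cdot> p, Cd = p, c0 = Sigma_hat, c1 = pair_hat\<rparr>)"

definition supports_product_types :: bool where
  "supports_product_types \<longleftrightarrow>
    (\<exists>Pi_hat lambda_hat. cartesian \<lparr>Dm = ext_poly p p, Cd = p, c0 = Pi_hat, c1 = lambda_hat\<rparr>)"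

end

end

theory Submission
  imports Defs
begin

text \<open>A square of presheaves is a pullback iff it is so pointwise, and between parallel pullback squares
  there is exactly one adjustment.  Hence the coherence axioms for 3-cells hold as soon as the composites
  involved are pasted from pullback squares whose boundaries match on the nose.  So a pseudomonad
  structure on \<open>p\<close> is no more than a pair of pullback squares \<open>i\<^sub>1 \<Rightarrow> p\<close> and \<open>p \<cdot> p \<Rightarrow> p\<close>, which are a unit
  type and dependent sum types, and a pseudoalgebra structure on \<open>p\<close> is a pullback square
  \<open>P\<^sub>p(p) \<Rightarrow> p\<close>, which is dependent product types.  The work lies in the matching of boundaries: horizontal
  composition is strictly functorial, the associativity and unit cells are strictly natural and satisfy
  the pentagon and triangle identities, and all of these cells, as well as the unit and multiplication of
  the lift, are pullback squares.\<close>

text \<open>The uniqueness of adjustments identifies two 3-cells only when their boundaries are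
  equal as HOL terms; isomorphic boundaries would leave nothing to compare. Strict equations are
  available because the components of a cell are families that are \<open>undefined\<close> off
  their domains, so two cells with the same boundary agree once they agree on elements. The awkward
  elements are those of \<open>ext f X\<close>: pairs of a point of the base and a function on its
  fibre. They are compared by first component and then by values at fibre points
  \<open>(\<sigma>, b)\<close>. Nested evaluations are moved between an arbitrary stage and an
  identity arrow by naturality, because the total space of a composite polynomial mentions values at
  identities only. Element types differ from presheaf to presheaf, while the definition of a
  pullback square tests it against presheaves of arrows; the elementwise criterion lifts that
  restriction, for instance where fibres serve as test objects. The passage from structures to types
  takes no calculation: the pullback squares are among the components of the structures.\<close>

context category
begin

section \<open>Polynomials and cartesian cells, pointwise\<close>

lemma on_apply: "\<Gamma> \<in> Obj C \<Longrightarrow> x \<in> El F \<Gamma> \<Longrightarrow> on F t \<Gamma> x = t \<Gamma> x"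
  by (simp add: on_def)

lemma ncomp_apply: "\<Gamma> \<in> Obj C \<Longrightarrow> x \<in> El F \<Gamma> \<Longrightarrow> ncomp F t s \<Gamma> x = t \<Gamma> (s \<Gamma> x)"
  by (simp add: ncomp_def on_def)

lemma nid_apply: "\<Gamma> \<in> Obj C \<Longrightarrow> x \<in> El F \<Gamma> \<Longrightarrow> nid F \<Gamma> x = x"
  by (simp add: nid_def on_def)

lemma ncomp_assoc:
  "nat_trans F G s \<Longrightarrow> ncomp F (ncomp G u t) s = ncomp F u (ncomp F t s)"
  by (auto simp: fun_eq_iff ncomp_def on_def nat_trans_in)

lemma nat_trans_nid: "presheaf F \<Longrightarrow> nat_trans F F (nid F)"
  unfolding nid_def by (rule nat_trans_onI) auto

lemma polynomialD:
  assumes "polynomial f"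
  shows "presheaf (Tot f)" "presheaf (Base f)" "nat_trans (Tot f) (Base f) (Map f)"
  using assms by (simp_all add: polynomial_def)

lemma polynomial_in:
  assumes "polynomial f" "\<sigma> \<in> Hom C \<Delta> \<Gamma>"
  shows "b \<in> El (Tot f) \<Gamma> \<Longrightarrow> Map f \<Gamma> b \<in> El (Base f) \<Gamma>"
    and "b \<in> El (Tot f) \<Gamma> \<Longrightarrow> Res (Tot f) \<sigma> b \<in> El (Tot f) \<Delta>"
    and "a \<in> El (Base f) \<Gamma> \<Longrightarrow> Res (Base f) \<sigma> a \<in> El (Base f) \<Delta>"
    and "b \<in> El (Tot f) \<Gamma> \<Longrightarrow> Map f \<Delta> (Res (Tot f) \<sigma> b) = Res (Base f) \<sigma> (Map f \<Gamma> b)"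
  using assms(2) polynomialD[OF assms(1)] Hom_Obj[OF assms(2)]
  by (blast intro: presheaf_ResD nat_trans_in nat_trans_natural)+

text \<open>The boundary is kept as separate arguments, so that elements are taken from
  \<open>Base f\<close> or \<open>Tot g\<close> directly instead of from projections of the record
  \<open>\<phi>\<close>.\<close>

definition ccell :: "('o, 'm, 'b, 'a) polynomial \<Rightarrow> ('o, 'm, 'd, 'c) polynomial \<Rightarrow>
    ('o, 'm, 'b, 'a, 'd, 'c) cell \<Rightarrow> bool" where
  "ccell f g \<phi> \<longleftrightarrow> cartesian \<phi> \<and> Dm \<phi> = f \<and> Cd \<phi> = g"

lemma ccellI:
  assumes "Dm \<phi> = f" "Cd \<phi> = g" "polynomial f" "polynomial g"
    and "nat_trans (Base f) (Base g) (c0 \<phi>)" "nat_trans (Tot f) (Tot g) (c1 \<phi>)"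
    and "\<And>\<Gamma> b. \<Gamma> \<in> Obj C \<Longrightarrow> b \<in> El (Tot f) \<Gamma> \<Longrightarrow> Map g \<Gamma> (c1 \<phi> \<Gamma> b) = c0 \<phi> \<Gamma> (Map f \<Gamma> b)"
    and "\<And>\<Gamma> a d. \<Gamma> \<in> Obj C \<Longrightarrow> a \<in> El (Base f) \<Gamma> \<Longrightarrow> d \<in> El (Tot g) \<Gamma> \<Longrightarrow>
      Map g \<Gamma> d = c0 \<phi> \<Gamma> a \<Longrightarrow> \<exists>!b. b \<in> El (Tot f) \<Gamma> \<and> Map f \<Gamma> b = a \<and> c1 \<phi> \<Gamma> b = d"
  shows "ccell f g \<phi>"
  unfolding ccell_def cartesian_pointwise square_def
  using assms by (auto simp: fun_eq_iff ncomp_def on_def)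

lemma ccellD:
  assumes "ccell f g \<phi>"
  shows "cartesian \<phi>" "square \<phi>" "Dm \<phi> = f" "Cd \<phi> = g" "polynomial f" "polynomial g"
    and "nat_trans (Base f) (Base g) (c0 \<phi>)" "nat_trans (Tot f) (Tot g) (c1 \<phi>)"
  using assms by (auto simp: ccell_def cartesian_def square_def)

lemma ccell_comm:
  "ccell f g \<phi> \<Longrightarrow> \<Gamma> \<in> Obj C \<Longrightarrow> b \<in> El (Tot f) \<Gamma> \<Longrightarrow> Map g \<Gamma> (c1 \<phi> \<Gamma> b) = c0 \<phi> \<Gamma> (Map f \<Gamma> b)"
  using square_comm[of \<phi> \<Gamma> b] ccellD[of f g \<phi>] by simp

lemma ccell_ex1:
  "ccell f g \<phi> \<Longrightarrow> \<Gamma> \<in> Obj C \<Longrightarrow> a \<in> El (Base f) \<Gamma> \<Longrightarrow> d \<in> El (Tot g) \<Gamma> \<Longrightarrow>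
    Map g \<Gamma> d = c0 \<phi> \<Gamma> a \<Longrightarrow> \<exists>!b. b \<in> El (Tot f) \<Gamma> \<and> Map f \<Gamma> b = a \<and> c1 \<phi> \<Gamma> b = d"
  unfolding ccell_def cartesian_pointwise by fastforce

lemma ccell_in:
  assumes "ccell f g \<phi>" "\<Gamma> \<in> Obj C"
  shows "a \<in> El (Base f) \<Gamma> \<Longrightarrow> c0 \<phi> \<Gamma> a \<in> El (Base g) \<Gamma>"
    and "b \<in> El (Tot f) \<Gamma> \<Longrightarrow> c1 \<phi> \<Gamma> b \<in> El (Tot g) \<Gamma>"
  using ccellD(7,8)[OF assms(1)] assms(2) by (blast intro: nat_trans_in)+

lemma ccell_natural:
  assumes "ccell f g \<phi>" "\<sigma> \<in> Hom C \<Delta> \<Gamma>"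
  shows "a \<in> El (Base f) \<Gamma> \<Longrightarrow> c0 \<phi> \<Delta> (Res (Base f) \<sigma> a) = Res (Base g) \<sigma> (c0 \<phi> \<Gamma> a)"
    and "b \<in> El (Tot f) \<Gamma> \<Longrightarrow> c1 \<phi> \<Delta> (Res (Tot f) \<sigma> b) = Res (Tot g) \<sigma> (c1 \<phi> \<Gamma> b)"
  using ccellD(7,8)[OF assms(1)] assms(2) by (blast intro: nat_trans_natural)+

lemma cell_eqI:
  fixes \<phi> \<psi> :: "('o, 'm, 'b, 'a, 'd, 'c) cell"
  assumes \<phi>: "ccell f g \<phi>" and \<psi>: "ccell f g \<psi>"
    and "\<And>\<Gamma> a. \<Gamma> \<in> Obj C \<Longrightarrow> a \<in> El (Base f) \<Gamma> \<Longrightarrow> c0 \<phi> \<Gamma> a = c0 \<psi> \<Gamma> a"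
    and "\<And>\<Gamma> b. \<Gamma> \<in> Obj C \<Longrightarrow> b \<in> El (Tot f) \<Gamma> \<Longrightarrow> c1 \<phi> \<Gamma> b = c1 \<psi> \<Gamma> b"
  shows "\<phi> = \<psi>"
proof (rule cell.equality)
  show "c0 \<phi> = c0 \<psi>" using assms(3) by (rule nat_trans_eqI[OF ccellD(7)[OF \<phi>] ccellD(7)[OF \<psi>]])
  show "c1 \<phi> = c1 \<psi>" using assms(4) by (rule nat_trans_eqI[OF ccellD(8)[OF \<phi>] ccellD(8)[OF \<psi>]])
qed (use ccellD[OF \<phi>] ccellD[OF \<psi>] in simp_all)

lemma ccell_cid: "polynomial f \<Longrightarrow> ccell f f (cid f)"
  unfolding cid_def
  by (rule ccellI) (simp_all add: nat_trans_nid nid_apply polynomialD nat_trans_in[OF polynomialD(3)]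
    cong: conj_cong, blast)

text \<open>Pasting of pullback squares: an element of the far total space is lifted along
  \<open>\<psi>\<close>, and the result is lifted along \<open>\<phi>\<close>.\<close>

lemma ccell_ccomp:
  assumes \<psi>: "ccell g h \<psi>" and \<phi>: "ccell f g \<phi>"
  shows "ccell f h (\<psi> \<odot> \<phi>)"
proof (rule ccellI)
  note ps = ccellD[OF \<phi>] ccellD[OF \<psi>]
  show "polynomial f" "polynomial h" by (rule ps)+
  show "nat_trans (Base f) (Base h) (c0 (\<psi> \<odot> \<phi>))" "nat_trans (Tot f) (Tot h) (c1 (\<psi> \<odot> \<phi>))"
    using ps by (auto simp: ccomp_def intro!: nat_trans_ncomp polynomialD)
  fix \<Gamma> assume \<Gamma>: "\<Gamma> \<in> Obj C"
  show "Map h \<Gamma> (c1 (\<psi> \<odot> \<phi>) \<Gamma> b) = c0 (\<psi> \<odot> \<phi>) \<Gamma> (Map f \<Gamma> b)" if "b \<in> El (Tot f) \<Gamma>" for b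
    using that \<Gamma> ccell_in[OF \<phi>] nat_trans_in[OF polynomialD(3)[OF ps(5)] \<Gamma> that]
    by (simp add: ccomp_def ps ncomp_apply ccell_comm[OF \<phi>] ccell_comm[OF \<psi>])
  fix a d assume a: "a \<in> El (Base f) \<Gamma>" and d: "d \<in> El (Tot h) \<Gamma>"
    and e: "Map h \<Gamma> d = c0 (\<psi> \<odot> \<phi>) \<Gamma> a"
  have e': "Map h \<Gamma> d = c0 \<psi> \<Gamma> (c0 \<phi> \<Gamma> a)" using e a \<Gamma> by (simp add: ccomp_def ps ncomp_apply)
  then obtain y where y: "y \<in> El (Tot g) \<Gamma>" "Map g \<Gamma> y = c0 \<phi> \<Gamma> a" "c1 \<psi> \<Gamma> y = d"
    using ccell_ex1[OF \<psi> \<Gamma> ccell_in(1)[OF \<phi> \<Gamma> a] d] by blast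
  note ex = ccell_ex1[OF \<phi> \<Gamma> a y(1,2)]
  then obtain b where b: "b \<in> El (Tot f) \<Gamma>" "Map f \<Gamma> b = a" "c1 \<phi> \<Gamma> b = y" by blast
  show "\<exists>!b. b \<in> El (Tot f) \<Gamma> \<and> Map f \<Gamma> b = a \<and> c1 (\<psi> \<odot> \<phi>) \<Gamma> b = d"
  proof (rule ex1I[of _ b])
    show "b \<in> El (Tot f) \<Gamma> \<and> Map f \<Gamma> b = a \<and> c1 (\<psi> \<odot> \<phi>) \<Gamma> b = d"
      using b y \<Gamma> by (simp add: ccomp_def ps ncomp_apply)
  next
    fix b' assume b': "b' \<in> El (Tot f) \<Gamma> \<and> Map f \<Gamma> b' = a \<and> c1 (\<psi> \<odot> \<phi>) \<Gamma> b' = d"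
    then have "c1 \<psi> \<Gamma> (c1 \<phi> \<Gamma> b') = d" using \<Gamma> by (auto simp: ccomp_def ps ncomp_apply)
    moreover have "c1 \<phi> \<Gamma> b' \<in> El (Tot g) \<Gamma>" "Map g \<Gamma> (c1 \<phi> \<Gamma> b') = c0 \<phi> \<Gamma> a"
      using b' ccell_in[OF \<phi> \<Gamma>] ccell_comm[OF \<phi> \<Gamma>] by auto
    \<comment> \<open>Commutativity of the first square puts \<open>c1 \<phi> \<Gamma> b'\<close>
      over the same base element as \<open>y\<close>, so uniqueness of lifts along
      \<open>\<psi>\<close> identifies the two.\<close>
    ultimately have "c1 \<phi> \<Gamma> b' = y"
      using y ccell_ex1[OF \<psi> \<Gamma> ccell_in(1)[OF \<phi> \<Gamma> a] d e'] by blast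
    then show "b' = b" using b b' ex by blast
  qed
qed (simp_all add: ccomp_def ccellD[OF \<phi>] ccellD[OF \<psi>])

lemma ccomp_apply:
  assumes "ccell f g \<phi>" "\<Gamma> \<in> Obj C"
  shows "a \<in> El (Base f) \<Gamma> \<Longrightarrow> c0 (\<psi> \<odot> \<phi>) \<Gamma> a = c0 \<psi> \<Gamma> (c0 \<phi> \<Gamma> a)"
    and "b \<in> El (Tot f) \<Gamma> \<Longrightarrow> c1 (\<psi> \<odot> \<phi>) \<Gamma> b = c1 \<psi> \<Gamma> (c1 \<phi> \<Gamma> b)"
  using assms ccellD[OF assms(1)] by (simp_all add: ccomp_def ncomp_apply)

text \<open>Strict, since a composite is restricted to the elements of its source and
  \<open>\<phi>\<close> maps these into the source of \<open>\<psi>\<close>.\<close>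

lemma ccomp_assoc:
  assumes "ccell f g \<phi>" "ccell g h \<psi>"
  shows "(\<chi> \<odot> \<psi>) \<odot> \<phi> = \<chi> \<odot> \<psi> \<odot> \<phi>"
  using ccellD[OF assms(1)] ccellD[OF assms(2)] by (simp add: ccomp_def ncomp_assoc)

lemma ccomp_cid:
  assumes \<phi>: "ccell f g \<phi>"
  shows "\<phi> \<odot> cid f = \<phi>"
proof -
  note id = ccell_cid[OF ccellD(5)[OF \<phi>]]
  have c: "c0 (cid f) = nid (Base f)" "c1 (cid f) = nid (Tot f)" by (simp_all add: cid_def)
  show ?thesis
    by (rule cell_eqI[OF ccell_ccomp[OF \<phi> id] \<phi>]) (simp_all add: ccomp_apply[OF id] c nid_apply)
qed

section \<open>Adjustments are determined by their boundaries\<close>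

lemma adjustment_the_adj:
  "cartesian \<phi> \<Longrightarrow> cartesian \<psi> \<Longrightarrow> Dm \<phi> = Dm \<psi> \<Longrightarrow> Cd \<phi> = Cd \<psi> \<Longrightarrow> adjustment \<phi> \<psi> (the_adj \<phi> \<psi>)"
  unfolding the_adj_def by (rule theI') (rule ex1_adjustment)

text \<open>Local codiscreteness in the form used for the coherence laws: it suffices that both
  sides are adjustments with the same source cell and the same target cell.\<close>

lemma adjustment_unique: "adjustment \<phi> \<psi> \<alpha> \<Longrightarrow> adjustment \<phi> \<psi> \<beta> \<Longrightarrow> \<alpha> = \<beta>"
  using ex1_adjustment[of \<phi> \<psi>] unfolding adjustment_def by blast

lemma adjustmentD:
  assumes "adjustment \<phi> \<psi> \<alpha>"
  shows "Dm3 \<alpha> = \<phi>" "Cd3 \<alpha> = \<psi>" "cartesian \<phi>" "cartesian \<psi>" "Dm \<psi> = Dm \<phi>" "Cd \<psi> = Cd \<phi>"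
  using assms by (simp_all add: adjustment_def)

lemma adjustment_aid:
  assumes "cartesian \<phi>"
  shows "adjustment \<phi> \<phi> (aid \<phi>)"
proof -
  have "square \<phi>" using assms by (simp add: cartesian_def)
  then have "nat_trans (cpb \<phi>) (cpb \<phi>) (nid (cpb \<phi>))" by (intro nat_trans_nid presheaf_cpb)
  moreover have "ncomp (cpb \<phi>) (c2 \<phi>) (nid (cpb \<phi>)) = c2 \<phi>"
    using nat_trans_undefined[OF nat_trans_c2[OF assms]]
    by (auto simp: fun_eq_iff ncomp_def nid_def on_def)
  ultimately show ?thesis using assms by (simp add: adjustment_def aid_def)
qed

text \<open>The conditions on \<open>c2\<close> compose because \<open>amap \<alpha>\<close> lands
  in the chosen pullback of the middle cell \<open>\<psi>\<close>, at which both factors have to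
  meet literally.\<close>

lemma adjustment_athen:
  assumes \<alpha>: "adjustment \<phi> \<psi> \<alpha>" and \<beta>: "adjustment \<psi> \<chi> \<beta>"
  shows "adjustment \<phi> \<chi> (\<alpha> \<then> \<beta>)"
proof -
  note a = \<alpha>[unfolded adjustment_def] and b = \<beta>[unfolded adjustment_def]
  have "presheaf (cpb \<phi>)" using a by (blast intro: presheaf_cpb cartesian_def[THEN iffD1, THEN conjunct1])
  then have "nat_trans (cpb \<phi>) (cpb \<chi>) (ncomp (cpb \<phi>) (amap \<beta>) (amap \<alpha>))"
    using a b nat_trans_ncomp by blast
  moreover have "ncomp (cpb \<phi>) (c2 \<chi>) (ncomp (cpb \<phi>) (amap \<beta>) (amap \<alpha>)) = c2 \<phi>"
    using a b ncomp_assoc[of "cpb \<phi>" "cpb \<psi>" "amap \<alpha>" "c2 \<chi>" "amap \<beta>"] by simp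
  ultimately show ?thesis using a b by (simp add: adjustment_def athen_def)
qed

text \<open>Inverses come for free: an adjustment in the opposite direction exists, and each round
  trip is parallel to an identity adjustment, hence equal to it.\<close>

lemma inv_adjustment_the_adj:
  assumes "cartesian \<phi>" "cartesian \<psi>" "Dm \<phi> = Dm \<psi>" "Cd \<phi> = Cd \<psi>"
  shows "inv_adjustment \<phi> \<psi> (the_adj \<phi> \<psi>)"
  unfolding inv_adjustment_def
proof (intro conjI exI)
  show 1: "adjustment \<phi> \<psi> (the_adj \<phi> \<psi>)" using assms by (intro adjustment_the_adj)
  show 2: "adjustment \<psi> \<phi> (the_adj \<psi> \<phi>)" using assms by (intro adjustment_the_adj) simp_all
  show "(the_adj \<phi> \<psi> \<then> the_adj \<psi> \<phi>) = aid \<phi>"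
    by (rule adjustment_unique[OF adjustment_athen[OF 1 2] adjustment_aid[OF assms(1)]])
  show "(the_adj \<psi> \<phi> \<then> the_adj \<phi> \<psi>) = aid \<psi>"
    by (rule adjustment_unique[OF adjustment_athen[OF 2 1] adjustment_aid[OF assms(2)]])
qed

section \<open>Extensions of polynomials\<close>

text \<open>The condition \<open>\<sigma> \<in> Hom C \<Delta> \<Gamma>\<close> makes
  \<open>\<Delta>\<close> an object, so the extensional Yoneda map takes its proper value
  \<open>Res (Base f) \<sigma> a\<close> here instead of \<open>undefined\<close>.\<close>

lemma fibre_iff: "(\<sigma>, b) \<in> El (fibre f \<Gamma> a) \<Delta> \<longleftrightarrow>
    \<sigma> \<in> Hom C \<Delta> \<Gamma> \<and> b \<in> El (Tot f) \<Delta> \<and> Map f \<Delta> b = Res (Base f) \<sigma> a"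
  by (auto simp: fibre_def pb_def yoneda_def on_def yo_def dest: Hom_Obj)

lemma fibre_Obj: "z \<in> El (fibre f \<Gamma> a) \<Delta> \<Longrightarrow> \<Delta> \<in> Obj C"
  by (cases z) (auto simp: fibre_iff dest: Hom_Obj)

lemma fibre_Res: "Res (fibre f \<Gamma> a) \<tau> (\<sigma>, b) = (Comp C \<sigma> \<tau>, Res (Tot f) \<tau> b)"
  by (simp add: fibre_def pb_def yo_def)

lemma presheaf_fibre:
  "polynomial f \<Longrightarrow> \<Gamma> \<in> Obj C \<Longrightarrow> a \<in> El (Base f) \<Gamma> \<Longrightarrow> presheaf (fibre f \<Gamma> a)"
  unfolding fibre_def by (blast intro: presheaf_pb presheaf_yo nat_trans_yoneda polynomialD)

lemma fibre_Res_in: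
  assumes "polynomial f" "a \<in> El (Base f) \<Gamma>" "(\<sigma>, b) \<in> El (fibre f \<Gamma> a) \<Delta>" "\<tau> \<in> Hom C \<Xi> \<Delta>"
  shows "(Comp C \<sigma> \<tau>, Res (Tot f) \<tau> b) \<in> El (fibre f \<Gamma> a) \<Xi>"
proof -
  have "\<sigma> \<in> Hom C \<Delta> \<Gamma>" using assms(3) by (simp add: fibre_iff)
  then show ?thesis
    using presheaf_ResD[OF presheaf_fibre[OF assms(1) _ assms(2)] assms(4,3)] Hom_Obj
    by (simp add: fibre_Res)
qed

text \<open>Restricting the base element along \<open>\<rho>\<close> amounts to composing the arrow
  of a fibre point with \<open>\<rho>\<close>. This substitution underlies restriction in
  \<open>ext f X\<close>.\<close>

lemma fibre_Res_iff:
  assumes "polynomial f" "a \<in> El (Base f) \<Gamma>" "\<rho> \<in> Hom C \<Delta> \<Gamma>" "\<sigma> \<in> Hom C \<Xi> \<Delta>"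
  shows "(\<sigma>, b) \<in> El (fibre f \<Delta> (Res (Base f) \<rho> a)) \<Xi> \<longleftrightarrow> (Comp C \<rho> \<sigma>, b) \<in> El (fibre f \<Gamma> a) \<Xi>"
  using assms polynomialD[OF assms(1)] by (simp add: fibre_iff Comp_in presheaf_CompD)

text \<open>The generic point belonging to \<open>b\<close>. Composite polynomials evaluate
  functions at such points, since they read \<open>m(d)\<close> as a value at an identity.\<close>

lemma fibre_Ident:
  "polynomial f \<Longrightarrow> \<Gamma> \<in> Obj C \<Longrightarrow> b \<in> El (Tot f) \<Gamma> \<Longrightarrow> (Ident C \<Gamma>, b) \<in> El (fibre f \<Gamma> (Map f \<Gamma> b)) \<Gamma>"
  using polynomialD[of f] by (simp add: fibre_iff Ident_in presheaf_IdentD nat_trans_in)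

lemma nat_trans_fibreI:
  assumes "polynomial f" "\<Gamma> \<in> Obj C" "a \<in> El (Base f) \<Gamma>"
    and "\<And>\<Delta> \<sigma> b. (\<sigma>, b) \<in> El (fibre f \<Gamma> a) \<Delta> \<Longrightarrow> t \<Delta> (\<sigma>, b) \<in> El X \<Delta>"
    and "\<And>\<Xi> \<Delta> \<tau> \<sigma> b. (\<sigma>, b) \<in> El (fibre f \<Gamma> a) \<Delta> \<Longrightarrow> \<tau> \<in> Hom C \<Xi> \<Delta> \<Longrightarrow>
      t \<Xi> (Comp C \<sigma> \<tau>, Res (Tot f) \<tau> b) = Res X \<tau> (t \<Delta> (\<sigma>, b))"
  shows "nat_trans (fibre f \<Gamma> a) X (on (fibre f \<Gamma> a) t)"
  by (rule nat_trans_onI[OF presheaf_fibre[OF assms(1-3)]]) (use assms(4,5) in \<open>auto simp: fibre_Res\<close>)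

lemma ext_iff: "e \<in> El (ext f X) \<Gamma> \<longleftrightarrow>
    fst e \<in> El (Base f) \<Gamma> \<and> nat_trans (fibre f \<Gamma> (fst e)) X (snd e)"
  by (cases e) (simp add: ext_def)

lemma ext_fst: "e \<in> El (ext f X) \<Gamma> \<Longrightarrow> fst e \<in> El (Base f) \<Gamma>"
  by (simp add: ext_iff)

lemma ext_eval:
  assumes "e \<in> El (ext f X) \<Gamma>" "z \<in> El (fibre f \<Gamma> (fst e)) \<Delta>"
  shows "snd e \<Delta> z \<in> El X \<Delta>"
proof -
  have "\<Delta> \<in> Obj C" using fibre_Obj[OF assms(2)] .
  then show ?thesis using assms by (auto simp: ext_iff intro: nat_trans_in)
qed

lemma ext_eval_Res:
  assumes "e \<in> El (ext f X) \<Gamma>" "(\<sigma>, b) \<in> El (fibre f \<Gamma> (fst e)) \<Delta>" "\<tau> \<in> Hom C \<Xi> \<Delta>"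
  shows "snd e \<Xi> (Comp C \<sigma> \<tau>, Res (Tot f) \<tau> b) = Res X \<tau> (snd e \<Delta> (\<sigma>, b))"
  using assms nat_trans_natural[of "fibre f \<Gamma> (fst e)" X "snd e" \<tau> \<Xi> \<Delta> "(\<sigma>, b)"]
  by (simp add: ext_iff fibre_Res)

text \<open>Off the fibre both functions are \<open>undefined\<close>, whatever presheaf they map
  into; the targets \<open>X\<close> and \<open>Y\<close> may therefore differ.\<close>

lemma ext_eqI:
  assumes "e \<in> El (ext f X) \<Gamma>" "e' \<in> El (ext f Y) \<Gamma>" "fst e = fst e'"
    and "\<And>\<Delta> \<sigma> b. (\<sigma>, b) \<in> El (fibre f \<Gamma> (fst e)) \<Delta> \<Longrightarrow> snd e \<Delta> (\<sigma>, b) = snd e' \<Delta> (\<sigma>, b)"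
  shows "e = e'"
proof (rule prod_eqI)
  show "snd e = snd e'"
    by (rule nat_trans_eqI[of "fibre f \<Gamma> (fst e)" X _ Y]) (use assms in \<open>auto simp: ext_iff\<close>)
qed fact

lemma ext_Res_fst: "fst (Res (ext f X) \<rho> e) = Res (Base f) \<rho> (fst e)"
  by (cases e) (simp add: ext_def)

lemma ext_Res_eval:
  assumes "polynomial f" "\<rho> \<in> Hom C \<Delta> \<Gamma>" "e \<in> El (ext f X) \<Gamma>"
    and "(\<sigma>, b) \<in> El (fibre f \<Delta> (Res (Base f) \<rho> (fst e))) \<Xi>"
  shows "snd (Res (ext f X) \<rho> e) \<Xi> (\<sigma>, b) = snd e \<Xi> (Comp C \<rho> \<sigma>, b)"
proof -
  have "Src C \<rho> = \<Delta>" "\<Xi> \<in> Obj C" using assms(2,4) by (auto simp: Hom_def fibre_iff dest: Src_in)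
  then show ?thesis using assms(4) by (cases e) (simp add: ext_def on_apply)
qed

text \<open>Restriction along \<open>\<rho>\<close> precomposes a function with the map of fibres
  that composes arrows with \<open>\<rho>\<close>, so functoriality comes from the identity and
  associativity laws of \<open>C\<close> and the presheaf laws of \<open>Base f\<close>.\<close>

lemma presheaf_ext:
  assumes f: "polynomial f" and X: "presheaf X"
  shows "presheaf (ext f X)"
proof -
  note ps = polynomialD[OF f]
  have in': "Res (ext f X) \<rho> e \<in> El (ext f X) \<Delta>" if r: "\<rho> \<in> Hom C \<Delta> \<Gamma>" and e: "e \<in> El (ext f X) \<Gamma>"
    for \<rho> \<Delta> \<Gamma> e
  proof -
    note o = Hom_Obj[OF r]
    have b: "Res (Base f) \<rho> (fst e) \<in> El (Base f) \<Delta>"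
      using polynomial_in(3)[OF f r ext_fst[OF e]] .
    have "nat_trans (fibre f \<Delta> (Res (Base f) \<rho> (fst e))) X
        (on (fibre f \<Delta> (Res (Base f) \<rho> (fst e))) (\<lambda>\<Delta> (\<sigma>, b). snd e \<Delta> (Comp C \<rho> \<sigma>, b)))"
    proof (rule nat_trans_fibreI[OF f o[THEN conjunct1] b])
      fix \<Xi> \<sigma> b assume z: "(\<sigma>, b) \<in> El (fibre f \<Delta> (Res (Base f) \<rho> (fst e))) \<Xi>"
      then have s: "\<sigma> \<in> Hom C \<Xi> \<Delta>" by (simp add: fibre_iff)
      have z': "(Comp C \<rho> \<sigma>, b) \<in> El (fibre f \<Gamma> (fst e)) \<Xi>"
        using z fibre_Res_iff[OF f ext_fst[OF e] r s] by simp
      show "(case (\<sigma>, b) of (\<sigma>, b) \<Rightarrow> snd e \<Xi> (Comp C \<rho> \<sigma>, b)) \<in> El X \<Xi>"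
        using ext_eval[OF e z'] by simp
      fix \<Theta> \<tau> assume t: "\<tau> \<in> Hom C \<Theta> \<Xi>"
      show "(case (Comp C \<sigma> \<tau>, Res (Tot f) \<tau> b) of (\<sigma>, b) \<Rightarrow> snd e \<Theta> (Comp C \<rho> \<sigma>, b)) =
          Res X \<tau> (case (\<sigma>, b) of (\<sigma>, b) \<Rightarrow> snd e \<Xi> (Comp C \<rho> \<sigma>, b))"
        using ext_eval_Res[OF e z' t] Comp_assoc[OF r s t] by simp
    qed
    moreover have "Src C \<rho> = \<Delta>" using r by (simp add: Hom_def)
    ultimately show ?thesis using b by (cases e) (simp add: ext_def)
  qed
  show ?thesis
    unfolding presheaf_def
  proof (intro conjI allI ballI)
    fix \<Delta> \<Gamma> \<sigma> e assume "\<sigma> \<in> Hom C \<Delta> \<Gamma>" "e \<in> El (ext f X) \<Gamma>"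
    then show "Res (ext f X) \<sigma> e \<in> El (ext f X) \<Delta>" by (rule in')
  next
    fix \<Gamma> e assume g: "\<Gamma> \<in> Obj C" and e: "e \<in> El (ext f X) \<Gamma>"
    note I = Ident_in[OF g] and ea = ext_fst[OF e]
    show "Res (ext f X) (Ident C \<Gamma>) e = e"
    proof (rule ext_eqI[OF in'[OF I e] e])
      show "fst (Res (ext f X) (Ident C \<Gamma>) e) = fst e"
        using ps g ea by (simp add: ext_Res_fst presheaf_IdentD)
      fix \<Delta> \<sigma> b assume "(\<sigma>, b) \<in> El (fibre f \<Gamma> (fst (Res (ext f X) (Ident C \<Gamma>) e))) \<Delta>"
      then show "snd (Res (ext f X) (Ident C \<Gamma>) e) \<Delta> (\<sigma>, b) = snd e \<Delta> (\<sigma>, b)"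
        using Ident_Comp[of \<sigma> \<Delta> \<Gamma>] by (simp add: ext_Res_fst ext_Res_eval[OF f I e]) (simp add: fibre_iff)
    qed
  next
    fix \<Xi> \<Delta> \<Gamma> \<sigma> \<tau> e assume s: "\<sigma> \<in> Hom C \<Delta> \<Gamma>" and t: "\<tau> \<in> Hom C \<Xi> \<Delta>" and e: "e \<in> El (ext f X) \<Gamma>"
    note st = Comp_in[OF s t] and ea = ext_fst[OF e]
    show "Res (ext f X) (Comp C \<sigma> \<tau>) e = Res (ext f X) \<tau> (Res (ext f X) \<sigma> e)"
    proof (rule ext_eqI[OF in'[OF st e] in'[OF t in'[OF s e]]])
      show "fst (Res (ext f X) (Comp C \<sigma> \<tau>) e) = fst (Res (ext f X) \<tau> (Res (ext f X) \<sigma> e))"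
        using ps s t ea by (simp add: ext_Res_fst presheaf_CompD)
      fix \<Theta> \<upsilon> b assume "(\<upsilon>, b) \<in> El (fibre f \<Xi> (fst (Res (ext f X) (Comp C \<sigma> \<tau>) e))) \<Theta>"
      then have z: "(\<upsilon>, b) \<in> El (fibre f \<Xi> (Res (Base f) (Comp C \<sigma> \<tau>) (fst e))) \<Theta>"
        by (simp add: ext_Res_fst)
      then have z1: "(\<upsilon>, b) \<in> El (fibre f \<Xi> (Res (Base f) \<tau> (fst (Res (ext f X) \<sigma> e)))) \<Theta>"
        using ps s t ea by (simp add: ext_Res_fst presheaf_CompD)
      have u: "\<upsilon> \<in> Hom C \<Theta> \<Xi>" using z by (simp add: fibre_iff)
      have z2: "(Comp C \<tau> \<upsilon>, b) \<in> El (fibre f \<Delta> (Res (Base f) \<sigma> (fst e))) \<Theta>"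
        using z1 fibre_Res_iff[OF f _ t u] polynomial_in(3)[OF f s ea] by (simp add: ext_Res_fst)
      show "snd (Res (ext f X) (Comp C \<sigma> \<tau>) e) \<Theta> (\<upsilon>, b) =
          snd (Res (ext f X) \<tau> (Res (ext f X) \<sigma> e)) \<Theta> (\<upsilon>, b)"
        using ext_Res_eval[OF f st e z] ext_Res_eval[OF f t in'[OF s e] z1] ext_Res_eval[OF f s e z2]
          Comp_assoc[OF s t u] by simp
    qed
  qed
qed

lemma ext_map_fst: "\<Gamma> \<in> Obj C \<Longrightarrow> e \<in> El (ext f X) \<Gamma> \<Longrightarrow> fst (ext_map f X h \<Gamma> e) = fst e"
  by (cases e) (simp add: ext_map_def on_apply)

lemma ext_map_eval:
  "\<Gamma> \<in> Obj C \<Longrightarrow> e \<in> El (ext f X) \<Gamma> \<Longrightarrow> z \<in> El (fibre f \<Gamma> (fst e)) \<Delta> \<Longrightarrow>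
    snd (ext_map f X h \<Gamma> e) \<Delta> z = h \<Delta> (snd e \<Delta> z)"
  using fibre_Obj[of z f \<Gamma> "fst e" \<Delta>] by (cases e) (simp add: ext_map_def on_apply ncomp_apply)

lemma ext_map_in:
  assumes "polynomial f" "nat_trans X Y h" "\<Gamma> \<in> Obj C" "e \<in> El (ext f X) \<Gamma>"
  shows "ext_map f X h \<Gamma> e \<in> El (ext f Y) \<Gamma>"
proof -
  have "nat_trans (fibre f \<Gamma> (fst e)) Y (ncomp (fibre f \<Gamma> (fst e)) h (snd e))"
    using assms by (auto simp: ext_iff intro: nat_trans_ncomp presheaf_fibre)
  then show ?thesis using assms by (cases e) (auto simp: ext_map_def on_apply ext_iff)
qed

lemma nat_trans_ext_map:
  assumes f: "polynomial f" and X: "presheaf X" and Y: "presheaf Y" and h: "nat_trans X Y h"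
  shows "nat_trans (ext f X) (ext f Y) (ext_map f X h)"
proof -
  have "nat_trans (ext f X) (ext f Y) (on (ext f X) (ext_map f X h))"
  proof (rule nat_trans_onI[OF presheaf_ext[OF f X]])
    fix \<Gamma> e assume "\<Gamma> \<in> Obj C" "e \<in> El (ext f X) \<Gamma>"
    then show "ext_map f X h \<Gamma> e \<in> El (ext f Y) \<Gamma>" by (rule ext_map_in[OF f h])
  next
    fix \<Delta> \<Gamma> \<sigma> e assume s: "\<sigma> \<in> Hom C \<Delta> \<Gamma>" and e: "e \<in> El (ext f X) \<Gamma>"
    note o = Hom_Obj[OF s]
    have se: "Res (ext f X) \<sigma> e \<in> El (ext f X) \<Delta>" using presheaf_ResD[OF presheaf_ext[OF f X] s e] .
    have he: "ext_map f X h \<Gamma> e \<in> El (ext f Y) \<Gamma>" using ext_map_in[OF f h _ e] o by simp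
    show "ext_map f X h \<Delta> (Res (ext f X) \<sigma> e) = Res (ext f Y) \<sigma> (ext_map f X h \<Gamma> e)"
    proof (rule ext_eqI[OF ext_map_in[OF f h _ se] presheaf_ResD[OF presheaf_ext[OF f Y] s he]])
      show "\<Delta> \<in> Obj C" using o by simp
      show 1: "fst (ext_map f X h \<Delta> (Res (ext f X) \<sigma> e)) = fst (Res (ext f Y) \<sigma> (ext_map f X h \<Gamma> e))"
        using o e se by (simp add: ext_map_fst ext_Res_fst)
      fix \<Xi> \<tau> b assume "(\<tau>, b) \<in> El (fibre f \<Delta> (fst (ext_map f X h \<Delta> (Res (ext f X) \<sigma> e)))) \<Xi>"
      then have z: "(\<tau>, b) \<in> El (fibre f \<Delta> (Res (Base f) \<sigma> (fst e))) \<Xi>"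
        using 1 o e by (simp add: ext_map_fst ext_Res_fst)
      then have "(Comp C \<sigma> \<tau>, b) \<in> El (fibre f \<Gamma> (fst e)) \<Xi>"
        using fibre_Res_iff[OF f ext_fst[OF e] s, of \<tau> \<Xi> b] by (simp add: fibre_iff)
      then show "snd (ext_map f X h \<Delta> (Res (ext f X) \<sigma> e)) \<Xi> (\<tau>, b) =
          snd (Res (ext f Y) \<sigma> (ext_map f X h \<Gamma> e)) \<Xi> (\<tau>, b)"
        using z o e se he
        by (simp add: ext_map_eval ext_map_fst ext_Res_fst ext_Res_eval[OF f s])
    qed
  qed
  moreover have "on (ext f X) (ext_map f X h) = ext_map f X h"
    by (auto simp: ext_map_def on_def fun_eq_iff)
  ultimately show ?thesis by simp
qed

lemma ext_map_ncomp:
  assumes "polynomial f" "nat_trans X Y h" "nat_trans Y Z k" "\<Gamma> \<in> Obj C" "e \<in> El (ext f X) \<Gamma>"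
  shows "ext_map f Y k \<Gamma> (ext_map f X h \<Gamma> e) = ext_map f X (ncomp X k h) \<Gamma> e"
proof -
  have "ncomp (fibre f \<Gamma> (fst e)) k (ncomp (fibre f \<Gamma> (fst e)) h (snd e)) =
      ncomp (fibre f \<Gamma> (fst e)) (ncomp X k h) (snd e)"
    using assms(5) by (intro ncomp_assoc[symmetric]) (simp add: ext_iff)
  moreover have "ext_map f X h \<Gamma> e \<in> El (ext f Y) \<Gamma>" using ext_map_in assms by blast
  ultimately show ?thesis using assms(4,5) by (cases e) (simp add: ext_map_def on_apply)
qed

text \<open>Only values on elements of \<open>X\<close> enter, so a raw function such as
  \<open>fst\<close> may be exchanged for its extensional restriction.\<close>

lemma ext_map_cong:
  assumes "\<Gamma> \<in> Obj C" "e \<in> El (ext f X) \<Gamma>" "\<And>\<Gamma> x. \<Gamma> \<in> Obj C \<Longrightarrow> x \<in> El X \<Gamma> \<Longrightarrow> h \<Gamma> x = k \<Gamma> x"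
  shows "ext_map f X h \<Gamma> e = ext_map f X k \<Gamma> e"
  using assms
  by (cases e) (auto simp: ext_map_def on_apply ncomp_def on_def fun_eq_iff ext_iff nat_trans_in)

lemma ext_map_nid:
  assumes "polynomial f" "presheaf X" "\<Gamma> \<in> Obj C" "e \<in> El (ext f X) \<Gamma>"
  shows "ext_map f X (nid X) \<Gamma> e = e"
  by (rule ext_eqI[OF ext_map_in[OF assms(1) nat_trans_nid[OF assms(2)] assms(3,4)] assms(4)])
     (use assms in \<open>auto simp: ext_map_fst ext_map_eval ext_eval nid_apply fibre_Obj\<close>)

lemma polynomial_ext_poly: "polynomial g \<Longrightarrow> polynomial f \<Longrightarrow> polynomial (ext_poly g f)"
  unfolding polynomial_def[of "ext_poly g f"]
  by (simp add: ext_poly_def presheaf_ext nat_trans_ext_map polynomialD)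

section \<open>The functor induced by a polynomial, acting on cartesian cells\<close>

text \<open>Exponentiation preserves pullbacks: an element of the extension is a map out of a fibre
  of \<open>p\<close>, so its lift is the mediating map for the cone whose vertex is that
  fibre.\<close>

lemma ccell_lift_cell:
  assumes p: "polynomial p" and \<phi>: "ccell f g \<phi>"
  shows "ccell (ext_poly p f) (ext_poly p g) (lift_cell p \<phi>)"
proof (rule ccellI)
  note ps = ccellD[OF \<phi>] and pf = polynomialD[OF ccellD(5)[OF \<phi>]] and pg = polynomialD[OF ccellD(6)[OF \<phi>]]
  show "Dm (lift_cell p \<phi>) = ext_poly p f" "Cd (lift_cell p \<phi>) = ext_poly p g"
    by (simp_all add: lift_cell_def ps)
  show "polynomial (ext_poly p f)" "polynomial (ext_poly p g)" using polynomial_ext_poly p ps by blast+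
  show "nat_trans (Base (ext_poly p f)) (Base (ext_poly p g)) (c0 (lift_cell p \<phi>))"
    "nat_trans (Tot (ext_poly p f)) (Tot (ext_poly p g)) (c1 (lift_cell p \<phi>))"
    using nat_trans_ext_map[OF p pf(2) pg(2) ps(7)] nat_trans_ext_map[OF p pf(1) pg(1) ps(8)]
    by (simp_all add: lift_cell_def ext_poly_def ps)
  fix \<Gamma> assume \<Gamma>: "\<Gamma> \<in> Obj C"
  show "Map (ext_poly p g) \<Gamma> (c1 (lift_cell p \<phi>) \<Gamma> e) = c0 (lift_cell p \<phi>) \<Gamma> (Map (ext_poly p f) \<Gamma> e)"
    if "e \<in> El (Tot (ext_poly p f)) \<Gamma>" for e
    using that ext_map_ncomp[OF p ps(8) pg(3) \<Gamma>] ext_map_ncomp[OF p pf(3) ps(7) \<Gamma>]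
      square_def[of \<phi>] ps
    by (simp add: lift_cell_def ext_poly_def)
  fix e e' assume "e \<in> El (Base (ext_poly p f)) \<Gamma>" "e' \<in> El (Tot (ext_poly p g)) \<Gamma>"
    "Map (ext_poly p g) \<Gamma> e' = c0 (lift_cell p \<phi>) \<Gamma> e"
  then have e: "e \<in> El (ext p (Base f)) \<Gamma>" and e': "e' \<in> El (ext p (Tot g)) \<Gamma>"
    and eq: "ext_map p (Tot g) (Map g) \<Gamma> e' = ext_map p (Base f) (c0 \<phi>) \<Gamma> e"
    by (simp_all add: lift_cell_def ext_poly_def ps)
  have fst: "fst e' = fst e" using eq ext_map_fst[OF \<Gamma> e] ext_map_fst[OF \<Gamma> e'] by metis
  let ?Z = "fibre p \<Gamma> (fst e)"
  have "cone \<phi> ?Z (snd e) (snd e')"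
    using e e' eq fst presheaf_fibre[OF p \<Gamma>] \<Gamma> unfolding cone_def ps
    by (cases e; cases e') (auto simp: ext_iff ext_map_def on_apply)
  \<comment> \<open>Elements of a fibre are pairs rather than arrows, which calls for the universal
    property at arbitrary element types.\<close>
  from cartesian_universal[OF ps(1) this, unfolded ps]
  obtain u where u: "nat_trans ?Z (Tot f) u" "ncomp ?Z (Map f) u = snd e" "ncomp ?Z (c1 \<phi>) u = snd e'"
    and uniq: "\<And>v. nat_trans ?Z (Tot f) v \<Longrightarrow> ncomp ?Z (Map f) v = snd e \<Longrightarrow>
      ncomp ?Z (c1 \<phi>) v = snd e' \<Longrightarrow> v = u" by blast
  have "\<exists>!w. w \<in> El (ext p (Tot f)) \<Gamma> \<and> ext_map p (Tot f) (Map f) \<Gamma> w = e \<and>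
      ext_map p (Tot f) (c1 \<phi>) \<Gamma> w = e'"
  proof (rule ex1I[of _ "(fst e, u)"])
    show "(fst e, u) \<in> El (ext p (Tot f)) \<Gamma> \<and> ext_map p (Tot f) (Map f) \<Gamma> (fst e, u) = e \<and>
        ext_map p (Tot f) (c1 \<phi>) \<Gamma> (fst e, u) = e'"
      using u \<Gamma> ext_fst[OF e] fst by (auto simp: ext_iff ext_map_def on_apply prod_eq_iff)
  next
    fix w assume "w \<in> El (ext p (Tot f)) \<Gamma> \<and> ext_map p (Tot f) (Map f) \<Gamma> w = e \<and>
        ext_map p (Tot f) (c1 \<phi>) \<Gamma> w = e'"
    then show "w = (fst e, u)"
      using uniq[of "snd w"] \<Gamma> by (cases w) (auto simp: ext_iff ext_map_def on_apply)
  qed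
  then show "\<exists>!w. w \<in> El (Tot (ext_poly p f)) \<Gamma> \<and> Map (ext_poly p f) \<Gamma> w = e \<and>
      c1 (lift_cell p \<phi>) \<Gamma> w = e'"
    by (simp add: lift_cell_def ext_poly_def ps)
qed

lemma lift_cell_ccomp:
  assumes p: "polynomial p" and \<psi>: "ccell g h \<psi>" and \<phi>: "ccell f g \<phi>"
  shows "lift_cell p (\<psi> \<odot> \<phi>) = lift_cell p \<psi> \<odot> lift_cell p \<phi>"
proof (rule cell_eqI[OF ccell_lift_cell[OF p ccell_ccomp[OF \<psi> \<phi>]]
      ccell_ccomp[OF ccell_lift_cell[OF p \<psi>] ccell_lift_cell[OF p \<phi>]]])
  note ps = ccellD[OF \<phi>] and qs = ccellD[OF \<psi>]
  fix \<Gamma> assume \<Gamma>: "\<Gamma> \<in> Obj C"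
  show "c0 (lift_cell p (\<psi> \<odot> \<phi>)) \<Gamma> e = c0 (lift_cell p \<psi> \<odot> lift_cell p \<phi>) \<Gamma> e"
    if "e \<in> El (Base (ext_poly p f)) \<Gamma>" for e
    unfolding ccomp_apply(1)[OF ccell_lift_cell[OF p \<phi>] \<Gamma> that]
    using that ext_map_ncomp[OF p ps(7) qs(7) \<Gamma>] by (simp add: lift_cell_def ext_poly_def ccomp_def ps qs)
  show "c1 (lift_cell p (\<psi> \<odot> \<phi>)) \<Gamma> e = c1 (lift_cell p \<psi> \<odot> lift_cell p \<phi>) \<Gamma> e"
    if "e \<in> El (Tot (ext_poly p f)) \<Gamma>" for e
    unfolding ccomp_apply(2)[OF ccell_lift_cell[OF p \<phi>] \<Gamma> that]
    using that ext_map_ncomp[OF p ps(8) qs(8) \<Gamma>] by (simp add: lift_cell_def ext_poly_def ccomp_def ps qs)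
qed

lemma lift_cell_cid:
  assumes p: "polynomial p" and f: "polynomial f"
  shows "lift_cell p (cid f) = cid (ext_poly p f)"
  by (rule cell_eqI[OF _ ccell_cid[OF polynomial_ext_poly[OF p f]]])
     (use ccell_lift_cell[OF p ccell_cid[OF f]] polynomialD[OF f] in
       \<open>auto simp: lift_cell_def cid_def ext_poly_def ext_map_nid[OF p] nid_apply\<close>)

section \<open>The action of cartesian cells on extensions\<close>

text \<open>The fibre of \<open>g\<close> over \<open>c0 \<phi> a\<close> consists of the images \<open>c1 \<phi> b\<close> of the elements of the fibre of \<open>f\<close> over \<open>a\<close>.
  An element of \<open>P\<^sub>g(X)\<close> over \<open>c0 \<phi> a\<close> is therefore determined by its values there, and \<^const>\<open>c2\<close> need not be
  computed.\<close>

lemma fibre_push: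
  assumes "ccell f g \<phi>" "a \<in> El (Base f) \<Gamma>" "(\<sigma>, b) \<in> El (fibre f \<Gamma> a) \<Delta>"
  shows "(\<sigma>, c1 \<phi> \<Delta> b) \<in> El (fibre g \<Gamma> (c0 \<phi> \<Gamma> a)) \<Delta>"
  using assms fibre_Obj[OF assms(3)] ccell_in[OF assms(1)] ccell_comm[OF assms(1)] ccell_natural[OF assms(1)]
  by (auto simp: fibre_iff)

lemma fibre_cover:
  assumes "ccell f g \<phi>" "a \<in> El (Base f) \<Gamma>" "(\<sigma>, d) \<in> El (fibre g \<Gamma> (c0 \<phi> \<Gamma> a)) \<Delta>"
  obtains b where "(\<sigma>, b) \<in> El (fibre f \<Gamma> a) \<Delta>" "d = c1 \<phi> \<Delta> b"
proof -
  have s: "\<sigma> \<in> Hom C \<Delta> \<Gamma>" and d: "d \<in> El (Tot g) \<Delta>" "Map g \<Delta> d = Res (Base g) \<sigma> (c0 \<phi> \<Gamma> a)"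
    using assms(3) by (simp_all add: fibre_iff)
  have "Map g \<Delta> d = c0 \<phi> \<Delta> (Res (Base f) \<sigma> a)" using ccell_natural(1)[OF assms(1) s assms(2)] d by simp
  moreover have "Res (Base f) \<sigma> a \<in> El (Base f) \<Delta>"
    using polynomial_in(3)[OF ccellD(5)[OF assms(1)] s assms(2)] .
  ultimately obtain b where "b \<in> El (Tot f) \<Delta>" "Map f \<Delta> b = Res (Base f) \<sigma> a" "c1 \<phi> \<Delta> b = d"
    using ccell_ex1[OF assms(1) fibre_Obj[OF assms(3)] _ d(1)] by blast
  then show ?thesis using that s by (simp add: fibre_iff)
qed

lemma c2_fibre:
  assumes "ccell f g \<phi>" "(\<sigma>, b) \<in> El (fibre f \<Gamma> a) \<Delta>"
  shows "c2 \<phi> \<Delta> (Res (Base f) \<sigma> a, c1 \<phi> \<Delta> b) = b"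
  using c2_eq(2)[OF ccellD(1)[OF assms(1)] fibre_Obj[OF assms(2)], of b] assms(2) ccellD[OF assms(1)]
  by (simp add: fibre_iff)

lemma ext_cell_fst:
  "ccell f g \<phi> \<Longrightarrow> \<Gamma> \<in> Obj C \<Longrightarrow> e \<in> El (ext f X) \<Gamma> \<Longrightarrow> fst (ext_cell \<phi> X \<Gamma> e) = c0 \<phi> \<Gamma> (fst e)"
  using ccellD[of f g \<phi>] by (cases e) (simp add: ext_cell_def on_apply)

lemma ext_cell_eval:
  assumes "ccell f g \<phi>" "\<Gamma> \<in> Obj C" "e \<in> El (ext f X) \<Gamma>" "(\<sigma>, b) \<in> El (fibre f \<Gamma> (fst e)) \<Delta>"
  shows "snd (ext_cell \<phi> X \<Gamma> e) \<Delta> (\<sigma>, c1 \<phi> \<Delta> b) = snd e \<Delta> (\<sigma>, b)"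
  using ccellD[OF assms(1)] assms(2-) fibre_push[OF assms(1) ext_fst[OF assms(3)] assms(4)]
    c2_fibre[OF assms(1,4)] fibre_Obj[OF assms(4)]
  by (cases e) (simp add: ext_cell_def on_apply)

lemma ext_cell_in:
  assumes \<phi>: "ccell f g \<phi>" and \<Gamma>: "\<Gamma> \<in> Obj C" and e: "e \<in> El (ext f X) \<Gamma>"
  shows "ext_cell \<phi> X \<Gamma> e \<in> El (ext g X) \<Gamma>"
proof -
  note ps = ccellD[OF \<phi>] and a = ext_fst[OF e]
  let ?t = "\<lambda>\<Delta> (\<sigma>, d). snd e \<Delta> (\<sigma>, c2 \<phi> \<Delta> (Res (Base f) \<sigma> (fst e), d))"
  have ga: "c0 \<phi> \<Gamma> (fst e) \<in> El (Base g) \<Gamma>" using ccell_in[OF \<phi> \<Gamma>] a by blast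
  have "nat_trans (fibre g \<Gamma> (c0 \<phi> \<Gamma> (fst e))) X (on (fibre g \<Gamma> (c0 \<phi> \<Gamma> (fst e))) ?t)"
  proof (rule nat_trans_fibreI[OF ps(6) \<Gamma> ga])
    fix \<Delta> \<sigma> d assume "(\<sigma>, d) \<in> El (fibre g \<Gamma> (c0 \<phi> \<Gamma> (fst e))) \<Delta>"
    then obtain b where b: "(\<sigma>, b) \<in> El (fibre f \<Gamma> (fst e)) \<Delta>" "d = c1 \<phi> \<Delta> b"
      by (rule fibre_cover[OF \<phi> a])
    then show "?t \<Delta> (\<sigma>, d) \<in> El X \<Delta>" using c2_fibre[OF \<phi> b(1)] ext_eval[OF e b(1)] by simp
    fix \<Xi> \<tau> assume t: "\<tau> \<in> Hom C \<Xi> \<Delta>"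
    have 1: "Res (Tot g) \<tau> d = c1 \<phi> \<Xi> (Res (Tot f) \<tau> b)"
      using b t ccell_natural(2)[OF \<phi> t] by (simp add: fibre_iff)
    show "?t \<Xi> (Comp C \<sigma> \<tau>, Res (Tot g) \<tau> d) = Res X \<tau> (?t \<Delta> (\<sigma>, d))"
      using c2_fibre[OF \<phi> b(1)] c2_fibre[OF \<phi> fibre_Res_in[OF ps(5) a b(1) t]]
        ext_eval_Res[OF e b(1) t] 1 b(2) by simp
  qed
  then show ?thesis using ps \<Gamma> e ga by (cases e) (simp add: ext_cell_def on_apply ext_iff)
qed

lemma ext_cell_eqI:
  assumes "ccell f g \<phi>" "a \<in> El (Base f) \<Gamma>" "e \<in> El (ext g X) \<Gamma>" "e' \<in> El (ext g Y) \<Gamma>"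
    and "fst e = c0 \<phi> \<Gamma> a" "fst e' = c0 \<phi> \<Gamma> a"
    and "\<And>\<Delta> \<sigma> b. (\<sigma>, b) \<in> El (fibre f \<Gamma> a) \<Delta> \<Longrightarrow> snd e \<Delta> (\<sigma>, c1 \<phi> \<Delta> b) = snd e' \<Delta> (\<sigma>, c1 \<phi> \<Delta> b)"
  shows "e = e'"
  by (rule ext_eqI[OF assms(3,4)]) (use assms in \<open>auto elim!: fibre_cover[OF assms(1,2)]\<close>)

lemma nat_trans_ext_cell:
  assumes \<phi>: "ccell f g \<phi>" and X: "presheaf X"
  shows "nat_trans (ext f X) (ext g X) (ext_cell \<phi> X)"
proof -
  note f = ccellD(5)[OF \<phi>] and g = ccellD(6)[OF \<phi>]
  have "nat_trans (ext f X) (ext g X) (on (ext f X) (ext_cell \<phi> X))"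
  proof (rule nat_trans_onI[OF presheaf_ext[OF f X]])
    fix \<Gamma> e assume "\<Gamma> \<in> Obj C" "e \<in> El (ext f X) \<Gamma>"
    then show "ext_cell \<phi> X \<Gamma> e \<in> El (ext g X) \<Gamma>" by (rule ext_cell_in[OF \<phi>])
  next
    fix \<Delta> \<Gamma> \<rho> e assume r: "\<rho> \<in> Hom C \<Delta> \<Gamma>" and e: "e \<in> El (ext f X) \<Gamma>"
    note o = Hom_Obj[OF r] and a = ext_fst[OF e]
    have re: "Res (ext f X) \<rho> e \<in> El (ext f X) \<Delta>" using presheaf_ResD[OF presheaf_ext[OF f X] r e] .
    have pe: "ext_cell \<phi> X \<Gamma> e \<in> El (ext g X) \<Gamma>" using ext_cell_in[OF \<phi> _ e] o by simp
    have ra: "Res (Base f) \<rho> (fst e) \<in> El (Base f) \<Delta>" using polynomial_in(3)[OF f r a] .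
    show "ext_cell \<phi> X \<Delta> (Res (ext f X) \<rho> e) = Res (ext g X) \<rho> (ext_cell \<phi> X \<Gamma> e)"
    proof (rule ext_cell_eqI[OF \<phi> ra ext_cell_in[OF \<phi> o[THEN conjunct1] re]
          presheaf_ResD[OF presheaf_ext[OF g X] r pe]])
      show "fst (ext_cell \<phi> X \<Delta> (Res (ext f X) \<rho> e)) = c0 \<phi> \<Delta> (Res (Base f) \<rho> (fst e))"
        using o re by (simp add: ext_cell_fst[OF \<phi>] ext_Res_fst)
      show fst: "fst (Res (ext g X) \<rho> (ext_cell \<phi> X \<Gamma> e)) = c0 \<phi> \<Delta> (Res (Base f) \<rho> (fst e))"
        using o e a ccell_natural(1)[OF \<phi> r a] by (simp add: ext_cell_fst[OF \<phi>] ext_Res_fst)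
      fix \<Xi> \<sigma> b assume z: "(\<sigma>, b) \<in> El (fibre f \<Delta> (Res (Base f) \<rho> (fst e))) \<Xi>"
      then have z': "(Comp C \<rho> \<sigma>, b) \<in> El (fibre f \<Gamma> (fst e)) \<Xi>"
        using fibre_Res_iff[OF f a r, of \<sigma> \<Xi> b] by (simp add: fibre_iff)
      have "snd (Res (ext g X) \<rho> (ext_cell \<phi> X \<Gamma> e)) \<Xi> (\<sigma>, c1 \<phi> \<Xi> b) =
          snd (ext_cell \<phi> X \<Gamma> e) \<Xi> (Comp C \<rho> \<sigma>, c1 \<phi> \<Xi> b)"
        using fibre_push[OF \<phi> ra z] fst by (intro ext_Res_eval[OF g r pe]) (simp add: ext_Res_fst)
      also have "\<dots> = snd e \<Xi> (Comp C \<rho> \<sigma>, b)" using ext_cell_eval[OF \<phi> _ e z'] o by simp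
      also have "\<dots> = snd (Res (ext f X) \<rho> e) \<Xi> (\<sigma>, b)" using ext_Res_eval[OF f r e z] by simp
      also have "\<dots> = snd (ext_cell \<phi> X \<Delta> (Res (ext f X) \<rho> e)) \<Xi> (\<sigma>, c1 \<phi> \<Xi> b)"
        using ext_cell_eval[OF \<phi> _ re] z o by (simp add: ext_Res_fst)
      finally show "snd (ext_cell \<phi> X \<Delta> (Res (ext f X) \<rho> e)) \<Xi> (\<sigma>, c1 \<phi> \<Xi> b) =
          snd (Res (ext g X) \<rho> (ext_cell \<phi> X \<Gamma> e)) \<Xi> (\<sigma>, c1 \<phi> \<Xi> b)" by simp
    qed
  qed
  moreover have "on (ext f X) (ext_cell \<phi> X) = ext_cell \<phi> X"
    using ccellD[OF \<phi>] by (auto simp: ext_cell_def on_def fun_eq_iff)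
  ultimately show ?thesis by simp
qed

text \<open>Naturality of P_\<phi> in the presheaf: at the image of a fibre point
  \<open>(\<sigma>, b)\<close> both sides have the value of \<open>h\<close> at
  \<open>snd e \<Delta> (\<sigma>, b)\<close>.\<close>

lemma ext_cell_ext_map:
  assumes \<phi>: "ccell f g \<phi>" and h: "nat_trans X Y h" and \<Gamma>: "\<Gamma> \<in> Obj C" and e: "e \<in> El (ext f X) \<Gamma>"
  shows "ext_cell \<phi> Y \<Gamma> (ext_map f X h \<Gamma> e) = ext_map g X h \<Gamma> (ext_cell \<phi> X \<Gamma> e)"
proof (rule ext_cell_eqI[OF \<phi> ext_fst[OF e]])
  note f = ccellD(5)[OF \<phi>] and g = ccellD(6)[OF \<phi>] and a = ext_fst[OF e]
  have he: "ext_map f X h \<Gamma> e \<in> El (ext f Y) \<Gamma>" by (rule ext_map_in[OF f h \<Gamma> e])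
  have pe: "ext_cell \<phi> X \<Gamma> e \<in> El (ext g X) \<Gamma>" by (rule ext_cell_in[OF \<phi> \<Gamma> e])
  show "ext_cell \<phi> Y \<Gamma> (ext_map f X h \<Gamma> e) \<in> El (ext g Y) \<Gamma>" by (rule ext_cell_in[OF \<phi> \<Gamma> he])
  show "ext_map g X h \<Gamma> (ext_cell \<phi> X \<Gamma> e) \<in> El (ext g Y) \<Gamma>" by (rule ext_map_in[OF g h \<Gamma> pe])
  show "fst (ext_cell \<phi> Y \<Gamma> (ext_map f X h \<Gamma> e)) = c0 \<phi> \<Gamma> (fst e)"
    "fst (ext_map g X h \<Gamma> (ext_cell \<phi> X \<Gamma> e)) = c0 \<phi> \<Gamma> (fst e)"
    using \<Gamma> e he pe by (simp_all add: ext_cell_fst[OF \<phi>] ext_map_fst)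
  fix \<Delta> \<sigma> b assume z: "(\<sigma>, b) \<in> El (fibre f \<Gamma> (fst e)) \<Delta>"
  then show "snd (ext_cell \<phi> Y \<Gamma> (ext_map f X h \<Gamma> e)) \<Delta> (\<sigma>, c1 \<phi> \<Delta> b) =
      snd (ext_map g X h \<Gamma> (ext_cell \<phi> X \<Gamma> e)) \<Delta> (\<sigma>, c1 \<phi> \<Delta> b)"
    using fibre_push[OF \<phi> a z] \<Gamma> e he pe
    by (simp add: ext_cell_eval[OF \<phi>] ext_map_eval ext_map_fst ext_cell_fst[OF \<phi>])
qed

text \<open>At the image of a fibre point under the composite cell both sides return the original
  value of \<open>e\<close>, so the two descriptions by \<open>c2\<close> are never compared
  directly.\<close>

lemma ext_cell_ccomp:
  assumes \<psi>: "ccell g h \<psi>" and \<phi>: "ccell f g \<phi>" and \<Gamma>: "\<Gamma> \<in> Obj C" and e: "e \<in> El (ext f X) \<Gamma>"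
  shows "ext_cell (\<psi> \<odot> \<phi>) X \<Gamma> e = ext_cell \<psi> X \<Gamma> (ext_cell \<phi> X \<Gamma> e)"
proof (rule ext_cell_eqI[OF ccell_ccomp[OF \<psi> \<phi>] ext_fst[OF e]])
  note \<psi>\<phi> = ccell_ccomp[OF \<psi> \<phi>] and a = ext_fst[OF e]
  have pe: "ext_cell \<phi> X \<Gamma> e \<in> El (ext g X) \<Gamma>" by (rule ext_cell_in[OF \<phi> \<Gamma> e])
  show "ext_cell (\<psi> \<odot> \<phi>) X \<Gamma> e \<in> El (ext h X) \<Gamma>" by (rule ext_cell_in[OF \<psi>\<phi> \<Gamma> e])
  show "ext_cell \<psi> X \<Gamma> (ext_cell \<phi> X \<Gamma> e) \<in> El (ext h X) \<Gamma>" by (rule ext_cell_in[OF \<psi> \<Gamma> pe])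
  show "fst (ext_cell (\<psi> \<odot> \<phi>) X \<Gamma> e) = c0 (\<psi> \<odot> \<phi>) \<Gamma> (fst e)"
    "fst (ext_cell \<psi> X \<Gamma> (ext_cell \<phi> X \<Gamma> e)) = c0 (\<psi> \<odot> \<phi>) \<Gamma> (fst e)"
    using ext_cell_fst[OF \<psi>\<phi> \<Gamma> e] ext_cell_fst[OF \<phi> \<Gamma> e] ext_cell_fst[OF \<psi> \<Gamma> pe]
      ccomp_apply(1)[OF \<phi> \<Gamma> a, where \<psi> = \<psi>] by simp_all
  fix \<Delta> \<sigma> b assume z: "(\<sigma>, b) \<in> El (fibre f \<Gamma> (fst e)) \<Delta>"
  have b: "c1 (\<psi> \<odot> \<phi>) \<Delta> b = c1 \<psi> \<Delta> (c1 \<phi> \<Delta> b)"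
    using ccomp_apply(2)[OF \<phi> fibre_Obj[OF z], where \<psi> = \<psi>] z by (simp add: fibre_iff)
  have "snd (ext_cell (\<psi> \<odot> \<phi>) X \<Gamma> e) \<Delta> (\<sigma>, c1 (\<psi> \<odot> \<phi>) \<Delta> b) = snd e \<Delta> (\<sigma>, b)"
    by (rule ext_cell_eval[OF \<psi>\<phi> \<Gamma> e z])
  moreover have "snd (ext_cell \<psi> X \<Gamma> (ext_cell \<phi> X \<Gamma> e)) \<Delta> (\<sigma>, c1 \<psi> \<Delta> (c1 \<phi> \<Delta> b)) = snd e \<Delta> (\<sigma>, b)"
    using ext_cell_eval[OF \<psi> \<Gamma> pe] fibre_push[OF \<phi> a z] ext_cell_eval[OF \<phi> \<Gamma> e z] ext_cell_fst[OF \<phi> \<Gamma> e]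
    by simp
  ultimately show "snd (ext_cell (\<psi> \<odot> \<phi>) X \<Gamma> e) \<Delta> (\<sigma>, c1 (\<psi> \<odot> \<phi>) \<Delta> b) =
      snd (ext_cell \<psi> X \<Gamma> (ext_cell \<phi> X \<Gamma> e)) \<Delta> (\<sigma>, c1 (\<psi> \<odot> \<phi>) \<Delta> b)" by (simp add: b)
qed

lemma ext_cell_cid:
  assumes f: "polynomial f" and \<Gamma>: "\<Gamma> \<in> Obj C" and e: "e \<in> El (ext f X) \<Gamma>"
  shows "ext_cell (cid f) X \<Gamma> e = e"
proof (rule ext_eqI)
  note i = ccell_cid[OF f]
  show "ext_cell (cid f) X \<Gamma> e \<in> El (ext f X) \<Gamma>" by (rule ext_cell_in[OF i \<Gamma> e])
  show fst: "fst (ext_cell (cid f) X \<Gamma> e) = fst e"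
    using ext_cell_fst[OF i \<Gamma> e] ext_fst[OF e] \<Gamma> by (simp add: cid_def nid_apply)
  fix \<Delta> \<sigma> b assume "(\<sigma>, b) \<in> El (fibre f \<Gamma> (fst (ext_cell (cid f) X \<Gamma> e))) \<Delta>"
  then have z: "(\<sigma>, b) \<in> El (fibre f \<Gamma> (fst e)) \<Delta>" by (simp add: fst)
  have "c1 (cid f) \<Delta> b = b" using z fibre_Obj[OF z] by (simp add: fibre_iff cid_def nid_apply)
  then show "snd (ext_cell (cid f) X \<Gamma> e) \<Delta> (\<sigma>, b) = snd e \<Delta> (\<sigma>, b)"
    using ext_cell_eval[OF i \<Gamma> e z] by simp
qed (rule e)

text \<open>P_\<phi> is a cartesian transformation because \<open>\<phi>\<close> induces bijections
  of fibres: a function on the fibre of \<open>g\<close> over \<open>c0 \<phi> \<Gamma> a\<close>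
  amounts to a function on the fibre of \<open>f\<close> over \<open>a\<close>.\<close>

lemma ccell_ext_cell:
  assumes \<phi>: "ccell f g \<phi>" and k: "polynomial k"
  shows "ccell (ext_poly f k) (ext_poly g k)
    \<lparr>Dm = ext_poly f k, Cd = ext_poly g k, c0 = ext_cell \<phi> (Base k), c1 = ext_cell \<phi> (Tot k)\<rparr>"
proof (rule ccellI)
  note f = ccellD(5)[OF \<phi>] and g = ccellD(6)[OF \<phi>] and pk = polynomialD[OF k]
  let ?e = "\<lparr>Dm = ext_poly f k, Cd = ext_poly g k, c0 = ext_cell \<phi> (Base k), c1 = ext_cell \<phi> (Tot k)\<rparr>"
  show "polynomial (ext_poly f k)" "polynomial (ext_poly g k)" using polynomial_ext_poly f g k by blast+
  show "nat_trans (Base (ext_poly f k)) (Base (ext_poly g k)) (c0 ?e)"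
    "nat_trans (Tot (ext_poly f k)) (Tot (ext_poly g k)) (c1 ?e)"
    using nat_trans_ext_cell[OF \<phi>] pk by (simp_all add: ext_poly_def)
  fix \<Gamma> assume \<Gamma>: "\<Gamma> \<in> Obj C"
  show "Map (ext_poly g k) \<Gamma> (c1 ?e \<Gamma> e) = c0 ?e \<Gamma> (Map (ext_poly f k) \<Gamma> e)"
    if "e \<in> El (Tot (ext_poly f k)) \<Gamma>" for e
    using that ext_cell_ext_map[OF \<phi> pk(3) \<Gamma>] by (simp add: ext_poly_def)
  fix e e' assume "e \<in> El (Base (ext_poly f k)) \<Gamma>" "e' \<in> El (Tot (ext_poly g k)) \<Gamma>"
    "Map (ext_poly g k) \<Gamma> e' = c0 ?e \<Gamma> e"
  then have e: "e \<in> El (ext f (Base k)) \<Gamma>" and e': "e' \<in> El (ext g (Tot k)) \<Gamma>"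
    and eq: "ext_map g (Tot k) (Map k) \<Gamma> e' = ext_cell \<phi> (Base k) \<Gamma> e" by (simp_all add: ext_poly_def)
  note a = ext_fst[OF e]
  have fst: "fst e' = c0 \<phi> \<Gamma> (fst e)"
    using eq ext_map_fst[OF \<Gamma> e'] ext_cell_fst[OF \<phi> \<Gamma> e] by metis
  let ?Z = "fibre f \<Gamma> (fst e)"
  \<comment> \<open>The candidate lift transports the function of \<open>e'\<close> back along the
    map of fibres that applies \<open>c1 \<phi>\<close>.\<close>
  define w where "w = (fst e, on ?Z (\<lambda>\<Delta> (\<sigma>, b). snd e' \<Delta> (\<sigma>, c1 \<phi> \<Delta> b)))"
  have w_eval: "snd w \<Delta> (\<sigma>, b) = snd e' \<Delta> (\<sigma>, c1 \<phi> \<Delta> b)" if "(\<sigma>, b) \<in> El ?Z \<Delta>" for \<Delta> \<sigma> b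
    using that fibre_Obj[OF that] by (simp add: w_def on_apply)
  have w: "w \<in> El (ext f (Tot k)) \<Gamma>"
    unfolding ext_iff w_def fst_conv snd_conv
  proof (intro conjI a nat_trans_fibreI[OF f \<Gamma> a])
    fix \<Delta> \<sigma> b assume z: "(\<sigma>, b) \<in> El ?Z \<Delta>"
    note z' = fibre_push[OF \<phi> a z, folded fst]
    show "(case (\<sigma>, b) of (\<sigma>, b) \<Rightarrow> snd e' \<Delta> (\<sigma>, c1 \<phi> \<Delta> b)) \<in> El (Tot k) \<Delta>"
      using ext_eval[OF e' z'] by simp
    fix \<Xi> \<tau> assume t: "\<tau> \<in> Hom C \<Xi> \<Delta>"
    have "c1 \<phi> \<Xi> (Res (Tot f) \<tau> b) = Res (Tot g) \<tau> (c1 \<phi> \<Delta> b)"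
      using z ccell_natural(2)[OF \<phi> t] by (simp add: fibre_iff)
    then show "(case (Comp C \<sigma> \<tau>, Res (Tot f) \<tau> b) of (\<sigma>, b) \<Rightarrow> snd e' \<Xi> (\<sigma>, c1 \<phi> \<Xi> b)) =
        Res (Tot k) \<tau> (case (\<sigma>, b) of (\<sigma>, b) \<Rightarrow> snd e' \<Delta> (\<sigma>, c1 \<phi> \<Delta> b))"
      using ext_eval_Res[OF e' z' t] by simp
  qed
  have fw: "fst w = fst e" by (simp add: w_def)
  have w1: "ext_map f (Tot k) (Map k) \<Gamma> w = e"
  proof (rule ext_eqI[OF ext_map_in[OF f pk(3) \<Gamma> w] e])
    show "fst (ext_map f (Tot k) (Map k) \<Gamma> w) = fst e" using ext_map_fst[OF \<Gamma> w] fw by simp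
    fix \<Delta> \<sigma> b assume "(\<sigma>, b) \<in> El (fibre f \<Gamma> (fst (ext_map f (Tot k) (Map k) \<Gamma> w))) \<Delta>"
    then have z: "(\<sigma>, b) \<in> El ?Z \<Delta>" using ext_map_fst[OF \<Gamma> w, of "Map k"] fw by simp
    then have "snd (ext_map f (Tot k) (Map k) \<Gamma> w) \<Delta> (\<sigma>, b) = Map k \<Delta> (snd e' \<Delta> (\<sigma>, c1 \<phi> \<Delta> b))"
      using ext_map_eval[OF \<Gamma> w, of "(\<sigma>, b)" \<Delta> "Map k"] w_eval fw by simp
    also have "\<dots> = snd (ext_map g (Tot k) (Map k) \<Gamma> e') \<Delta> (\<sigma>, c1 \<phi> \<Delta> b)"
      using ext_map_eval[OF \<Gamma> e' fibre_push[OF \<phi> a z, folded fst], of "Map k"] by simp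
    also have "\<dots> = snd e \<Delta> (\<sigma>, b)" using ext_cell_eval[OF \<phi> \<Gamma> e z] eq by simp
    finally show "snd (ext_map f (Tot k) (Map k) \<Gamma> w) \<Delta> (\<sigma>, b) = snd e \<Delta> (\<sigma>, b)" .
  qed
  have w2: "ext_cell \<phi> (Tot k) \<Gamma> w = e'"
    by (rule ext_cell_eqI[OF \<phi> a ext_cell_in[OF \<phi> \<Gamma> w] e'])
       (use fst fw w \<Gamma> in \<open>simp_all add: ext_cell_fst[OF \<phi>] ext_cell_eval[OF \<phi>] w_eval\<close>)
  have "\<exists>!w. w \<in> El (ext f (Tot k)) \<Gamma> \<and> ext_map f (Tot k) (Map k) \<Gamma> w = e \<and>
      ext_cell \<phi> (Tot k) \<Gamma> w = e'"
  proof (rule ex1I[of _ w])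
    show "w \<in> El (ext f (Tot k)) \<Gamma> \<and> ext_map f (Tot k) (Map k) \<Gamma> w = e \<and> ext_cell \<phi> (Tot k) \<Gamma> w = e'"
      using w w1 w2 by blast
  next
    fix v assume v: "v \<in> El (ext f (Tot k)) \<Gamma> \<and> ext_map f (Tot k) (Map k) \<Gamma> v = e \<and>
      ext_cell \<phi> (Tot k) \<Gamma> v = e'"
    then have fv: "fst v = fst e" using ext_map_fst[OF \<Gamma>] by metis
    show "v = w"
    proof (rule ext_eqI[OF _ w])
      show "v \<in> El (ext f (Tot k)) \<Gamma>" "fst v = fst w" using v fv fw by auto
      fix \<Delta> \<sigma> b assume z: "(\<sigma>, b) \<in> El (fibre f \<Gamma> (fst v)) \<Delta>"
      have "snd v \<Delta> (\<sigma>, b) = snd e' \<Delta> (\<sigma>, c1 \<phi> \<Delta> b)" using ext_cell_eval[OF \<phi> \<Gamma> _ z] v by metis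
      then show "snd v \<Delta> (\<sigma>, b) = snd w \<Delta> (\<sigma>, b)" using w_eval z fv by simp
    qed
  qed
  then show "\<exists>!w. w \<in> El (Tot (ext_poly f k)) \<Gamma> \<and> Map (ext_poly f k) \<Gamma> w = e \<and> c1 ?e \<Gamma> w = e'"
    by (simp add: ext_poly_def)
qed simp_all

section \<open>Composition of polynomials\<close>

lemma pcomp_simps: "Base (g \<cdot> f) = ext g (Base f)"
    "Res (Tot (g \<cdot> f)) \<sigma> (e, d, b) = (Res (ext g (Base f)) \<sigma> e, Res (Tot g) \<sigma> d, Res (Tot f) \<sigma> b)"
  by (simp_all add: pcomp_def Let_def)

lemma pcomp_iff: "(e, d, b) \<in> El (Tot (g \<cdot> f)) \<Gamma> \<longleftrightarrow>
    e \<in> El (ext g (Base f)) \<Gamma> \<and> d \<in> El (Tot g) \<Gamma> \<and> Map g \<Gamma> d = fst e \<and>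
    b \<in> El (Tot f) \<Gamma> \<and> Map f \<Gamma> b = snd e \<Gamma> (Ident C \<Gamma>, d)"
  by (cases e) (simp add: pcomp_def Let_def)

lemma pcomp_Map: "\<Gamma> \<in> Obj C \<Longrightarrow> (e, d, b) \<in> El (Tot (g \<cdot> f)) \<Gamma> \<Longrightarrow> Map (g \<cdot> f) \<Gamma> (e, d, b) = e"
  by (simp add: pcomp_def Let_def on_apply)

text \<open>Links the two conventions of evaluation: a value at an arrow \<open>\<rho>\<close> is
  the value at the identity after restriction along \<open>\<rho>\<close>.\<close>

lemma ext_Res_Ident:
  assumes "polynomial g" "\<rho> \<in> Hom C \<Delta> \<Gamma>" "e \<in> El (ext g X) \<Gamma>" "(\<rho>, d) \<in> El (fibre g \<Gamma> (fst e)) \<Delta>"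
  shows "snd (Res (ext g X) \<rho> e) \<Delta> (Ident C \<Delta>, d) = snd e \<Delta> (\<rho>, d)"
proof -
  have "(Ident C \<Delta>, d) \<in> El (fibre g \<Delta> (Res (Base g) \<rho> (fst e))) \<Delta>"
    using assms fibre_Res_iff[OF assms(1) ext_fst[OF assms(3)] assms(2) Ident_in] Hom_Obj[OF assms(2)]
    by (simp add: Comp_Ident)
  then show ?thesis using ext_Res_eval[OF assms(1-3)] Comp_Ident[OF assms(2)] by simp
qed

text \<open>An element of the composite total space records its base element as first component,
  which is here the restriction of \<open>e\<close>. A point of the fibre thus amounts to a fibre
  point \<open>d\<close> of \<open>g\<close> and an element \<open>b\<close> over the value of
  \<open>e\<close> there.\<close>

lemma pcomp_fibre_iff:
  assumes g: "polynomial g" and e: "e \<in> El (ext g (Base f)) \<Gamma>" and X: "presheaf (Base f)"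
  shows "(\<sigma>, (e', d, b)) \<in> El (fibre (g \<cdot> f) \<Gamma> e) \<Delta> \<longleftrightarrow>
    (\<sigma>, d) \<in> El (fibre g \<Gamma> (fst e)) \<Delta> \<and> e' = Res (ext g (Base f)) \<sigma> e \<and>
    b \<in> El (Tot f) \<Delta> \<and> Map f \<Delta> b = snd e \<Delta> (\<sigma>, d)"
proof (cases "\<sigma> \<in> Hom C \<Delta> \<Gamma>")
  case True
  note o = Hom_Obj[OF True]
  have se: "Res (ext g (Base f)) \<sigma> e \<in> El (ext g (Base f)) \<Delta>"
    using presheaf_ResD[OF presheaf_ext[OF g X] True e] .
  have "(\<sigma>, (e', d, b)) \<in> El (fibre (g \<cdot> f) \<Gamma> e) \<Delta> \<longleftrightarrow>
      (e', d, b) \<in> El (Tot (g \<cdot> f)) \<Delta> \<and> e' = Res (ext g (Base f)) \<sigma> e"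
    using True o pcomp_Map[of \<Delta> e' d b g f] by (auto simp: fibre_iff pcomp_simps)
  also have "\<dots> \<longleftrightarrow> (\<sigma>, d) \<in> El (fibre g \<Gamma> (fst e)) \<Delta> \<and> e' = Res (ext g (Base f)) \<sigma> e \<and>
      b \<in> El (Tot f) \<Delta> \<and> Map f \<Delta> b = snd e \<Delta> (\<sigma>, d)"
    using True se ext_Res_Ident[OF g True e, of d]
    by (auto simp: pcomp_iff fibre_iff ext_Res_fst)
  finally show ?thesis .
qed (simp add: fibre_iff)

text \<open>The substance is that restriction preserves the condition that \<open>b\<close> lies
  over \<open>m(d)\<close>.\<close>

lemma polynomial_pcomp:
  assumes g: "polynomial g" and f: "polynomial f"
  shows "polynomial (g \<cdot> f)"
proof -
  note pg = polynomialD[OF g] and pf = polynomialD[OF f] and E = presheaf_ext[OF g polynomialD(2)[OF f]]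
  have T: "presheaf (Tot (g \<cdot> f))"
    unfolding presheaf_def
  proof (intro conjI allI ballI)
    fix \<Delta> \<Gamma> \<sigma> x assume s: "\<sigma> \<in> Hom C \<Delta> \<Gamma>" and x: "x \<in> El (Tot (g \<cdot> f)) \<Gamma>"
    obtain e d b where xx: "x = (e, d, b)" by (cases x)
    note o = Hom_Obj[OF s]
    have x': "e \<in> El (ext g (Base f)) \<Gamma>" "d \<in> El (Tot g) \<Gamma>" "Map g \<Gamma> d = fst e" "b \<in> El (Tot f) \<Gamma>"
      "Map f \<Gamma> b = snd e \<Gamma> (Ident C \<Gamma>, d)" using x by (auto simp: xx pcomp_iff)
    have i: "(Ident C \<Gamma>, d) \<in> El (fibre g \<Gamma> (fst e)) \<Gamma>" using fibre_Ident[OF g _ x'(2)] o x'(3) by simp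
    have z: "(\<sigma>, Res (Tot g) \<sigma> d) \<in> El (fibre g \<Gamma> (fst e)) \<Delta>"
      using fibre_Res_in[OF g ext_fst[OF x'(1)] i s] Ident_Comp[OF s] by simp
    \<comment> \<open>The value of the restricted function at the identity is first read off at
      \<open>\<sigma>\<close> and then, by naturality, recognised as the restriction of
      \<open>m(d)\<close>.\<close>
    have "snd (Res (ext g (Base f)) \<sigma> e) \<Delta> (Ident C \<Delta>, Res (Tot g) \<sigma> d) = snd e \<Delta> (\<sigma>, Res (Tot g) \<sigma> d)"
      by (rule ext_Res_Ident[OF g s x'(1) z])
    also have "\<dots> = Res (Base f) \<sigma> (snd e \<Gamma> (Ident C \<Gamma>, d))"
      using ext_eval_Res[OF x'(1) i s] Ident_Comp[OF s] by simp
    finally show "Res (Tot (g \<cdot> f)) \<sigma> x \<in> El (Tot (g \<cdot> f)) \<Delta>"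
      using x' polynomial_in[OF f s] polynomial_in[OF g s] presheaf_ResD[OF E s]
      by (simp add: xx pcomp_simps pcomp_iff ext_Res_fst)
  next
    fix \<Gamma> x assume "\<Gamma> \<in> Obj C" "x \<in> El (Tot (g \<cdot> f)) \<Gamma>"
    then show "Res (Tot (g \<cdot> f)) (Ident C \<Gamma>) x = x"
      using pg pf E by (cases x) (auto simp: pcomp_simps pcomp_iff presheaf_IdentD)
  next
    fix \<Xi> \<Delta> \<Gamma> \<sigma> \<tau> x assume "\<sigma> \<in> Hom C \<Delta> \<Gamma>" "\<tau> \<in> Hom C \<Xi> \<Delta>" "x \<in> El (Tot (g \<cdot> f)) \<Gamma>"
    then show "Res (Tot (g \<cdot> f)) (Comp C \<sigma> \<tau>) x = Res (Tot (g \<cdot> f)) \<tau> (Res (Tot (g \<cdot> f)) \<sigma> x)"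
      using pg pf E by (cases x) (auto simp: pcomp_simps pcomp_iff presheaf_CompD)
  qed
  have "Map (g \<cdot> f) = on (Tot (g \<cdot> f)) (\<lambda>\<Gamma>. fst)" by (simp add: pcomp_def Let_def)
  moreover have "nat_trans (Tot (g \<cdot> f)) (Base (g \<cdot> f)) (on (Tot (g \<cdot> f)) (\<lambda>\<Gamma>. fst))"
    by (rule nat_trans_onI[OF T]) (auto simp: pcomp_simps pcomp_iff)
  ultimately show ?thesis using T E by (simp add: polynomial_def pcomp_simps)
qed

section \<open>Unit and composition isomorphisms of extensions\<close>

text \<open>Bijectivity of \<open>c1\<close> provides a unique preimage \<open>b\<close> of
  \<open>d\<close>; since the square commutes, injectivity of \<open>c0\<close> forces
  \<open>b\<close> to lie over \<open>a\<close>.\<close>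

lemma ccell_isoI:
  assumes "Dm \<phi> = f" "Cd \<phi> = g" "polynomial f" "polynomial g"
    and "nat_trans (Base f) (Base g) (c0 \<phi>)" "nat_trans (Tot f) (Tot g) (c1 \<phi>)"
    and comm: "\<And>\<Gamma> b. \<Gamma> \<in> Obj C \<Longrightarrow> b \<in> El (Tot f) \<Gamma> \<Longrightarrow> Map g \<Gamma> (c1 \<phi> \<Gamma> b) = c0 \<phi> \<Gamma> (Map f \<Gamma> b)"
    and inj0: "\<And>\<Gamma>. \<Gamma> \<in> Obj C \<Longrightarrow> inj_on (c0 \<phi> \<Gamma>) (El (Base f) \<Gamma>)"
    and bij1: "\<And>\<Gamma>. \<Gamma> \<in> Obj C \<Longrightarrow> bij_betw (c1 \<phi> \<Gamma>) (El (Tot f) \<Gamma>) (El (Tot g) \<Gamma>)"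
  shows "ccell f g \<phi>"
proof (rule ccellI[OF assms(1-6)])
  show "Map g \<Gamma> (c1 \<phi> \<Gamma> b) = c0 \<phi> \<Gamma> (Map f \<Gamma> b)" if "\<Gamma> \<in> Obj C" "b \<in> El (Tot f) \<Gamma>" for \<Gamma> b
    using comm that by blast
  fix \<Gamma> a d assume g: "\<Gamma> \<in> Obj C" and a: "a \<in> El (Base f) \<Gamma>" and d: "d \<in> El (Tot g) \<Gamma>"
    and ad: "Map g \<Gamma> d = c0 \<phi> \<Gamma> a"
  obtain b where b: "b \<in> El (Tot f) \<Gamma>" "c1 \<phi> \<Gamma> b = d"
    using bij_betw_imp_surj_on[OF bij1[OF g]] d by (metis imageE)
  have "Map f \<Gamma> b \<in> El (Base f) \<Gamma>" using nat_trans_in[OF polynomialD(3)[OF assms(3)] g b(1)] .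
  then have "Map f \<Gamma> b = a" using a comm[OF g b(1)] b(2) ad by (intro inj_onD[OF inj0[OF g]]) simp_all
  moreover have "b' = b" if "b' \<in> El (Tot f) \<Gamma>" "c1 \<phi> \<Gamma> b' = d" for b'
    using that b by (intro inj_onD[OF bij_betw_imp_inj_on[OF bij1[OF g]]]) simp_all
  ultimately show "\<exists>!b. b \<in> El (Tot f) \<Gamma> \<and> Map f \<Gamma> b = a \<and> c1 \<phi> \<Gamma> b = d" using b by blast
qed

lemma presheaf_one: "presheaf one"
  by (simp add: presheaf_def one_def)

lemma polynomial_pid: "polynomial pid"
  by (simp add: polynomial_def pid_def presheaf_one nat_trans_nid)

text \<open>The fibre of the identity polynomial is the representable of \<open>\<Gamma>\<close>
  paired with the one-element type, so that \<open>ext pid X\<close> is \<open>X\<close> by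
  Yoneda.\<close>

lemma fibre_pid: "(\<sigma>, u) \<in> El (fibre pid \<Gamma> a) \<Delta> \<longleftrightarrow> \<sigma> \<in> Hom C \<Delta> \<Gamma>"
  by (simp add: fibre_iff pid_def one_def)

lemma ext_unit_iso_eval:
  "\<Gamma> \<in> Obj C \<Longrightarrow> x \<in> El X \<Gamma> \<Longrightarrow> \<sigma> \<in> Hom C \<Delta> \<Gamma> \<Longrightarrow> snd (ext_unit_iso X \<Gamma> x) \<Delta> (\<sigma>, u) = Res X \<sigma> x"
  using Hom_Obj[of \<sigma> \<Delta> \<Gamma>] by (simp add: ext_unit_iso_def on_apply fibre_pid)

lemma ext_unit_iso_in:
  assumes X: "presheaf X" and \<Gamma>: "\<Gamma> \<in> Obj C" and x: "x \<in> El X \<Gamma>"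
  shows "ext_unit_iso X \<Gamma> x \<in> El (ext pid X) \<Gamma>"
proof -
  have u: "() \<in> El (Base pid) \<Gamma>" by (simp add: pid_def one_def)
  have "nat_trans (fibre pid \<Gamma> ()) X (on (fibre pid \<Gamma> ()) (\<lambda>\<Delta> (\<sigma>, _). Res X \<sigma> x))"
    by (rule nat_trans_fibreI[OF polynomial_pid \<Gamma> u])
       (use x in \<open>auto simp: fibre_pid presheaf_ResD[OF X] presheaf_CompD[OF X]\<close>)
  then show ?thesis using \<Gamma> x u by (simp add: ext_unit_iso_def on_apply ext_iff)
qed

lemma nat_trans_ext_unit_iso:
  assumes X: "presheaf X"
  shows "nat_trans X (ext pid X) (ext_unit_iso X)"
proof -
  have "nat_trans X (ext pid X) (on X (ext_unit_iso X))"
  proof (rule nat_trans_onI[OF X])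
    fix \<Gamma> x assume "\<Gamma> \<in> Obj C" "x \<in> El X \<Gamma>"
    then show "ext_unit_iso X \<Gamma> x \<in> El (ext pid X) \<Gamma>" by (rule ext_unit_iso_in[OF X])
  next
    fix \<Delta> \<Gamma> \<sigma> x assume s: "\<sigma> \<in> Hom C \<Delta> \<Gamma>" and x: "x \<in> El X \<Gamma>"
    note o = Hom_Obj[OF s] and sx = presheaf_ResD[OF X s x]
    have ex: "ext_unit_iso X \<Gamma> x \<in> El (ext pid X) \<Gamma>" using ext_unit_iso_in[OF X] o x by blast
    show "ext_unit_iso X \<Delta> (Res X \<sigma> x) = Res (ext pid X) \<sigma> (ext_unit_iso X \<Gamma> x)"
    proof (rule ext_eqI[OF ext_unit_iso_in[OF X o[THEN conjunct1] sx]
          presheaf_ResD[OF presheaf_ext[OF polynomial_pid X] s ex]])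
      fix \<Xi> \<tau> u assume "(\<tau>, u) \<in> El (fibre pid \<Delta> (fst (ext_unit_iso X \<Delta> (Res X \<sigma> x)))) \<Xi>"
      then have t: "\<tau> \<in> Hom C \<Xi> \<Delta>" by (simp add: fibre_pid)
      have "snd (Res (ext pid X) \<sigma> (ext_unit_iso X \<Gamma> x)) \<Xi> (\<tau>, u) = snd (ext_unit_iso X \<Gamma> x) \<Xi> (Comp C \<sigma> \<tau>, u)"
        using t by (intro ext_Res_eval[OF polynomial_pid s ex]) (simp add: fibre_pid)
      then show "snd (ext_unit_iso X \<Delta> (Res X \<sigma> x)) \<Xi> (\<tau>, u) =
          snd (Res (ext pid X) \<sigma> (ext_unit_iso X \<Gamma> x)) \<Xi> (\<tau>, u)"
        using o x sx t Comp_in[OF s t] by (simp add: ext_unit_iso_eval presheaf_CompD[OF X s t])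
    qed simp
  qed
  moreover have "on X (ext_unit_iso X) = ext_unit_iso X"
    by (auto simp: ext_unit_iso_def on_def fun_eq_iff)
  ultimately show ?thesis by simp
qed

text \<open>Yoneda: a map out of the fibre of \<open>pid\<close> is determined by its value at the
  identity arrow, and naturality recovers all other values from it.\<close>

lemma ext_unit_iso_inverse:
  assumes X: "presheaf X" and \<Gamma>: "\<Gamma> \<in> Obj C"
  shows "x \<in> El X \<Gamma> \<Longrightarrow> snd (ext_unit_iso X \<Gamma> x) \<Gamma> (Ident C \<Gamma>, ()) = x"
    and "e \<in> El (ext pid X) \<Gamma> \<Longrightarrow> snd e \<Gamma> (Ident C \<Gamma>, ()) \<in> El X \<Gamma>"
    and "e \<in> El (ext pid X) \<Gamma> \<Longrightarrow> ext_unit_iso X \<Gamma> (snd e \<Gamma> (Ident C \<Gamma>, ())) = e"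
proof -
  note I = Ident_in[OF \<Gamma>]
  show "x \<in> El X \<Gamma> \<Longrightarrow> snd (ext_unit_iso X \<Gamma> x) \<Gamma> (Ident C \<Gamma>, ()) = x"
    using \<Gamma> I by (simp add: ext_unit_iso_eval presheaf_IdentD[OF X])
  assume e: "e \<in> El (ext pid X) \<Gamma>"
  have i: "(Ident C \<Gamma>, ()) \<in> El (fibre pid \<Gamma> (fst e)) \<Gamma>" using I by (simp add: fibre_pid)
  show ie: "snd e \<Gamma> (Ident C \<Gamma>, ()) \<in> El X \<Gamma>" by (rule ext_eval[OF e i])
  show "ext_unit_iso X \<Gamma> (snd e \<Gamma> (Ident C \<Gamma>, ())) = e"
  proof (rule ext_eqI[OF ext_unit_iso_in[OF X \<Gamma> ie] e])
    fix \<Delta> \<sigma> u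
    assume "(\<sigma>, u) \<in> El (fibre pid \<Gamma> (fst (ext_unit_iso X \<Gamma> (snd e \<Gamma> (Ident C \<Gamma>, ()))))) \<Delta>"
    then have s: "\<sigma> \<in> Hom C \<Delta> \<Gamma>" by (simp add: fibre_pid)
    show "snd (ext_unit_iso X \<Gamma> (snd e \<Gamma> (Ident C \<Gamma>, ()))) \<Delta> (\<sigma>, u) = snd e \<Delta> (\<sigma>, u)"
      using ext_eval_Res[OF e i s] Ident_Comp[OF s] by (simp add: ext_unit_iso_eval[OF \<Gamma> ie s])
  qed simp
qed

lemma bij_ext_unit_iso:
  assumes "presheaf X" "\<Gamma> \<in> Obj C"
  shows "bij_betw (ext_unit_iso X \<Gamma>) (El X \<Gamma>) (El (ext pid X) \<Gamma>)"
proof (rule bij_betw_byWitness[where f' = "\<lambda>e. snd e \<Gamma> (Ident C \<Gamma>, ())"])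
  show "(\<lambda>e. snd e \<Gamma> (Ident C \<Gamma>, ())) ` El (ext pid X) \<Gamma> \<subseteq> El X \<Gamma>"
    using ext_unit_iso_inverse(2)[OF assms] by blast
qed (use ext_unit_iso_inverse[OF assms] ext_unit_iso_in[OF assms] in auto)

lemma ext_unit_iso_natural:
  assumes X: "presheaf X" and Y: "presheaf Y" and h: "nat_trans X Y h"
    and \<Gamma>: "\<Gamma> \<in> Obj C" and x: "x \<in> El X \<Gamma>"
  shows "ext_map pid X h \<Gamma> (ext_unit_iso X \<Gamma> x) = ext_unit_iso Y \<Gamma> (h \<Gamma> x)"
proof (rule ext_eqI)
  note ex = ext_unit_iso_in[OF X \<Gamma> x] and hx = nat_trans_in[OF h \<Gamma> x]
  show "ext_map pid X h \<Gamma> (ext_unit_iso X \<Gamma> x) \<in> El (ext pid Y) \<Gamma>"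
    by (rule ext_map_in[OF polynomial_pid h \<Gamma> ex])
  show "ext_unit_iso Y \<Gamma> (h \<Gamma> x) \<in> El (ext pid Y) \<Gamma>" by (rule ext_unit_iso_in[OF Y \<Gamma> hx])
  fix \<Delta> \<sigma> u assume "(\<sigma>, u) \<in> El (fibre pid \<Gamma> (fst (ext_map pid X h \<Gamma> (ext_unit_iso X \<Gamma> x)))) \<Delta>"
  then have s: "\<sigma> \<in> Hom C \<Delta> \<Gamma>" by (simp add: fibre_pid)
  then show "snd (ext_map pid X h \<Gamma> (ext_unit_iso X \<Gamma> x)) \<Delta> (\<sigma>, u) =
      snd (ext_unit_iso Y \<Gamma> (h \<Gamma> x)) \<Delta> (\<sigma>, u)"
    using ext_map_eval[OF \<Gamma> ex, of "(\<sigma>, u)" \<Delta> h] \<Gamma> x hx nat_trans_natural[OF h s x]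
    by (simp add: fibre_pid ext_unit_iso_eval)
qed simp

text \<open>The square factors through \<open>ext_poly pid f\<close> as a square that is bijective
  on elements, followed by a naturality square of P_\<eta>; both are pullbacks.\<close>

lemma ccell_lift_unit:
  assumes \<eta>: "ccell pid p \<eta>" and f: "polynomial f"
  shows "ccell f (ext_poly p f) (lift_unit \<eta> f)"
proof -
  note pf = polynomialD[OF f]
  let ?i = "\<lparr>Dm = f, Cd = ext_poly pid f, c0 = ext_unit_iso (Base f), c1 = ext_unit_iso (Tot f)\<rparr>"
  have "ccell f (ext_poly pid f) ?i"
  proof (rule ccell_isoI)
    show "polynomial (ext_poly pid f)" by (rule polynomial_ext_poly[OF polynomial_pid f])
    show "nat_trans (Base f) (Base (ext_poly pid f)) (c0 ?i)"
      "nat_trans (Tot f) (Tot (ext_poly pid f)) (c1 ?i)"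
      by (simp_all add: ext_poly_def nat_trans_ext_unit_iso pf)
    fix \<Gamma> assume \<Gamma>: "\<Gamma> \<in> Obj C"
    show "inj_on (c0 ?i \<Gamma>) (El (Base f) \<Gamma>)"
      using bij_betw_imp_inj_on[OF bij_ext_unit_iso[OF pf(2) \<Gamma>]] by simp
    show "bij_betw (c1 ?i \<Gamma>) (El (Tot f) \<Gamma>) (El (Tot (ext_poly pid f)) \<Gamma>)"
      using bij_ext_unit_iso[OF pf(1) \<Gamma>] by (simp add: ext_poly_def)
    fix b assume "b \<in> El (Tot f) \<Gamma>"
    then show "Map (ext_poly pid f) \<Gamma> (c1 ?i \<Gamma> b) = c0 ?i \<Gamma> (Map f \<Gamma> b)"
      using ext_unit_iso_natural[OF pf(1,2,3) \<Gamma>] by (simp add: ext_poly_def)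
  qed (simp_all add: f)
  from ccell_ccomp[OF ccell_ext_cell[OF \<eta> f] this]
  show ?thesis using ccellD[OF \<eta>] by (simp add: ccomp_def lift_unit_def)
qed

text \<open>The projection to the base, cut down by \<open>on\<close> to a morphism of presheaves.
  It expresses the base of the composition isomorphism through \<open>ext_map\<close>.\<close>

lemma nat_trans_ext_fst:
  assumes "polynomial f" "presheaf X"
  shows "nat_trans (ext f X) (Base f) (on (ext f X) (\<lambda>_. fst))"
  by (rule nat_trans_onI[OF presheaf_ext[OF assms]]) (auto simp: ext_fst ext_Res_fst)

section \<open>The composition isomorphism as currying over composite fibres\<close>

context
  fixes g :: "('o, 'm, 'd, 'c) polynomial" and f :: "('o, 'm, 'b, 'a) polynomial"
    and X :: "('o, 'm, 'x) presheaf"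
  assumes g: "polynomial g" and f: "polynomial f" and X: "presheaf X"
begin

text \<open>The base component is P_g applied to the projection from P_f(X) to the base of
  \<open>f\<close>, which reduces its membership and its naturality to those of
  \<open>ext_map\<close>.\<close>

lemma ext_comp_base:
  assumes \<Gamma>: "\<Gamma> \<in> Obj C" and e: "e \<in> El (ext g (ext f X)) \<Gamma>"
  shows "fst (ext_comp_iso g f X \<Gamma> e) = ext_map g (ext f X) (on (ext f X) (\<lambda>_. fst)) \<Gamma> e"
    and "fst (ext_comp_iso g f X \<Gamma> e) \<in> El (ext g (Base f)) \<Gamma>"
    and "fst (fst (ext_comp_iso g f X \<Gamma> e)) = fst e"
    and "z \<in> El (fibre g \<Gamma> (fst e)) \<Delta> \<Longrightarrow> snd (fst (ext_comp_iso g f X \<Gamma> e)) \<Delta> z = fst (snd e \<Delta> z)"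
proof -
  have "fst (ext_comp_iso g f X \<Gamma> e) = ext_map g (ext f X) (\<lambda>_. fst) \<Gamma> e"
    using \<Gamma> e by (cases e) (simp add: ext_comp_iso_def on_apply Let_def ext_map_def ncomp_def)
  also have "\<dots> = ext_map g (ext f X) (on (ext f X) (\<lambda>_. fst)) \<Gamma> e"
    by (rule ext_map_cong[OF \<Gamma> e]) (simp add: on_apply)
  finally show 1: "fst (ext_comp_iso g f X \<Gamma> e) = ext_map g (ext f X) (on (ext f X) (\<lambda>_. fst)) \<Gamma> e" .
  show "fst (ext_comp_iso g f X \<Gamma> e) \<in> El (ext g (Base f)) \<Gamma>"
    unfolding 1 by (rule ext_map_in[OF g nat_trans_ext_fst[OF f X] \<Gamma> e])
  show "fst (fst (ext_comp_iso g f X \<Gamma> e)) = fst e" unfolding 1 by (rule ext_map_fst[OF \<Gamma> e])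
  show "snd (fst (ext_comp_iso g f X \<Gamma> e)) \<Delta> z = fst (snd e \<Delta> z)" if "z \<in> El (fibre g \<Gamma> (fst e)) \<Delta>"
    unfolding 1 using ext_map_eval[OF \<Gamma> e that, of "on (ext f X) (\<lambda>_. fst)"] ext_eval[OF e that] fibre_Obj[OF that]
    by (simp add: on_apply)
qed

lemma ext_comp_base_Res:
  assumes r: "\<rho> \<in> Hom C \<Delta> \<Gamma>" and e: "e \<in> El (ext g (ext f X)) \<Gamma>"
  shows "fst (ext_comp_iso g f X \<Delta> (Res (ext g (ext f X)) \<rho> e)) =
    Res (ext g (Base f)) \<rho> (fst (ext_comp_iso g f X \<Gamma> e))"
proof -
  have E: "presheaf (ext f X)" by (rule presheaf_ext[OF f X])
  have "Res (ext g (ext f X)) \<rho> e \<in> El (ext g (ext f X)) \<Delta>"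
    using presheaf_ResD[OF presheaf_ext[OF g E] r e] .
  then show ?thesis
    using ext_comp_base(1) Hom_Obj[OF r] e
      nat_trans_natural[OF nat_trans_ext_map[OF g E polynomialD(2)[OF f] nat_trans_ext_fst[OF f X]] r e]
    by simp
qed

text \<open>A point of the composite fibre is a point \<open>(\<sigma>, d)\<close> of the outer
  fibre together with a point of the inner fibre at the same stage, whose arrow is therefore an
  identity. If \<open>(\<sigma>, d)\<close> is not in the outer fibre, both sides are false.\<close>

lemma ext_comp_fibre_iff:
  assumes \<Gamma>: "\<Gamma> \<in> Obj C" and e: "e \<in> El (ext g (ext f X)) \<Gamma>"
  shows "(\<sigma>, (e', d, b)) \<in> El (fibre (g \<cdot> f) \<Gamma> (fst (ext_comp_iso g f X \<Gamma> e))) \<Delta> \<longleftrightarrow>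
    (\<sigma>, d) \<in> El (fibre g \<Gamma> (fst e)) \<Delta> \<and>
    e' = Res (ext g (Base f)) \<sigma> (fst (ext_comp_iso g f X \<Gamma> e)) \<and>
    (Ident C \<Delta>, b) \<in> El (fibre f \<Delta> (fst (snd e \<Delta> (\<sigma>, d)))) \<Delta>"
proof (cases "(\<sigma>, d) \<in> El (fibre g \<Gamma> (fst e)) \<Delta>")
  case True
  have "fst (snd e \<Delta> (\<sigma>, d)) \<in> El (Base f) \<Delta>" using ext_fst[OF ext_eval[OF e True]] .
  then have "Res (Base f) (Ident C \<Delta>) (fst (snd e \<Delta> (\<sigma>, d))) = fst (snd e \<Delta> (\<sigma>, d))"
    using presheaf_IdentD[OF polynomialD(2)[OF f] fibre_Obj[OF True]] by blast
  then show ?thesis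
    using pcomp_fibre_iff[OF g ext_comp_base(2)[OF \<Gamma> e] polynomialD(2)[OF f]] True
      ext_comp_base(3)[OF \<Gamma> e] ext_comp_base(4)[OF \<Gamma> e True] Ident_in[OF fibre_Obj[OF True]]
    by (auto simp: fibre_iff[of _ b])
next
  case False
  then show ?thesis
    using pcomp_fibre_iff[OF g ext_comp_base(2)[OF \<Gamma> e] polynomialD(2)[OF f]] ext_comp_base(3)[OF \<Gamma> e]
    by simp
qed

lemma ext_comp_eval:
  assumes \<Gamma>: "\<Gamma> \<in> Obj C" and e: "e \<in> El (ext g (ext f X)) \<Gamma>"
    and z: "(\<sigma>, (e', d, b)) \<in> El (fibre (g \<cdot> f) \<Gamma> (fst (ext_comp_iso g f X \<Gamma> e))) \<Delta>"
  shows "snd (ext_comp_iso g f X \<Gamma> e) \<Delta> (\<sigma>, (e', d, b)) = snd (snd e \<Delta> (\<sigma>, d)) \<Delta> (Ident C \<Delta>, b)"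
  using \<Gamma> e z fibre_Obj[OF z] by (cases e) (simp add: ext_comp_iso_def on_apply Let_def)

text \<open>An inner evaluation at an arrow \<open>\<tau>\<close> is traded for one at the identity
  by restricting the outer point \<open>(\<sigma>, d)\<close> along \<open>\<tau>\<close>. This is
  why values at identities determine everything.\<close>

lemma ext_comp_fibre_Res:
  assumes e: "e \<in> El (ext g (ext f X)) \<Gamma>" and d: "(\<sigma>, d) \<in> El (fibre g \<Gamma> (fst e)) \<Delta>"
    and b: "(\<tau>, b) \<in> El (fibre f \<Delta> (fst (snd e \<Delta> (\<sigma>, d)))) \<Xi>"
  shows "(Comp C \<sigma> \<tau>, Res (Tot g) \<tau> d) \<in> El (fibre g \<Gamma> (fst e)) \<Xi>"
    and "snd e \<Xi> (Comp C \<sigma> \<tau>, Res (Tot g) \<tau> d) = Res (ext f X) \<tau> (snd e \<Delta> (\<sigma>, d))"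
    and "(Ident C \<Xi>, b) \<in> El (fibre f \<Xi> (fst (snd e \<Xi> (Comp C \<sigma> \<tau>, Res (Tot g) \<tau> d)))) \<Xi>"
    and "snd (snd e \<Xi> (Comp C \<sigma> \<tau>, Res (Tot g) \<tau> d)) \<Xi> (Ident C \<Xi>, b) = snd (snd e \<Delta> (\<sigma>, d)) \<Xi> (\<tau>, b)"
proof -
  have t: "\<tau> \<in> Hom C \<Xi> \<Delta>" using b by (simp add: fibre_iff)
  show "(Comp C \<sigma> \<tau>, Res (Tot g) \<tau> d) \<in> El (fibre g \<Gamma> (fst e)) \<Xi>"
    by (rule fibre_Res_in[OF g ext_fst[OF e] d t])
  show 2: "snd e \<Xi> (Comp C \<sigma> \<tau>, Res (Tot g) \<tau> d) = Res (ext f X) \<tau> (snd e \<Delta> (\<sigma>, d))"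
    by (rule ext_eval_Res[OF e d t])
  show "(Ident C \<Xi>, b) \<in> El (fibre f \<Xi> (fst (snd e \<Xi> (Comp C \<sigma> \<tau>, Res (Tot g) \<tau> d)))) \<Xi>"
    using fibre_Res_iff[OF f ext_fst[OF ext_eval[OF e d]] t Ident_in] b Hom_Obj[OF t] Comp_Ident[OF t]
    by (simp add: 2 ext_Res_fst)
  show "snd (snd e \<Xi> (Comp C \<sigma> \<tau>, Res (Tot g) \<tau> d)) \<Xi> (Ident C \<Xi>, b) = snd (snd e \<Delta> (\<sigma>, d)) \<Xi> (\<tau>, b)"
    unfolding 2 by (rule ext_Res_Ident[OF f t ext_eval[OF e d] b])
qed

text \<open>Every inner value of \<open>e\<close> is recovered from the image of \<open>e\<close>.
  This gives injectivity and dictates the formula for the inverse.\<close>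

lemma ext_comp_eval_Comp:
  assumes \<Gamma>: "\<Gamma> \<in> Obj C" and e: "e \<in> El (ext g (ext f X)) \<Gamma>"
    and d: "(\<sigma>, d) \<in> El (fibre g \<Gamma> (fst e)) \<Delta>"
    and b: "(\<tau>, b) \<in> El (fibre f \<Delta> (fst (snd e \<Delta> (\<sigma>, d)))) \<Xi>"
  shows "snd (snd e \<Delta> (\<sigma>, d)) \<Xi> (\<tau>, b) = snd (ext_comp_iso g f X \<Gamma> e) \<Xi>
    (Comp C \<sigma> \<tau>, (Res (ext g (Base f)) (Comp C \<sigma> \<tau>) (fst (ext_comp_iso g f X \<Gamma> e)), Res (Tot g) \<tau> d, b))"
  using ext_comp_eval[OF \<Gamma> e] ext_comp_fibre_iff[OF \<Gamma> e] ext_comp_fibre_Res[OF e d b] by simp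

lemma ext_comp_iso_in:
  assumes \<Gamma>: "\<Gamma> \<in> Obj C" and e: "e \<in> El (ext g (ext f X)) \<Gamma>"
  shows "ext_comp_iso g f X \<Gamma> e \<in> El (ext (g \<cdot> f) X) \<Gamma>"
proof -
  let ?B = "fst (ext_comp_iso g f X \<Gamma> e)"
  let ?t = "\<lambda>\<Delta> (\<sigma>, _, d, b). snd (snd e \<Delta> (\<sigma>, d)) \<Delta> (Ident C \<Delta>, b)"
  have B: "?B \<in> El (Base (g \<cdot> f)) \<Gamma>" using ext_comp_base(2)[OF \<Gamma> e] by (simp add: pcomp_simps)
  have "nat_trans (fibre (g \<cdot> f) \<Gamma> ?B) X (on (fibre (g \<cdot> f) \<Gamma> ?B) ?t)"
  proof (rule nat_trans_fibreI[OF polynomial_pcomp[OF g f] \<Gamma> B])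
    fix \<Delta> \<sigma> w assume z: "(\<sigma>, w) \<in> El (fibre (g \<cdot> f) \<Gamma> ?B) \<Delta>"
    obtain e' d b where w: "w = (e', d, b)" by (cases w)
    have d: "(\<sigma>, d) \<in> El (fibre g \<Gamma> (fst e)) \<Delta>"
      and b: "(Ident C \<Delta>, b) \<in> El (fibre f \<Delta> (fst (snd e \<Delta> (\<sigma>, d)))) \<Delta>"
      using z ext_comp_fibre_iff[OF \<Gamma> e] by (simp_all add: w)
    note ed = ext_eval[OF e d]
    show "?t \<Delta> (\<sigma>, w) \<in> El X \<Delta>" using ext_eval[OF ed b] by (simp add: w)
    fix \<Xi> \<tau> assume t: "\<tau> \<in> Hom C \<Xi> \<Delta>"
    have b': "(\<tau>, Res (Tot f) \<tau> b) \<in> El (fibre f \<Delta> (fst (snd e \<Delta> (\<sigma>, d)))) \<Xi>"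
      using fibre_Res_in[OF f ext_fst[OF ed] b t] Ident_Comp[OF t] by simp
    show "?t \<Xi> (Comp C \<sigma> \<tau>, Res (Tot (g \<cdot> f)) \<tau> w) = Res X \<tau> (?t \<Delta> (\<sigma>, w))"
      using ext_comp_fibre_Res(4)[OF e d b'] ext_eval_Res[OF ed b t] Ident_Comp[OF t]
      by (simp add: w pcomp_simps)
  qed
  moreover have "snd (ext_comp_iso g f X \<Gamma> e) = on (fibre (g \<cdot> f) \<Gamma> ?B) ?t"
    using \<Gamma> e by (cases e) (simp add: ext_comp_iso_def on_apply Let_def)
  ultimately show ?thesis using B by (simp add: ext_iff)
qed

lemma nat_trans_ext_comp_iso: "nat_trans (ext g (ext f X)) (ext (g \<cdot> f) X) (ext_comp_iso g f X)"
proof -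
  note gf = polynomial_pcomp[OF g f]
  have P: "presheaf (ext g (ext f X))" and Q: "presheaf (ext (g \<cdot> f) X)"
    by (simp_all add: presheaf_ext g f X gf)
  have "nat_trans (ext g (ext f X)) (ext (g \<cdot> f) X) (on (ext g (ext f X)) (ext_comp_iso g f X))"
  proof (rule nat_trans_onI[OF P])
    fix \<Gamma> e assume "\<Gamma> \<in> Obj C" "e \<in> El (ext g (ext f X)) \<Gamma>"
    then show "ext_comp_iso g f X \<Gamma> e \<in> El (ext (g \<cdot> f) X) \<Gamma>" by (rule ext_comp_iso_in)
  next
    fix \<Delta> \<Gamma> \<rho> e assume r: "\<rho> \<in> Hom C \<Delta> \<Gamma>" and e: "e \<in> El (ext g (ext f X)) \<Gamma>"
    have \<Delta>: "\<Delta> \<in> Obj C" and \<Gamma>: "\<Gamma> \<in> Obj C" using Hom_Obj[OF r] by auto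
    note re = presheaf_ResD[OF P r e] and ie = ext_comp_iso_in[OF \<Gamma> e]
    let ?R = "Res (ext g (ext f X)) \<rho> e"
    show "ext_comp_iso g f X \<Delta> ?R = Res (ext (g \<cdot> f) X) \<rho> (ext_comp_iso g f X \<Gamma> e)"
    proof (rule ext_eqI[OF ext_comp_iso_in[OF \<Delta> re] presheaf_ResD[OF Q r ie]])
      show fst: "fst (ext_comp_iso g f X \<Delta> ?R) = fst (Res (ext (g \<cdot> f) X) \<rho> (ext_comp_iso g f X \<Gamma> e))"
        using ext_comp_base_Res[OF r e] by (simp add: ext_Res_fst pcomp_simps)
      fix \<Xi> \<sigma> w assume z: "(\<sigma>, w) \<in> El (fibre (g \<cdot> f) \<Delta> (fst (ext_comp_iso g f X \<Delta> ?R))) \<Xi>"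
      then have s: "\<sigma> \<in> Hom C \<Xi> \<Delta>" by (simp add: fibre_iff)
      obtain e' d b where w: "w = (e', d, b)" by (cases w)
      have z1: "(\<sigma>, w) \<in> El (fibre (g \<cdot> f) \<Delta> (Res (Base (g \<cdot> f)) \<rho> (fst (ext_comp_iso g f X \<Gamma> e)))) \<Xi>"
        using z fst by (simp add: ext_Res_fst)
      then have z2: "(Comp C \<rho> \<sigma>, w) \<in> El (fibre (g \<cdot> f) \<Gamma> (fst (ext_comp_iso g f X \<Gamma> e))) \<Xi>"
        using fibre_Res_iff[OF gf ext_fst[OF ie] r s] by simp
      have d: "(\<sigma>, d) \<in> El (fibre g \<Delta> (Res (Base g) \<rho> (fst e))) \<Xi>"
        using z ext_comp_fibre_iff[OF \<Delta> re] by (simp add: w ext_Res_fst)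
      have "snd (ext_comp_iso g f X \<Delta> ?R) \<Xi> (\<sigma>, w) = snd (snd ?R \<Xi> (\<sigma>, d)) \<Xi> (Ident C \<Xi>, b)"
        using ext_comp_eval[OF \<Delta> re] z by (simp add: w)
      also have "snd ?R \<Xi> (\<sigma>, d) = snd e \<Xi> (Comp C \<rho> \<sigma>, d)" by (rule ext_Res_eval[OF g r e d])
      also have "snd \<dots> \<Xi> (Ident C \<Xi>, b) = snd (ext_comp_iso g f X \<Gamma> e) \<Xi> (Comp C \<rho> \<sigma>, w)"
        using ext_comp_eval[OF \<Gamma> e] z2 by (simp add: w)
      also have "\<dots> = snd (Res (ext (g \<cdot> f) X) \<rho> (ext_comp_iso g f X \<Gamma> e)) \<Xi> (\<sigma>, w)"
        using ext_Res_eval[OF gf r ie z1] by simp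
      finally show "snd (ext_comp_iso g f X \<Delta> ?R) \<Xi> (\<sigma>, w) =
          snd (Res (ext (g \<cdot> f) X) \<rho> (ext_comp_iso g f X \<Gamma> e)) \<Xi> (\<sigma>, w)" .
    qed
  qed
  moreover have "on (ext g (ext f X)) (ext_comp_iso g f X) = ext_comp_iso g f X"
    by (auto simp: ext_comp_iso_def on_def fun_eq_iff)
  ultimately show ?thesis by simp
qed

lemma inj_ext_comp_iso:
  assumes \<Gamma>: "\<Gamma> \<in> Obj C"
  shows "inj_on (ext_comp_iso g f X \<Gamma>) (El (ext g (ext f X)) \<Gamma>)"
proof (rule inj_onI)
  fix e e' assume e: "e \<in> El (ext g (ext f X)) \<Gamma>" and e': "e' \<in> El (ext g (ext f X)) \<Gamma>"
    and eq: "ext_comp_iso g f X \<Gamma> e = ext_comp_iso g f X \<Gamma> e'"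
  show "e = e'"
  proof (rule ext_eqI[OF e e'])
    show fst: "fst e = fst e'" using ext_comp_base(3)[OF \<Gamma> e] ext_comp_base(3)[OF \<Gamma> e'] eq by simp
    fix \<Delta> \<sigma> d assume d: "(\<sigma>, d) \<in> El (fibre g \<Gamma> (fst e)) \<Delta>"
    then have d': "(\<sigma>, d) \<in> El (fibre g \<Gamma> (fst e')) \<Delta>" by (simp add: fst)
    show "snd e \<Delta> (\<sigma>, d) = snd e' \<Delta> (\<sigma>, d)"
    proof (rule ext_eqI[OF ext_eval[OF e d] ext_eval[OF e' d']])
      show fst': "fst (snd e \<Delta> (\<sigma>, d)) = fst (snd e' \<Delta> (\<sigma>, d))"
        using ext_comp_base(4)[OF \<Gamma> e d] ext_comp_base(4)[OF \<Gamma> e' d'] eq by simp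
      fix \<Xi> \<tau> b assume "(\<tau>, b) \<in> El (fibre f \<Delta> (fst (snd e \<Delta> (\<sigma>, d)))) \<Xi>"
      then show "snd (snd e \<Delta> (\<sigma>, d)) \<Xi> (\<tau>, b) = snd (snd e' \<Delta> (\<sigma>, d)) \<Xi> (\<tau>, b)"
        using ext_comp_eval_Comp[OF \<Gamma> e d] ext_comp_eval_Comp[OF \<Gamma> e' d'] fst' eq by simp
    qed
  qed
qed

text \<open>The preimage curries \<open>w\<close>: at an outer point \<open>(\<sigma>, d)\<close> it
  is the function that sends an inner point \<open>(\<tau>, b)\<close> to the value of
  \<open>w\<close> at the stage of \<open>b\<close>, with \<open>d\<close> restricted to that
  stage.\<close>

lemma surj_ext_comp_iso:
  assumes \<Gamma>: "\<Gamma> \<in> Obj C" and w: "w \<in> El (ext (g \<cdot> f) X) \<Gamma>"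
  shows "\<exists>e \<in> El (ext g (ext f X)) \<Gamma>. ext_comp_iso g f X \<Gamma> e = w"
proof -
  note gf = polynomial_pcomp[OF g f] and E = presheaf_ext[OF f X]
  let ?B = "fst w" and ?G = "ext g (Base f)"
  have PG: "presheaf ?G" by (rule presheaf_ext[OF g polynomialD(2)[OF f]])
  have B: "?B \<in> El ?G \<Gamma>" using ext_fst[OF w] by (simp add: pcomp_simps)
  note c = ext_fst[OF B]
  \<comment> \<open>The formula is forced by \<open>ext_comp_eval_Comp\<close>; the base component
    of the composite point has to be the restriction of \<open>?B\<close> along the composite
    arrow.\<close>
  let ?v = "\<lambda>\<sigma> d \<Xi> (\<tau>, b). snd w \<Xi> (Comp C \<sigma> \<tau>, (Res ?G (Comp C \<sigma> \<tau>) ?B, Res (Tot g) \<tau> d, b))"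
  let ?u = "\<lambda>\<Delta> (\<sigma>, d). (snd ?B \<Delta> (\<sigma>, d), on (fibre f \<Delta> (snd ?B \<Delta> (\<sigma>, d))) (?v \<sigma> d))"
  have wz: "(Comp C \<sigma> \<tau>, (Res ?G (Comp C \<sigma> \<tau>) ?B, Res (Tot g) \<tau> d, b)) \<in> El (fibre (g \<cdot> f) \<Gamma> ?B) \<Xi>"
    if d: "(\<sigma>, d) \<in> El (fibre g \<Gamma> (fst ?B)) \<Delta>" and b: "(\<tau>, b) \<in> El (fibre f \<Delta> (snd ?B \<Delta> (\<sigma>, d))) \<Xi>"
    for \<sigma> d \<Delta> \<tau> b \<Xi>
  proof -
    have t: "\<tau> \<in> Hom C \<Xi> \<Delta>" using b by (simp add: fibre_iff)
    show ?thesis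
      unfolding pcomp_fibre_iff[OF g B polynomialD(2)[OF f]]
      using fibre_Res_in[OF g c d t] ext_eval_Res[OF B d t] b by (simp add: fibre_iff)
  qed
  have u_in: "?u \<Delta> (\<sigma>, d) \<in> El (ext f X) \<Delta>" if d: "(\<sigma>, d) \<in> El (fibre g \<Gamma> (fst ?B)) \<Delta>" for \<Delta> \<sigma> d
  proof -
    have s: "\<sigma> \<in> Hom C \<Delta> \<Gamma>" using d by (simp add: fibre_iff)
    note a = ext_eval[OF B d]
    have "nat_trans (fibre f \<Delta> (snd ?B \<Delta> (\<sigma>, d))) X (on (fibre f \<Delta> (snd ?B \<Delta> (\<sigma>, d))) (?v \<sigma> d))"
    proof (rule nat_trans_fibreI[OF f fibre_Obj[OF d] a])
      fix \<Xi> \<tau> b assume b: "(\<tau>, b) \<in> El (fibre f \<Delta> (snd ?B \<Delta> (\<sigma>, d))) \<Xi>"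
      then have t: "\<tau> \<in> Hom C \<Xi> \<Delta>" by (simp add: fibre_iff)
      note z = wz[OF d b]
      show "?v \<sigma> d \<Xi> (\<tau>, b) \<in> El X \<Xi>" using ext_eval[OF w z] by simp
      fix \<Theta> \<upsilon> assume u: "\<upsilon> \<in> Hom C \<Theta> \<Xi>"
      have "snd w \<Theta> (Comp C (Comp C \<sigma> \<tau>) \<upsilon>,
          Res (Tot (g \<cdot> f)) \<upsilon> (Res ?G (Comp C \<sigma> \<tau>) ?B, Res (Tot g) \<tau> d, b)) = Res X \<upsilon> (?v \<sigma> d \<Xi> (\<tau>, b))"
        using ext_eval_Res[OF w z u] by simp
      moreover have "Res (Tot g) \<upsilon> (Res (Tot g) \<tau> d) = Res (Tot g) (Comp C \<tau> \<upsilon>) d"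
        using d presheaf_CompD[OF polynomialD(1)[OF g] t u] by (simp add: fibre_iff)
      ultimately show "?v \<sigma> d \<Theta> (Comp C \<tau> \<upsilon>, Res (Tot f) \<upsilon> b) = Res X \<upsilon> (?v \<sigma> d \<Xi> (\<tau>, b))"
        using presheaf_CompD[OF PG Comp_in[OF s t] u B] by (simp add: pcomp_simps Comp_assoc[OF s t u])
    qed
    then show ?thesis using a by (simp add: ext_iff)
  qed
  let ?F = "fibre g \<Gamma> (fst ?B)"
  have "nat_trans ?F (ext f X) (on ?F ?u)"
  proof (rule nat_trans_fibreI[OF g \<Gamma> c])
    fix \<Delta> \<sigma> d assume d: "(\<sigma>, d) \<in> El ?F \<Delta>"
    show ud: "?u \<Delta> (\<sigma>, d) \<in> El (ext f X) \<Delta>" by (rule u_in[OF d])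
    have s: "\<sigma> \<in> Hom C \<Delta> \<Gamma>" using d by (simp add: fibre_iff)
    fix \<Xi> \<tau> assume t: "\<tau> \<in> Hom C \<Xi> \<Delta>"
    note d' = fibre_Res_in[OF g c d t] and a = ext_eval[OF B d]
    have a': "snd ?B \<Xi> (Comp C \<sigma> \<tau>, Res (Tot g) \<tau> d) = Res (Base f) \<tau> (snd ?B \<Delta> (\<sigma>, d))"
      by (rule ext_eval_Res[OF B d t])
    show "?u \<Xi> (Comp C \<sigma> \<tau>, Res (Tot g) \<tau> d) = Res (ext f X) \<tau> (?u \<Delta> (\<sigma>, d))"
    proof (rule ext_eqI[OF u_in[OF d'] presheaf_ResD[OF E t ud]])
      show "fst (?u \<Xi> (Comp C \<sigma> \<tau>, Res (Tot g) \<tau> d)) = fst (Res (ext f X) \<tau> (?u \<Delta> (\<sigma>, d)))"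
        using a' by (simp add: ext_Res_fst)
      fix \<Theta> \<upsilon> b assume "(\<upsilon>, b) \<in> El (fibre f \<Xi> (fst (?u \<Xi> (Comp C \<sigma> \<tau>, Res (Tot g) \<tau> d)))) \<Theta>"
      then have b: "(\<upsilon>, b) \<in> El (fibre f \<Xi> (Res (Base f) \<tau> (snd ?B \<Delta> (\<sigma>, d)))) \<Theta>" by (simp add: a')
      then have u: "\<upsilon> \<in> Hom C \<Theta> \<Xi>" by (simp add: fibre_iff)
      have b': "(Comp C \<tau> \<upsilon>, b) \<in> El (fibre f \<Delta> (snd ?B \<Delta> (\<sigma>, d))) \<Theta>"
        using b fibre_Res_iff[OF f a t u] by simp
      have "Res (Tot g) \<upsilon> (Res (Tot g) \<tau> d) = Res (Tot g) (Comp C \<tau> \<upsilon>) d"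
        using d presheaf_CompD[OF polynomialD(1)[OF g] t u] by (simp add: fibre_iff)
      moreover have "snd (Res (ext f X) \<tau> (?u \<Delta> (\<sigma>, d))) \<Theta> (\<upsilon>, b) = snd (?u \<Delta> (\<sigma>, d)) \<Theta> (Comp C \<tau> \<upsilon>, b)"
        by (rule ext_Res_eval[OF f t ud]) (use b in simp)
      ultimately show "snd (?u \<Xi> (Comp C \<sigma> \<tau>, Res (Tot g) \<tau> d)) \<Theta> (\<upsilon>, b) =
          snd (Res (ext f X) \<tau> (?u \<Delta> (\<sigma>, d))) \<Theta> (\<upsilon>, b)"
        using b b' fibre_Obj[OF b] by (simp add: a' on_apply Comp_assoc[OF s t u])
    qed
  qed
  then have e: "(fst ?B, on ?F ?u) \<in> El (ext g (ext f X)) \<Gamma>" (is "?e \<in> _") using c by (simp add: ext_iff)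
  have e_eval: "snd ?e \<Delta> (\<sigma>, d) = ?u \<Delta> (\<sigma>, d)" if "(\<sigma>, d) \<in> El ?F \<Delta>" for \<Delta> \<sigma> d
    using that fibre_Obj[OF that] by (simp add: on_apply)
  have "ext_comp_iso g f X \<Gamma> ?e = w"
  proof (rule ext_eqI[OF ext_comp_iso_in[OF \<Gamma> e] w])
    show fst: "fst (ext_comp_iso g f X \<Gamma> ?e) = ?B"
    proof (rule ext_eqI[OF ext_comp_base(2)[OF \<Gamma> e] B])
      show "fst (fst (ext_comp_iso g f X \<Gamma> ?e)) = fst ?B" using ext_comp_base(3)[OF \<Gamma> e] by simp
      fix \<Delta> \<sigma> d assume "(\<sigma>, d) \<in> El (fibre g \<Gamma> (fst (fst (ext_comp_iso g f X \<Gamma> ?e)))) \<Delta>"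
      then have d: "(\<sigma>, d) \<in> El ?F \<Delta>" using ext_comp_base(3)[OF \<Gamma> e] by simp
      then show "snd (fst (ext_comp_iso g f X \<Gamma> ?e)) \<Delta> (\<sigma>, d) = snd ?B \<Delta> (\<sigma>, d)"
        using ext_comp_base(4)[OF \<Gamma> e, of "(\<sigma>, d)" \<Delta>] e_eval[OF d] by simp
    qed
    fix \<Delta> \<sigma> y assume z: "(\<sigma>, y) \<in> El (fibre (g \<cdot> f) \<Gamma> (fst (ext_comp_iso g f X \<Gamma> ?e))) \<Delta>"
    obtain e' d b where y: "y = (e', d, b)" by (cases y)
    have zz: "(\<sigma>, (e', d, b)) \<in> El (fibre (g \<cdot> f) \<Gamma> ?B) \<Delta>" using z fst by (simp add: y)
    then have d: "(\<sigma>, d) \<in> El ?F \<Delta>" and e': "e' = Res ?G \<sigma> ?B" and b: "b \<in> El (Tot f) \<Delta>"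
      "Map f \<Delta> b = snd ?B \<Delta> (\<sigma>, d)"
      using pcomp_fibre_iff[OF g B polynomialD(2)[OF f]] by simp_all
    have \<Delta>: "\<Delta> \<in> Obj C" and s: "\<sigma> \<in> Hom C \<Delta> \<Gamma>" using d fibre_Obj[OF d] by (simp_all add: fibre_iff)
    have ib: "(Ident C \<Delta>, b) \<in> El (fibre f \<Delta> (snd ?B \<Delta> (\<sigma>, d))) \<Delta>"
      using fibre_Ident[OF f \<Delta> b(1)] b(2) by simp
    \<comment> \<open>At an identity arrow the restriction inside \<open>?v\<close> disappears, and
      what is left is the value of \<open>w\<close> at the original point.\<close>
    have "Res (Tot g) (Ident C \<Delta>) d = d"
      using d presheaf_IdentD[OF polynomialD(1)[OF g] \<Delta>] by (simp add: fibre_iff)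
    then have "snd (snd ?e \<Delta> (\<sigma>, d)) \<Delta> (Ident C \<Delta>, b) = snd w \<Delta> (\<sigma>, y)"
      unfolding e_eval[OF d] using ib \<Delta> by (simp add: on_apply Comp_Ident[OF s] e' y)
    then show "snd (ext_comp_iso g f X \<Gamma> ?e) \<Delta> (\<sigma>, y) = snd w \<Delta> (\<sigma>, y)"
      using ext_comp_eval[OF \<Gamma> e] z by (simp add: y)
  qed
  with e show ?thesis by blast
qed

lemma bij_ext_comp_iso:
  assumes \<Gamma>: "\<Gamma> \<in> Obj C"
  shows "bij_betw (ext_comp_iso g f X \<Gamma>) (El (ext g (ext f X)) \<Gamma>) (El (ext (g \<cdot> f) X) \<Gamma>)"
  unfolding bij_betw_def using inj_ext_comp_iso[OF \<Gamma>] ext_comp_iso_in[OF \<Gamma>] surj_ext_comp_iso[OF \<Gamma>] by blast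

end

text \<open>After the bases have been matched, both sides apply \<open>h\<close> to the same doubly
  nested value of \<open>e\<close> at each point of the composite fibre.\<close>

lemma ext_comp_iso_natural:
  assumes g: "polynomial g" and f: "polynomial f" and X: "presheaf X" and Y: "presheaf Y"
    and h: "nat_trans X Y h" and \<Gamma>: "\<Gamma> \<in> Obj C" and e: "e \<in> El (ext g (ext f X)) \<Gamma>"
  shows "ext_comp_iso g f Y \<Gamma> (ext_map g (ext f X) (ext_map f X h) \<Gamma> e) =
    ext_map (g \<cdot> f) X h \<Gamma> (ext_comp_iso g f X \<Gamma> e)"
proof -
  note gf = polynomial_pcomp[OF g f] and H = nat_trans_ext_map[OF f X Y h]
  let ?e = "ext_map g (ext f X) (ext_map f X h) \<Gamma> e"
  have he: "?e \<in> El (ext g (ext f Y)) \<Gamma>" by (rule ext_map_in[OF g H \<Gamma> e])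
  note ie = ext_comp_iso_in[OF g f X \<Gamma> e]
  have he_eval: "snd ?e \<Delta> z = ext_map f X h \<Delta> (snd e \<Delta> z)" if "z \<in> El (fibre g \<Gamma> (fst e)) \<Delta>" for \<Delta> z
    by (rule ext_map_eval[OF \<Gamma> e that])
  have fe: "fst ?e = fst e" by (rule ext_map_fst[OF \<Gamma> e])
  have fst: "fst (ext_comp_iso g f Y \<Gamma> ?e) = fst (ext_comp_iso g f X \<Gamma> e)"
  proof (rule ext_eqI[OF ext_comp_base(2)[OF g f Y \<Gamma> he] ext_comp_base(2)[OF g f X \<Gamma> e]])
    show "fst (fst (ext_comp_iso g f Y \<Gamma> ?e)) = fst (fst (ext_comp_iso g f X \<Gamma> e))"
      using ext_comp_base(3)[OF g f Y \<Gamma> he] ext_comp_base(3)[OF g f X \<Gamma> e] fe by simp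
    fix \<Delta> \<sigma> d assume "(\<sigma>, d) \<in> El (fibre g \<Gamma> (fst (fst (ext_comp_iso g f Y \<Gamma> ?e)))) \<Delta>"
    then have d: "(\<sigma>, d) \<in> El (fibre g \<Gamma> (fst e)) \<Delta>"
      using ext_comp_base(3)[OF g f Y \<Gamma> he] fe by simp
    then show "snd (fst (ext_comp_iso g f Y \<Gamma> ?e)) \<Delta> (\<sigma>, d) = snd (fst (ext_comp_iso g f X \<Gamma> e)) \<Delta> (\<sigma>, d)"
      using ext_comp_base(4)[OF g f Y \<Gamma> he, of "(\<sigma>, d)" \<Delta>] ext_comp_base(4)[OF g f X \<Gamma> e d] fe he_eval[OF d]
        ext_map_fst[OF fibre_Obj[OF d] ext_eval[OF e d]] by simp
  qed
  show ?thesis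
  proof (rule ext_eqI[OF ext_comp_iso_in[OF g f Y \<Gamma> he] ext_map_in[OF gf h \<Gamma> ie]])
    show "fst (ext_comp_iso g f Y \<Gamma> ?e) = fst (ext_map (g \<cdot> f) X h \<Gamma> (ext_comp_iso g f X \<Gamma> e))"
      using fst ext_map_fst[OF \<Gamma> ie, of h] by simp
    fix \<Delta> \<sigma> y assume z: "(\<sigma>, y) \<in> El (fibre (g \<cdot> f) \<Gamma> (fst (ext_comp_iso g f Y \<Gamma> ?e))) \<Delta>"
    obtain e' d b where y: "y = (e', d, b)" by (cases y)
    note zY = z[unfolded y] and zX = z[unfolded y fst]
    have d: "(\<sigma>, d) \<in> El (fibre g \<Gamma> (fst e)) \<Delta>" and b: "(Ident C \<Delta>, b) \<in> El (fibre f \<Delta> (fst (snd e \<Delta> (\<sigma>, d)))) \<Delta>"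
      using zX ext_comp_fibre_iff[OF g f X \<Gamma> e] by simp_all
    have "snd (ext_comp_iso g f Y \<Gamma> ?e) \<Delta> (\<sigma>, y) = snd (snd ?e \<Delta> (\<sigma>, d)) \<Delta> (Ident C \<Delta>, b)"
      using ext_comp_eval[OF g f Y \<Gamma> he zY] by (simp add: y)
    also have "\<dots> = h \<Delta> (snd (snd e \<Delta> (\<sigma>, d)) \<Delta> (Ident C \<Delta>, b))"
      using he_eval[OF d] ext_map_eval[OF fibre_Obj[OF d] ext_eval[OF e d] b, of h] by simp
    also have "\<dots> = h \<Delta> (snd (ext_comp_iso g f X \<Gamma> e) \<Delta> (\<sigma>, y))"
      using ext_comp_eval[OF g f X \<Gamma> e zX] by (simp add: y)
    also have "\<dots> = snd (ext_map (g \<cdot> f) X h \<Gamma> (ext_comp_iso g f X \<Gamma> e)) \<Delta> (\<sigma>, y)"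
      using ext_map_eval[OF \<Gamma> ie z[unfolded fst], of h] by simp
    finally show "snd (ext_comp_iso g f Y \<Gamma> ?e) \<Delta> (\<sigma>, y) =
        snd (ext_map (g \<cdot> f) X h \<Gamma> (ext_comp_iso g f X \<Gamma> e)) \<Delta> (\<sigma>, y)" .
  qed
qed

text \<open>As for the unit: the composition isomorphism gives a square that is bijective on
  elements, and this is pasted with a naturality square of P_\<mu>.\<close>

lemma ccell_lift_mult:
  assumes \<mu>: "ccell (p \<cdot> p) p \<mu>" and p: "polynomial p" and f: "polynomial f"
  shows "ccell (ext_poly p (ext_poly p f)) (ext_poly p f) (lift_mult p \<mu> f)"
proof -
  note pf = polynomialD[OF f]
  let ?i = "\<lparr>Dm = ext_poly p (ext_poly p f), Cd = ext_poly (p \<cdot> p) f,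
    c0 = ext_comp_iso p p (Base f), c1 = ext_comp_iso p p (Tot f)\<rparr>"
  have "ccell (ext_poly p (ext_poly p f)) (ext_poly (p \<cdot> p) f) ?i"
  proof (rule ccell_isoI)
    show "polynomial (ext_poly p (ext_poly p f))" "polynomial (ext_poly (p \<cdot> p) f)"
      by (simp_all add: polynomial_ext_poly polynomial_pcomp p f)
    show "nat_trans (Base (ext_poly p (ext_poly p f))) (Base (ext_poly (p \<cdot> p) f)) (c0 ?i)"
      "nat_trans (Tot (ext_poly p (ext_poly p f))) (Tot (ext_poly (p \<cdot> p) f)) (c1 ?i)"
      by (simp_all add: ext_poly_def nat_trans_ext_comp_iso p pf)
    fix \<Gamma> assume \<Gamma>: "\<Gamma> \<in> Obj C"
    show "inj_on (c0 ?i \<Gamma>) (El (Base (ext_poly p (ext_poly p f))) \<Gamma>)"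
      by (simp add: ext_poly_def inj_ext_comp_iso p pf \<Gamma>)
    show "bij_betw (c1 ?i \<Gamma>) (El (Tot (ext_poly p (ext_poly p f))) \<Gamma>) (El (Tot (ext_poly (p \<cdot> p) f)) \<Gamma>)"
      by (simp add: ext_poly_def bij_ext_comp_iso p pf \<Gamma>)
    fix b assume "b \<in> El (Tot (ext_poly p (ext_poly p f))) \<Gamma>"
    then show "Map (ext_poly (p \<cdot> p) f) \<Gamma> (c1 ?i \<Gamma> b) = c0 ?i \<Gamma> (Map (ext_poly p (ext_poly p f)) \<Gamma> b)"
      using ext_comp_iso_natural[OF p p pf(1,2,3) \<Gamma>] by (simp add: ext_poly_def)
  qed simp_all
  from ccell_ccomp[OF ccell_ext_cell[OF \<mu> f] this]
  show ?thesis using ccellD[OF \<mu>] by (simp add: ccomp_def lift_mult_def ext_poly_def)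
qed

section \<open>Horizontal composition and its coherence cells\<close>

lemma hcomp_boundary: "Dm (\<psi> \<star> \<phi>) = Dm \<psi> \<cdot> Dm \<phi>" "Cd (\<psi> \<star> \<phi>) = Cd \<psi> \<cdot> Cd \<phi>"
  by (simp_all add: hcomp_def Let_def)

context
  fixes \<psi> :: "('o, 'm, 'd, 'c, 'd1, 'c1) cell" and \<phi> :: "('o, 'm, 'b, 'a, 'b1, 'a1) cell"
    and g g' f f'
  assumes \<psi>: "ccell g g' \<psi>" and \<phi>: "ccell f f' \<phi>"
begin

lemma hcomp_c0:
  assumes "\<Gamma> \<in> Obj C" "e \<in> El (ext g (Base f)) \<Gamma>"
  shows "c0 (\<psi> \<star> \<phi>) \<Gamma> e = ext_cell \<psi> (Base f') \<Gamma> (ext_map g (Base f) (c0 \<phi>) \<Gamma> e)"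
    and "c0 (\<psi> \<star> \<phi>) \<Gamma> e \<in> El (ext g' (Base f')) \<Gamma>"
    and "fst (c0 (\<psi> \<star> \<phi>) \<Gamma> e) = c0 \<psi> \<Gamma> (fst e)"
proof -
  note ps = ccellD[OF \<psi>] and qs = ccellD[OF \<phi>]
  show 1: "c0 (\<psi> \<star> \<phi>) \<Gamma> e = ext_cell \<psi> (Base f') \<Gamma> (ext_map g (Base f) (c0 \<phi>) \<Gamma> e)"
    using assms ps(3) qs(3,4) by (simp add: hcomp_def Let_def ncomp_apply)
  have m: "ext_map g (Base f) (c0 \<phi>) \<Gamma> e \<in> El (ext g (Base f')) \<Gamma>"
    by (rule ext_map_in[OF ps(5) qs(7) assms])
  show "c0 (\<psi> \<star> \<phi>) \<Gamma> e \<in> El (ext g' (Base f')) \<Gamma>"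
    unfolding 1 by (rule ext_cell_in[OF \<psi> assms(1) m])
  show "fst (c0 (\<psi> \<star> \<phi>) \<Gamma> e) = c0 \<psi> \<Gamma> (fst e)"
    unfolding 1 ext_cell_fst[OF \<psi> assms(1) m] ext_map_fst[OF assms] ..
qed

text \<open>Gives the values of the base map at the images of fibre points. By
  \<open>ext_cell_eqI\<close> these are all that later comparisons have to inspect.\<close>

lemma hcomp_c0_eval:
  assumes \<Gamma>: "\<Gamma> \<in> Obj C" and e: "e \<in> El (ext g (Base f)) \<Gamma>" and d: "(\<sigma>, d) \<in> El (fibre g \<Gamma> (fst e)) \<Delta>"
  shows "snd (c0 (\<psi> \<star> \<phi>) \<Gamma> e) \<Delta> (\<sigma>, c1 \<psi> \<Delta> d) = c0 \<phi> \<Delta> (snd e \<Delta> (\<sigma>, d))"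
proof -
  have m: "ext_map g (Base f) (c0 \<phi>) \<Gamma> e \<in> El (ext g (Base f')) \<Gamma>"
    by (rule ext_map_in[OF ccellD(5)[OF \<psi>] ccellD(7)[OF \<phi>] \<Gamma> e])
  show ?thesis
    using ext_cell_eval[OF \<psi> \<Gamma> m] d
    by (simp add: hcomp_c0(1)[OF \<Gamma> e] ext_map_fst[OF \<Gamma> e] ext_map_eval[OF \<Gamma> e d])
qed

lemma hcomp_c1:
  "\<Gamma> \<in> Obj C \<Longrightarrow> (e, d, b) \<in> El (Tot (g \<cdot> f)) \<Gamma> \<Longrightarrow>
    c1 (\<psi> \<star> \<phi>) \<Gamma> (e, d, b) = (c0 (\<psi> \<star> \<phi>) \<Gamma> e, c1 \<psi> \<Gamma> d, c1 \<phi> \<Gamma> b)"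
  using ccellD[OF \<psi>] ccellD[OF \<phi>] by (simp add: hcomp_def Let_def on_apply)

text \<open>That \<open>c1 \<phi> \<Gamma> b\<close> lies over the value of the new function at
  \<open>c1 \<psi> \<Gamma> d\<close> is \<open>hcomp_c0_eval\<close> at the generic point of
  \<open>d\<close>.\<close>

lemma hcomp_c1_in:
  assumes \<Gamma>: "\<Gamma> \<in> Obj C" and x: "x \<in> El (Tot (g \<cdot> f)) \<Gamma>"
  shows "c1 (\<psi> \<star> \<phi>) \<Gamma> x \<in> El (Tot (g' \<cdot> f')) \<Gamma>"
proof -
  obtain e d b where xx: "x = (e, d, b)" by (cases x)
  have x': "e \<in> El (ext g (Base f)) \<Gamma>" "d \<in> El (Tot g) \<Gamma>" "Map g \<Gamma> d = fst e" "b \<in> El (Tot f) \<Gamma>"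
    "Map f \<Gamma> b = snd e \<Gamma> (Ident C \<Gamma>, d)" using x by (auto simp: xx pcomp_iff)
  have i: "(Ident C \<Gamma>, d) \<in> El (fibre g \<Gamma> (fst e)) \<Gamma>"
    using fibre_Ident[OF ccellD(5)[OF \<psi>] \<Gamma> x'(2)] x'(3) by simp
  show ?thesis
    using x hcomp_c1[OF \<Gamma>, of e d b] hcomp_c0[OF \<Gamma> x'(1)] hcomp_c0_eval[OF \<Gamma> x'(1) i] x'
      ccell_comm[OF \<psi> \<Gamma> x'(2)] ccell_comm[OF \<phi> \<Gamma> x'(4)] ccell_in[OF \<psi> \<Gamma>] ccell_in[OF \<phi> \<Gamma>]
    by (simp add: xx pcomp_iff)
qed

text \<open>Two successive lifts: lifting \<open>d'\<close> along \<open>\<psi>\<close> over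
  \<open>fst e\<close> fixes the value of \<open>e\<close> over which \<open>b'\<close> is then
  lifted along \<open>\<phi>\<close>.\<close>

lemma ccell_hcomp: "ccell (g \<cdot> f) (g' \<cdot> f') (\<psi> \<star> \<phi>)"
proof (rule ccellI)
  note ps = ccellD[OF \<psi>] and qs = ccellD[OF \<phi>]
  note pf = polynomialD[OF qs(5)] and pf' = polynomialD[OF qs(6)]
  show gf: "polynomial (g \<cdot> f)" and gf': "polynomial (g' \<cdot> f')" by (simp_all add: polynomial_pcomp ps qs)
  show "Dm (\<psi> \<star> \<phi>) = g \<cdot> f" "Cd (\<psi> \<star> \<phi>) = g' \<cdot> f'" by (simp_all add: hcomp_boundary ps qs)
  have "nat_trans (ext g (Base f)) (ext g' (Base f'))
      (ncomp (ext g (Base f)) (ext_cell \<psi> (Base f')) (ext_map g (Base f) (c0 \<phi>)))"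
    using presheaf_ext[OF ps(5) pf(2)] nat_trans_ext_map[OF ps(5) pf(2) pf'(2) qs(7)]
      nat_trans_ext_cell[OF \<psi> pf'(2)] by (rule nat_trans_ncomp)
  then show nt0: "nat_trans (Base (g \<cdot> f)) (Base (g' \<cdot> f')) (c0 (\<psi> \<star> \<phi>))"
    using ps qs by (simp add: hcomp_def Let_def pcomp_simps)
  have "nat_trans (Tot (g \<cdot> f)) (Tot (g' \<cdot> f')) (on (Tot (g \<cdot> f)) (c1 (\<psi> \<star> \<phi>)))"
  proof (rule nat_trans_onI[OF polynomialD(1)[OF gf] hcomp_c1_in])
    fix \<Delta> \<Gamma> \<sigma> x assume s: "\<sigma> \<in> Hom C \<Delta> \<Gamma>" and x: "x \<in> El (Tot (g \<cdot> f)) \<Gamma>"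
    obtain e d b where xx: "x = (e, d, b)" by (cases x)
    have x': "e \<in> El (ext g (Base f)) \<Gamma>" "d \<in> El (Tot g) \<Gamma>" "b \<in> El (Tot f) \<Gamma>"
      using x by (auto simp: xx pcomp_iff)
    have \<Delta>: "\<Delta> \<in> Obj C" and \<Gamma>: "\<Gamma> \<in> Obj C" using Hom_Obj[OF s] by auto
    have sx: "Res (Tot (g \<cdot> f)) \<sigma> x \<in> El (Tot (g \<cdot> f)) \<Delta>" using polynomial_in(2)[OF gf s x] .
    have "c0 (\<psi> \<star> \<phi>) \<Delta> (Res (Base (g \<cdot> f)) \<sigma> e) = Res (Base (g' \<cdot> f')) \<sigma> (c0 (\<psi> \<star> \<phi>) \<Gamma> e)"
      using x'(1) by (intro nat_trans_natural[OF nt0 s]) (simp add: pcomp_simps)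
    then show "c1 (\<psi> \<star> \<phi>) \<Delta> (Res (Tot (g \<cdot> f)) \<sigma> x) = Res (Tot (g' \<cdot> f')) \<sigma> (c1 (\<psi> \<star> \<phi>) \<Gamma> x)"
      using hcomp_c1[OF \<Delta>] hcomp_c1[OF \<Gamma>] x sx x' ccell_natural[OF \<psi> s] ccell_natural[OF \<phi> s]
      by (simp add: xx pcomp_simps)
  qed
  moreover have "on (Tot (g \<cdot> f)) (c1 (\<psi> \<star> \<phi>)) = c1 (\<psi> \<star> \<phi>)"
    using ps qs by (auto simp: hcomp_def Let_def on_def fun_eq_iff)
  ultimately show "nat_trans (Tot (g \<cdot> f)) (Tot (g' \<cdot> f')) (c1 (\<psi> \<star> \<phi>))" by simp
  fix \<Gamma> assume \<Gamma>: "\<Gamma> \<in> Obj C"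
  show "Map (g' \<cdot> f') \<Gamma> (c1 (\<psi> \<star> \<phi>) \<Gamma> x) = c0 (\<psi> \<star> \<phi>) \<Gamma> (Map (g \<cdot> f) \<Gamma> x)"
    if x: "x \<in> El (Tot (g \<cdot> f)) \<Gamma>" for x
    using hcomp_c1_in[OF \<Gamma> x] x by (cases x) (simp add: hcomp_c1[OF \<Gamma>] pcomp_Map[OF \<Gamma>])
  fix e y assume "e \<in> El (Base (g \<cdot> f)) \<Gamma>" and y: "y \<in> El (Tot (g' \<cdot> f')) \<Gamma>"
    and eq: "Map (g' \<cdot> f') \<Gamma> y = c0 (\<psi> \<star> \<phi>) \<Gamma> e"
  then have e: "e \<in> El (ext g (Base f)) \<Gamma>" by (simp add: pcomp_simps)
  obtain e' d' b' where yy: "y = (e', d', b')" by (cases y)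
  have e': "e' = c0 (\<psi> \<star> \<phi>) \<Gamma> e" using eq y by (simp add: pcomp_Map[OF \<Gamma>] yy)
  have y': "d' \<in> El (Tot g') \<Gamma>" "Map g' \<Gamma> d' = c0 \<psi> \<Gamma> (fst e)" "b' \<in> El (Tot f') \<Gamma>"
    "Map f' \<Gamma> b' = snd e' \<Gamma> (Ident C \<Gamma>, d')" using y hcomp_c0(3)[OF \<Gamma> e] e' by (auto simp: yy pcomp_iff)
  note exd = ccell_ex1[OF \<psi> \<Gamma> ext_fst[OF e] y'(1,2)]
  then obtain d where d: "d \<in> El (Tot g) \<Gamma>" "Map g \<Gamma> d = fst e" "c1 \<psi> \<Gamma> d = d'" by blast
  have i: "(Ident C \<Gamma>, d) \<in> El (fibre g \<Gamma> (fst e)) \<Gamma>" using fibre_Ident[OF ps(5) \<Gamma> d(1)] d(2) by simp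
  note m = ext_eval[OF e i]
  have "Map f' \<Gamma> b' = c0 \<phi> \<Gamma> (snd e \<Gamma> (Ident C \<Gamma>, d))" using y'(4) hcomp_c0_eval[OF \<Gamma> e i] d(3) e' by simp
  note exb = ccell_ex1[OF \<phi> \<Gamma> m y'(3) this]
  then obtain b where b: "b \<in> El (Tot f) \<Gamma>" "Map f \<Gamma> b = snd e \<Gamma> (Ident C \<Gamma>, d)" "c1 \<phi> \<Gamma> b = b'" by blast
  show "\<exists>!x. x \<in> El (Tot (g \<cdot> f)) \<Gamma> \<and> Map (g \<cdot> f) \<Gamma> x = e \<and> c1 (\<psi> \<star> \<phi>) \<Gamma> x = y"
  proof (rule ex1I[of _ "(e, d, b)"])
    have "(e, d, b) \<in> El (Tot (g \<cdot> f)) \<Gamma>" using e d b by (simp add: pcomp_iff)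
    then show "(e, d, b) \<in> El (Tot (g \<cdot> f)) \<Gamma> \<and> Map (g \<cdot> f) \<Gamma> (e, d, b) = e \<and> c1 (\<psi> \<star> \<phi>) \<Gamma> (e, d, b) = y"
      using hcomp_c1[OF \<Gamma>] d b e' by (simp add: pcomp_Map[OF \<Gamma>] yy)
  next
    fix x assume x: "x \<in> El (Tot (g \<cdot> f)) \<Gamma> \<and> Map (g \<cdot> f) \<Gamma> x = e \<and> c1 (\<psi> \<star> \<phi>) \<Gamma> x = y"
    obtain e2 d2 b2 where xx: "x = (e2, d2, b2)" by (cases x)
    have xi: "(e2, d2, b2) \<in> El (Tot (g \<cdot> f)) \<Gamma>" using x by (simp add: xx)
    have e2: "e2 = e" using x pcomp_Map[OF \<Gamma> xi] by (simp add: xx)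
    have d2: "d2 \<in> El (Tot g) \<Gamma>" "Map g \<Gamma> d2 = fst e" "c1 \<psi> \<Gamma> d2 = d'"
      and b2: "b2 \<in> El (Tot f) \<Gamma>" "Map f \<Gamma> b2 = snd e \<Gamma> (Ident C \<Gamma>, d2)" "c1 \<phi> \<Gamma> b2 = b'"
      using x xi hcomp_c1[OF \<Gamma> xi] by (simp_all add: xx yy pcomp_iff e2)
    have dd: "d2 = d" using exd d d2 by blast
    have "b2 = b" using exb b b2 by (auto simp: dd)
    then show "x = (e, d, b)" by (simp add: xx e2 dd)
  qed
qed

end

section \<open>Strict functoriality of horizontal composition\<close>

text \<open>Interchange. On bases the two middle factors change places by naturality of P_\<psi>
  with respect to \<open>c0 \<phi>'\<close>; on total spaces the law is componentwise.\<close>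

lemma hcomp_ccomp:
  assumes \<psi>: "ccell g g' \<psi>" and \<phi>: "ccell f f' \<phi>" and \<psi>': "ccell g' g'' \<psi>'" and \<phi>': "ccell f' f'' \<phi>'"
  shows "(\<psi>' \<odot> \<psi>) \<star> (\<phi>' \<odot> \<phi>) = (\<psi>' \<star> \<phi>') \<odot> (\<psi> \<star> \<phi>)"
proof -
  note \<psi>\<psi> = ccell_ccomp[OF \<psi>' \<psi>] and \<phi>\<phi> = ccell_ccomp[OF \<phi>' \<phi>]
  note h1 = ccell_hcomp[OF \<psi> \<phi>] and h2 = ccell_hcomp[OF \<psi>' \<phi>']
  note ps = ccellD[OF \<psi>] and qs = ccellD[OF \<phi>] and qs' = ccellD[OF \<phi>']
  have c0: "c0 ((\<psi>' \<odot> \<psi>) \<star> (\<phi>' \<odot> \<phi>)) \<Gamma> e = c0 (\<psi>' \<star> \<phi>') \<Gamma> (c0 (\<psi> \<star> \<phi>) \<Gamma> e)"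
    if \<Gamma>: "\<Gamma> \<in> Obj C" and e: "e \<in> El (ext g (Base f)) \<Gamma>" for \<Gamma> e
  proof -
    let ?m = "ext_map g (Base f) (c0 \<phi>) \<Gamma> e"
    have m: "?m \<in> El (ext g (Base f')) \<Gamma>" by (rule ext_map_in[OF ps(5) qs(7) \<Gamma> e])
    have m': "ext_map g (Base f') (c0 \<phi>') \<Gamma> ?m \<in> El (ext g (Base f'')) \<Gamma>"
      by (rule ext_map_in[OF ps(5) qs'(7) \<Gamma> m])
    have "c0 (\<phi>' \<odot> \<phi>) = ncomp (Base f) (c0 \<phi>') (c0 \<phi>)" using qs by (simp add: ccomp_def)
    then have "c0 ((\<psi>' \<odot> \<psi>) \<star> (\<phi>' \<odot> \<phi>)) \<Gamma> e =
        ext_cell (\<psi>' \<odot> \<psi>) (Base f'') \<Gamma> (ext_map g (Base f') (c0 \<phi>') \<Gamma> ?m)"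
      using hcomp_c0(1)[OF \<psi>\<psi> \<phi>\<phi> \<Gamma> e] ext_map_ncomp[OF ps(5) qs(7) qs'(7) \<Gamma> e] by simp
    also have "\<dots> = ext_cell \<psi>' (Base f'') \<Gamma> (ext_map g' (Base f') (c0 \<phi>') \<Gamma> (ext_cell \<psi> (Base f') \<Gamma> ?m))"
      using ext_cell_ccomp[OF \<psi>' \<psi> \<Gamma> m'] ext_cell_ext_map[OF \<psi> qs'(7) \<Gamma> m] by simp
    also have "\<dots> = c0 (\<psi>' \<star> \<phi>') \<Gamma> (c0 (\<psi> \<star> \<phi>) \<Gamma> e)"
      using hcomp_c0(1)[OF \<psi>' \<phi>' \<Gamma> hcomp_c0(2)[OF \<psi> \<phi> \<Gamma> e]] hcomp_c0(1)[OF \<psi> \<phi> \<Gamma> e] by simp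
    finally show ?thesis .
  qed
  show ?thesis
  proof (rule cell_eqI[OF ccell_hcomp[OF \<psi>\<psi> \<phi>\<phi>] ccell_ccomp[OF h2 h1]])
    fix \<Gamma> e assume \<Gamma>: "\<Gamma> \<in> Obj C" and e: "e \<in> El (Base (g \<cdot> f)) \<Gamma>"
    then show "c0 ((\<psi>' \<odot> \<psi>) \<star> (\<phi>' \<odot> \<phi>)) \<Gamma> e = c0 ((\<psi>' \<star> \<phi>') \<odot> (\<psi> \<star> \<phi>)) \<Gamma> e"
      using c0[OF \<Gamma>] ccomp_apply(1)[OF h1 \<Gamma> e, of "\<psi>' \<star> \<phi>'"] by (simp add: pcomp_simps)
  next
    fix \<Gamma> x assume \<Gamma>: "\<Gamma> \<in> Obj C" and x: "x \<in> El (Tot (g \<cdot> f)) \<Gamma>"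
    obtain e d b where xx: "x = (e, d, b)" by (cases x)
    note xi = x[unfolded xx]
    have x': "e \<in> El (ext g (Base f)) \<Gamma>" "d \<in> El (Tot g) \<Gamma>" "b \<in> El (Tot f) \<Gamma>"
      using xi by (auto simp: pcomp_iff)
    have "c1 (\<psi> \<star> \<phi>) \<Gamma> (e, d, b) \<in> El (Tot (g' \<cdot> f')) \<Gamma>" by (rule hcomp_c1_in[OF \<psi> \<phi> \<Gamma> xi])
    then show "c1 ((\<psi>' \<odot> \<psi>) \<star> (\<phi>' \<odot> \<phi>)) \<Gamma> x = c1 ((\<psi>' \<star> \<phi>') \<odot> (\<psi> \<star> \<phi>)) \<Gamma> x"
      using ccomp_apply(2)[OF h1 \<Gamma> x, of "\<psi>' \<star> \<phi>'"] ccomp_apply(2)[OF \<psi> \<Gamma> x'(2), of \<psi>']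
        ccomp_apply(2)[OF \<phi> \<Gamma> x'(3), of \<phi>'] c0[OF \<Gamma> x'(1)] hcomp_c1[OF \<psi>\<psi> \<phi>\<phi> \<Gamma> xi] hcomp_c1[OF \<psi> \<phi> \<Gamma> xi]
        hcomp_c1[OF \<psi>' \<phi>' \<Gamma>] by (simp add: xx)
  qed
qed

lemma hcomp_cid_c0:
  assumes g: "polynomial g" and \<phi>: "ccell f f' \<phi>" and \<Gamma>: "\<Gamma> \<in> Obj C" and e: "e \<in> El (ext g (Base f)) \<Gamma>"
  shows "c0 (cid g \<star> \<phi>) \<Gamma> e = ext_map g (Base f) (c0 \<phi>) \<Gamma> e"
  unfolding hcomp_c0(1)[OF ccell_cid[OF g] \<phi> \<Gamma> e]
  by (rule ext_cell_cid[OF g \<Gamma> ext_map_in[OF g ccellD(7)[OF \<phi>] \<Gamma> e]])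

lemma hcomp_cid:
  assumes g: "polynomial g" and f: "polynomial f"
  shows "cid g \<star> cid f = cid (g \<cdot> f)"
proof (rule cell_eqI[OF ccell_hcomp[OF ccell_cid[OF g] ccell_cid[OF f]] ccell_cid[OF polynomial_pcomp[OF g f]]])
  note i = ccell_cid[OF g] ccell_cid[OF f]
  have c0: "c0 (cid g \<star> cid f) \<Gamma> e = e" if "\<Gamma> \<in> Obj C" "e \<in> El (ext g (Base f)) \<Gamma>" for \<Gamma> e
    using hcomp_cid_c0[OF g i(2) that] ext_map_nid[OF g polynomialD(2)[OF f] that] by (simp add: cid_def)
  fix \<Gamma> assume \<Gamma>: "\<Gamma> \<in> Obj C"
  show "c0 (cid g \<star> cid f) \<Gamma> e = c0 (cid (g \<cdot> f)) \<Gamma> e" if "e \<in> El (Base (g \<cdot> f)) \<Gamma>" for e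
    using that \<Gamma> c0[OF \<Gamma>] by (simp add: pcomp_simps cid_def nid_apply)
  show "c1 (cid g \<star> cid f) \<Gamma> x = c1 (cid (g \<cdot> f)) \<Gamma> x" if x: "x \<in> El (Tot (g \<cdot> f)) \<Gamma>" for x
  proof -
    obtain e d b where xx: "x = (e, d, b)" by (cases x)
    have "c1 (cid (g \<cdot> f)) \<Gamma> x = x" "c1 (cid g) \<Gamma> d = d" "c1 (cid f) \<Gamma> b = b"
      using x \<Gamma> by (simp_all add: cid_def nid_apply xx pcomp_iff)
    then show ?thesis
      using hcomp_c1[OF i \<Gamma>] x c0[OF \<Gamma>] by (simp add: xx pcomp_iff)
  qed
qed

section \<open>The associator, its naturality and the pentagon\<close>

lemma assoc_simps: "Dm (assoc h g f) = h \<cdot> (g \<cdot> f)" "Cd (assoc h g f) = (h \<cdot> g) \<cdot> f"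
    "c0 (assoc h g f) = ext_comp_iso h g (Base f)"
  by (simp_all add: assoc_def)

lemma assoc_c1: "\<Gamma> \<in> Obj C \<Longrightarrow> (e, x, (e2, d, b)) \<in> El (Tot (h \<cdot> (g \<cdot> f))) \<Gamma> \<Longrightarrow>
    c1 (assoc h g f) \<Gamma> (e, x, (e2, d, b)) =
    (ext_comp_iso h g (Base f) \<Gamma> e, (fst (ext_comp_iso h g (Base f) \<Gamma> e), x, d), b)"
  by (simp add: assoc_def on_apply Let_def)

text \<open>The component \<open>e2\<close> is the base of the inner element and has to be the value
  of \<open>e\<close> at \<open>x\<close>, so an element is given by \<open>e\<close>,
  \<open>x\<close>, \<open>d\<close> and \<open>b\<close>.\<close>

lemma pcomp_assoc_iff:
  "\<Gamma> \<in> Obj C \<Longrightarrow> (e, x, (e2, d, b)) \<in> El (Tot (h \<cdot> (g \<cdot> f))) \<Gamma> \<longleftrightarrow>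
    e \<in> El (ext h (ext g (Base f))) \<Gamma> \<and> x \<in> El (Tot h) \<Gamma> \<and> Map h \<Gamma> x = fst e \<and>
    (e2, d, b) \<in> El (Tot (g \<cdot> f)) \<Gamma> \<and> e2 = snd e \<Gamma> (Ident C \<Gamma>, x)"
  using pcomp_Map[of \<Gamma> e2 d b g f] by (auto simp: pcomp_iff[of e] pcomp_simps)

text \<open>An equivalence because both directions serve in \<open>ccell_assoc\<close>: from right
  to left \<open>c1\<close> is well defined, from left to right the candidate lift is an element. If
  \<open>x\<close> does not lie over \<open>fst e\<close>, both sides fail.\<close>

lemma assoc_c1_in:
  assumes h: "polynomial h" and g: "polynomial g" and f: "polynomial f"
    and \<Gamma>: "\<Gamma> \<in> Obj C" and e: "e \<in> El (ext h (ext g (Base f))) \<Gamma>"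
  shows "(ext_comp_iso h g (Base f) \<Gamma> e, (fst (ext_comp_iso h g (Base f) \<Gamma> e), x, d), b)
      \<in> El (Tot ((h \<cdot> g) \<cdot> f)) \<Gamma> \<longleftrightarrow>
    (e, x, (snd e \<Gamma> (Ident C \<Gamma>, x), d, b)) \<in> El (Tot (h \<cdot> (g \<cdot> f))) \<Gamma>"
proof (cases "x \<in> El (Tot h) \<Gamma> \<and> Map h \<Gamma> x = fst e")
  case True
  note fA = polynomialD(2)[OF f]
  let ?e = "ext_comp_iso h g (Base f) \<Gamma> e"
  have ix: "(Ident C \<Gamma>, x) \<in> El (fibre h \<Gamma> (fst e)) \<Gamma>" using fibre_Ident[OF h \<Gamma>] True by metis
  note ee = ext_eval[OF e ix]
  note base = ext_comp_base[OF h g fA \<Gamma> e]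
  have 1: "(fst ?e, x, d) \<in> El (Tot (h \<cdot> g)) \<Gamma> \<longleftrightarrow> d \<in> El (Tot g) \<Gamma> \<and> Map g \<Gamma> d = fst (snd e \<Gamma> (Ident C \<Gamma>, x))"
    using True base ix by (simp add: pcomp_iff)
  have 2: "snd ?e \<Gamma> (Ident C \<Gamma>, (fst ?e, x, d)) = snd (snd e \<Gamma> (Ident C \<Gamma>, x)) \<Gamma> (Ident C \<Gamma>, d)"
    if "(fst ?e, x, d) \<in> El (Tot (h \<cdot> g)) \<Gamma>"
    using fibre_Ident[OF polynomial_pcomp[OF h g] \<Gamma> that] pcomp_Map[OF \<Gamma> that]
    by (intro ext_comp_eval[OF h g fA \<Gamma> e]) simp
  show ?thesis
    using 1 2 True e ee ext_comp_iso_in[OF h g fA \<Gamma> e] pcomp_Map[OF \<Gamma>, of "fst ?e" x d h g]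
    by (auto simp: pcomp_assoc_iff[OF \<Gamma>] pcomp_iff[of _ d] pcomp_iff[of ?e])
next
  case False
  then show ?thesis
    using ext_comp_base(3)[OF h g polynomialD(2)[OF f] \<Gamma> e]
    by (auto simp: pcomp_iff)
qed

text \<open>On total spaces the associator rebrackets \<open>x\<close>, \<open>d\<close> and
  \<open>b\<close>, and the other components are determined by the base element, so the unique lift
  can be read off from coordinates.\<close>

lemma ccell_assoc:
  assumes h: "polynomial h" and g: "polynomial g" and f: "polynomial f"
  shows "ccell (h \<cdot> (g \<cdot> f)) ((h \<cdot> g) \<cdot> f) (assoc h g f)"
proof (rule ccellI)
  note fA = polynomialD(2)[OF f]
  let ?s = "h \<cdot> (g \<cdot> f)" and ?t = "(h \<cdot> g) \<cdot> f"
  show s: "polynomial ?s" and t: "polynomial ?t" by (simp_all add: polynomial_pcomp h g f)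
  show "Dm (assoc h g f) = ?s" "Cd (assoc h g f) = ?t" by (simp_all add: assoc_simps)
  show nt0: "nat_trans (Base ?s) (Base ?t) (c0 (assoc h g f))"
    using nat_trans_ext_comp_iso[OF h g fA] by (simp add: assoc_simps pcomp_simps)
  have c1_in: "c1 (assoc h g f) \<Gamma> x \<in> El (Tot ?t) \<Gamma>" if \<Gamma>: "\<Gamma> \<in> Obj C" and x: "x \<in> El (Tot ?s) \<Gamma>" for \<Gamma> x
  proof -
    obtain e y e2 d b where xx: "x = (e, y, (e2, d, b))" by (cases x)
    have e: "e \<in> El (ext h (ext g (Base f))) \<Gamma>" and e2: "e2 = snd e \<Gamma> (Ident C \<Gamma>, y)"
      using x by (simp_all add: xx pcomp_assoc_iff[OF \<Gamma>])
    show ?thesis using assoc_c1_in[OF h g f \<Gamma> e] x e2 by (simp add: xx assoc_c1[OF \<Gamma>])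
  qed
  have "nat_trans (Tot ?s) (Tot ?t) (on (Tot ?s) (c1 (assoc h g f)))"
  proof (rule nat_trans_onI[OF polynomialD(1)[OF s] c1_in])
    fix \<Delta> \<Gamma> \<sigma> x assume sg: "\<sigma> \<in> Hom C \<Delta> \<Gamma>" and x: "x \<in> El (Tot ?s) \<Gamma>"
    obtain e y e2 d b where xx: "x = (e, y, (e2, d, b))" by (cases x)
    have \<Delta>: "\<Delta> \<in> Obj C" and \<Gamma>: "\<Gamma> \<in> Obj C" using Hom_Obj[OF sg] by auto
    have e: "e \<in> El (ext h (ext g (Base f))) \<Gamma>" using x by (simp_all add: xx pcomp_assoc_iff[OF \<Gamma>])
    have sx: "Res (Tot ?s) \<sigma> x \<in> El (Tot ?s) \<Delta>" using polynomial_in(2)[OF s sg x] .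
    show "c1 (assoc h g f) \<Delta> (Res (Tot ?s) \<sigma> x) = Res (Tot ?t) \<sigma> (c1 (assoc h g f) \<Gamma> x)"
      using x sx ext_comp_base_Res[OF h g fA sg e]
        nat_trans_natural[OF nat_trans_ext_comp_iso[OF h g fA] sg e]
      by (simp add: assoc_c1[OF \<Gamma>] assoc_c1[OF \<Delta>] xx pcomp_simps)
  qed
  moreover have "on (Tot ?s) (c1 (assoc h g f)) = c1 (assoc h g f)"
    by (auto simp: assoc_def on_def fun_eq_iff)
  ultimately show "nat_trans (Tot ?s) (Tot ?t) (c1 (assoc h g f))" by simp
  fix \<Gamma> assume \<Gamma>: "\<Gamma> \<in> Obj C"
  show "Map ?t \<Gamma> (c1 (assoc h g f) \<Gamma> x) = c0 (assoc h g f) \<Gamma> (Map ?s \<Gamma> x)" if x: "x \<in> El (Tot ?s) \<Gamma>" for x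
  proof -
    obtain e y e2 d b where xx: "x = (e, y, (e2, d, b))" by (cases x)
    show ?thesis
      using c1_in[OF \<Gamma> x] x by (simp add: pcomp_Map[OF \<Gamma>] assoc_c1[OF \<Gamma>] xx assoc_simps)
  qed
  fix e w assume "e \<in> El (Base ?s) \<Gamma>" and w: "w \<in> El (Tot ?t) \<Gamma>" and eq: "Map ?t \<Gamma> w = c0 (assoc h g f) \<Gamma> e"
  then have e: "e \<in> El (ext h (ext g (Base f))) \<Gamma>" by (simp add: pcomp_simps)
  obtain e' e'' y d b where ww: "w = (e', (e'', y, d), b)" by (cases w) auto
  have e': "e' = ext_comp_iso h g (Base f) \<Gamma> e" using eq w by (simp add: pcomp_Map[OF \<Gamma>] ww assoc_simps)
  have "(e'', y, d) \<in> El (Tot (h \<cdot> g)) \<Gamma>" "Map (h \<cdot> g) \<Gamma> (e'', y, d) = fst e'" using w by (simp_all add: ww pcomp_iff[of e'])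
  then have e'': "e'' = fst e'" using pcomp_Map[OF \<Gamma>, of e'' y d h g] by simp
  let ?x = "(e, y, (snd e \<Gamma> (Ident C \<Gamma>, y), d, b))"
  have xi: "?x \<in> El (Tot ?s) \<Gamma>" using w assoc_c1_in[OF h g f \<Gamma> e] by (simp add: ww e' e'')
  show "\<exists>!x. x \<in> El (Tot ?s) \<Gamma> \<and> Map ?s \<Gamma> x = e \<and> c1 (assoc h g f) \<Gamma> x = w"
  proof (rule ex1I[of _ ?x])
    show "?x \<in> El (Tot ?s) \<Gamma> \<and> Map ?s \<Gamma> ?x = e \<and> c1 (assoc h g f) \<Gamma> ?x = w"
      using xi by (simp add: pcomp_Map[OF \<Gamma>] assoc_c1[OF \<Gamma>] ww e' e'')
  next
    fix x assume x: "x \<in> El (Tot ?s) \<Gamma> \<and> Map ?s \<Gamma> x = e \<and> c1 (assoc h g f) \<Gamma> x = w"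
    obtain e3 y3 e4 d3 b3 where xx: "x = (e3, y3, (e4, d3, b3))" by (cases x)
    have "e3 = e" using x by (auto simp: pcomp_Map[OF \<Gamma>] xx)
    moreover have "y3 = y" "d3 = d" "b3 = b" using x by (auto simp: assoc_c1[OF \<Gamma>] xx ww)
    moreover have "e4 = snd e3 \<Gamma> (Ident C \<Gamma>, y3)" using x by (simp add: xx pcomp_assoc_iff[OF \<Gamma>])
    ultimately show "x = ?x" by (simp add: xx)
  qed
qed

text \<open>The base map is compared on images of fibre points at two levels: along
  \<open>\<chi>\<close> for the first components, which are functions themselves, and along
  \<open>\<chi> \<star> \<psi>\<close> for the functions over them.\<close>

lemma hcomp_assoc_natural:
  assumes \<chi>: "ccell h h' \<chi>" and \<psi>: "ccell g g' \<psi>" and \<phi>: "ccell f f' \<phi>"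
  shows "assoc h' g' f' \<odot> (\<chi> \<star> (\<psi> \<star> \<phi>)) = ((\<chi> \<star> \<psi>) \<star> \<phi>) \<odot> assoc h g f"
proof -
  note h = ccellD(5)[OF \<chi>] and h' = ccellD(6)[OF \<chi>] and g = ccellD(5)[OF \<psi>] and g' = ccellD(6)[OF \<psi>]
    and f = ccellD(5)[OF \<phi>] and f' = ccellD(6)[OF \<phi>]
  note fA = polynomialD(2)[OF f] and fA' = polynomialD(2)[OF f']
  note \<psi>\<phi> = ccell_hcomp[OF \<psi> \<phi>] and \<chi>\<psi> = ccell_hcomp[OF \<chi> \<psi>]
  note l = ccell_hcomp[OF \<chi> \<psi>\<phi>] and r = ccell_hcomp[OF \<chi>\<psi> \<phi>]
  note a = ccell_assoc[OF h g f] and a' = ccell_assoc[OF h' g' f']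
  have c0: "ext_comp_iso h' g' (Base f') \<Gamma> (c0 (\<chi> \<star> (\<psi> \<star> \<phi>)) \<Gamma> e) =
      c0 ((\<chi> \<star> \<psi>) \<star> \<phi>) \<Gamma> (ext_comp_iso h g (Base f) \<Gamma> e)"
    (is "?L = ?R")
    if \<Gamma>: "\<Gamma> \<in> Obj C" and e: "e \<in> El (ext h (ext g (Base f))) \<Gamma>" for \<Gamma> e
  proof -
    let ?i = "ext_comp_iso h g (Base f) \<Gamma> e" and ?k = "c0 (\<chi> \<star> (\<psi> \<star> \<phi>)) \<Gamma> e"
    note i = ext_comp_iso_in[OF h g fA \<Gamma> e] and bi = ext_comp_base[OF h g fA \<Gamma> e]
    have e0: "e \<in> El (ext h (Base (g \<cdot> f))) \<Gamma>" using e by (simp add: pcomp_simps)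
    have k: "?k \<in> El (ext h' (ext g' (Base f'))) \<Gamma>" using hcomp_c0(2)[OF \<chi> \<psi>\<phi> \<Gamma> e0] by (simp add: pcomp_simps)
    have fk: "fst ?k = c0 \<chi> \<Gamma> (fst e)" using hcomp_c0(3)[OF \<chi> \<psi>\<phi> \<Gamma> e0] .
    have k_eval: "snd ?k \<Delta> (\<sigma>, c1 \<chi> \<Delta> x) = c0 (\<psi> \<star> \<phi>) \<Delta> (snd e \<Delta> (\<sigma>, x))"
      if "(\<sigma>, x) \<in> El (fibre h \<Gamma> (fst e)) \<Delta>" for \<Delta> \<sigma> x by (rule hcomp_c0_eval[OF \<chi> \<psi>\<phi> \<Gamma> e0 that])
    note bk = ext_comp_base[OF h' g' fA' \<Gamma> k]
    note b = hcomp_c0[OF \<chi> \<psi> \<Gamma> bi(2)]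
    have fst: "fst ?L = c0 (\<chi> \<star> \<psi>) \<Gamma> (fst ?i)"
    proof (rule ext_cell_eqI[OF \<chi> ext_fst[OF e] bk(2) b(2)])
      show "fst (fst ?L) = c0 \<chi> \<Gamma> (fst e)" using bk(3) fk by simp
      show "fst (c0 (\<chi> \<star> \<psi>) \<Gamma> (fst ?i)) = c0 \<chi> \<Gamma> (fst e)" using b(3) bi(3) by simp
      fix \<Delta> \<sigma> x assume x: "(\<sigma>, x) \<in> El (fibre h \<Gamma> (fst e)) \<Delta>"
      have "snd (fst ?L) \<Delta> (\<sigma>, c1 \<chi> \<Delta> x) = fst (snd ?k \<Delta> (\<sigma>, c1 \<chi> \<Delta> x))"
        using bk(4)[of "(\<sigma>, c1 \<chi> \<Delta> x)" \<Delta>] fibre_push[OF \<chi> ext_fst[OF e] x] fk by simp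
      also have "\<dots> = c0 \<psi> \<Delta> (fst (snd e \<Delta> (\<sigma>, x)))"
        using k_eval[OF x] hcomp_c0(3)[OF \<psi> \<phi> fibre_Obj[OF x] ext_eval[OF e x]] by simp
      also have "\<dots> = snd (c0 (\<chi> \<star> \<psi>) \<Gamma> (fst ?i)) \<Delta> (\<sigma>, c1 \<chi> \<Delta> x)"
        using hcomp_c0_eval[OF \<chi> \<psi> \<Gamma> bi(2)] bi(3) bi(4)[OF x] x by simp
      finally show "snd (fst ?L) \<Delta> (\<sigma>, c1 \<chi> \<Delta> x) = snd (c0 (\<chi> \<star> \<psi>) \<Gamma> (fst ?i)) \<Delta> (\<sigma>, c1 \<chi> \<Delta> x)" .
    qed
    show ?thesis
    proof (rule ext_cell_eqI[OF \<chi>\<psi> ext_fst[OF i] ext_comp_iso_in[OF h' g' fA' \<Gamma> k] hcomp_c0(2)[OF \<chi>\<psi> \<phi> \<Gamma> i] fst])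
      show "fst ?R = c0 (\<chi> \<star> \<psi>) \<Gamma> (fst ?i)" by (rule hcomp_c0(3)[OF \<chi>\<psi> \<phi> \<Gamma> i])
      fix \<Delta> \<sigma> w assume w: "(\<sigma>, w) \<in> El (fibre (h \<cdot> g) \<Gamma> (fst ?i)) \<Delta>"
      note \<Delta> = fibre_Obj[OF w]
      obtain e' x d where ww: "w = (e', x, d)" by (cases w)
      have x: "(\<sigma>, x) \<in> El (fibre h \<Gamma> (fst e)) \<Delta>"
        and d: "(Ident C \<Delta>, d) \<in> El (fibre g \<Delta> (fst (snd e \<Delta> (\<sigma>, x)))) \<Delta>"
        using w ext_comp_fibre_iff[OF h g fA \<Gamma> e] by (simp_all add: ww)
      have "(e', x, d) \<in> El (Tot (h \<cdot> g)) \<Delta>" using w by (simp add: fibre_iff ww)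
      from hcomp_c1[OF \<chi> \<psi> \<Delta> this]
      have cw: "c1 (\<chi> \<star> \<psi>) \<Delta> w = (c0 (\<chi> \<star> \<psi>) \<Delta> e', c1 \<chi> \<Delta> x, c1 \<psi> \<Delta> d)" by (simp add: ww)
      have "snd ?L \<Delta> (\<sigma>, c1 (\<chi> \<star> \<psi>) \<Delta> w) = snd (snd ?k \<Delta> (\<sigma>, c1 \<chi> \<Delta> x)) \<Delta> (Ident C \<Delta>, c1 \<psi> \<Delta> d)"
        using fibre_push[OF \<chi>\<psi> ext_fst[OF i] w] ext_comp_eval[OF h' g' fA' \<Gamma> k] by (simp add: cw fst)
      also have "\<dots> = c0 \<phi> \<Delta> (snd (snd e \<Delta> (\<sigma>, x)) \<Delta> (Ident C \<Delta>, d))"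
        unfolding k_eval[OF x] by (rule hcomp_c0_eval[OF \<psi> \<phi> \<Delta> ext_eval[OF e x] d])
      also have "\<dots> = c0 \<phi> \<Delta> (snd ?i \<Delta> (\<sigma>, w))"
        using ext_comp_eval[OF h g fA \<Gamma> e] w by (simp add: ww)
      also have "\<dots> = snd ?R \<Delta> (\<sigma>, c1 (\<chi> \<star> \<psi>) \<Delta> w)" using hcomp_c0_eval[OF \<chi>\<psi> \<phi> \<Gamma> i w] by simp
      finally show "snd ?L \<Delta> (\<sigma>, c1 (\<chi> \<star> \<psi>) \<Delta> w) = snd ?R \<Delta> (\<sigma>, c1 (\<chi> \<star> \<psi>) \<Delta> w)" .
    qed
  qed
  show ?thesis
  proof (rule cell_eqI[OF ccell_ccomp[OF a' l] ccell_ccomp[OF r a]])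
    fix \<Gamma> e assume \<Gamma>: "\<Gamma> \<in> Obj C" and e: "e \<in> El (Base (h \<cdot> (g \<cdot> f))) \<Gamma>"
    then show "c0 (assoc h' g' f' \<odot> (\<chi> \<star> (\<psi> \<star> \<phi>))) \<Gamma> e = c0 (((\<chi> \<star> \<psi>) \<star> \<phi>) \<odot> assoc h g f) \<Gamma> e"
      using c0[OF \<Gamma>]
      by (simp add: ccomp_apply(1)[OF l \<Gamma>] ccomp_apply(1)[OF a \<Gamma>] assoc_simps pcomp_simps)
  next
    fix \<Gamma> y assume \<Gamma>: "\<Gamma> \<in> Obj C" and y: "y \<in> El (Tot (h \<cdot> (g \<cdot> f))) \<Gamma>"
    obtain e x e2 d b where yy: "y = (e, x, (e2, d, b))" by (cases y)
    note yi = y[unfolded yy]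
    have e: "e \<in> El (ext h (ext g (Base f))) \<Gamma>" and y2: "(e2, d, b) \<in> El (Tot (g \<cdot> f)) \<Gamma>"
      using yi by (auto simp: pcomp_assoc_iff[OF \<Gamma>])
    let ?i = "ext_comp_iso h g (Base f) \<Gamma> e"
    have cy: "c1 (\<chi> \<star> (\<psi> \<star> \<phi>)) \<Gamma> y =
        (c0 (\<chi> \<star> (\<psi> \<star> \<phi>)) \<Gamma> e, c1 \<chi> \<Gamma> x, (c0 (\<psi> \<star> \<phi>) \<Gamma> e2, c1 \<psi> \<Gamma> d, c1 \<phi> \<Gamma> b))"
      using hcomp_c1[OF \<chi> \<psi>\<phi> \<Gamma> yi] hcomp_c1[OF \<psi> \<phi> \<Gamma> y2] by (simp add: yy)
    have ay: "c1 (assoc h g f) \<Gamma> y = (?i, (fst ?i, x, d), b)" using assoc_c1[OF \<Gamma> yi] by (simp add: yy)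
    have ai: "(?i, (fst ?i, x, d), b) \<in> El (Tot ((h \<cdot> g) \<cdot> f)) \<Gamma>" using ccell_in(2)[OF a \<Gamma> y] ay by simp
    then have ai': "(fst ?i, x, d) \<in> El (Tot (h \<cdot> g)) \<Gamma>" by (simp add: pcomp_iff[of ?i])
    have "fst (c0 ((\<chi> \<star> \<psi>) \<star> \<phi>) \<Gamma> ?i) = c0 (\<chi> \<star> \<psi>) \<Gamma> (fst ?i)"
      by (rule hcomp_c0(3)[OF \<chi>\<psi> \<phi> \<Gamma> ext_comp_iso_in[OF h g fA \<Gamma> e]])
    then show "c1 (assoc h' g' f' \<odot> (\<chi> \<star> (\<psi> \<star> \<phi>))) \<Gamma> y = c1 (((\<chi> \<star> \<psi>) \<star> \<phi>) \<odot> assoc h g f) \<Gamma> y"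
      using c0[OF \<Gamma> e] ccell_in(2)[OF l \<Gamma> y] hcomp_c1[OF \<chi>\<psi> \<phi> \<Gamma> ai] hcomp_c1[OF \<chi> \<psi> \<Gamma> ai']
      by (simp add: ccomp_apply(2)[OF l \<Gamma> y] ccomp_apply(2)[OF a \<Gamma> y] cy ay assoc_c1[OF \<Gamma>])
  qed
qed

text \<open>First components agree by naturality of the composition isomorphism at the projection
  from \<open>ext g ?A\<close> to \<open>Base g\<close>. At every fibre point both sides are then
  the same threefold nested evaluation of \<open>e\<close> at identities.\<close>

lemma assoc_pentagon:
  assumes k: "polynomial k" and h: "polynomial h" and g: "polynomial g" and f: "polynomial f"
  shows "(assoc k h g \<star> cid f) \<odot> assoc k (h \<cdot> g) f \<odot> (cid k \<star> assoc h g f) =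
    assoc (k \<cdot> h) g f \<odot> assoc k h (g \<cdot> f)"
proof -
  let ?A = "Base f"
  note A = polynomialD(2)[OF f] and ic = ccell_cid[OF k] and fc = ccell_cid[OF f]
  have hg: "polynomial (h \<cdot> g)" and kh: "polynomial (k \<cdot> h)" and gf: "polynomial (g \<cdot> f)"
    by (simp_all add: polynomial_pcomp k h g f)
  note G = presheaf_ext[OF g A]
  note a1 = ccell_assoc[OF h g f] and a2 = ccell_assoc[OF k hg f] and a3 = ccell_assoc[OF k h g]
    and a4 = ccell_assoc[OF k h gf] and a5 = ccell_assoc[OF kh g f]
  note l1 = ccell_hcomp[OF ic a1] and l3 = ccell_hcomp[OF a3 fc]
  let ?l1 = "c0 (cid k \<star> assoc h g f)" and ?l3 = "c0 (assoc k h g \<star> cid f)"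
  let ?r1 = "ext_comp_iso k h (ext g ?A)" and ?r2 = "ext_comp_iso (k \<cdot> h) g ?A"
    and ?l2 = "ext_comp_iso k (h \<cdot> g) ?A"
  have l1_eq: "?l1 \<Gamma> e = ext_map k (ext h (ext g ?A)) (ext_comp_iso h g ?A) \<Gamma> e"
    if "\<Gamma> \<in> Obj C" "e \<in> El (ext k (ext h (ext g ?A))) \<Gamma>" for \<Gamma> e
    using hcomp_cid_c0[OF k a1] that by (simp add: pcomp_simps assoc_simps)
  have l1_in: "?l1 \<Gamma> e \<in> El (ext k (ext (h \<cdot> g) ?A)) \<Gamma>"
    if "\<Gamma> \<in> Obj C" "e \<in> El (ext k (ext h (ext g ?A))) \<Gamma>" for \<Gamma> e
    unfolding l1_eq[OF that] by (rule ext_map_in[OF k nat_trans_ext_comp_iso[OF h g A] that])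
  have fst_eq: "fst (?r2 \<Gamma> (?r1 \<Gamma> e)) = ext_comp_iso k h (Base g) \<Gamma> (fst (?l2 \<Gamma> (?l1 \<Gamma> e)))"
    if \<Gamma>: "\<Gamma> \<in> Obj C" and e: "e \<in> El (ext k (ext h (ext g ?A))) \<Gamma>" for \<Gamma> e
  proof -
    let ?\<pi> = "on (ext g ?A) (\<lambda>_. fst)" and ?\<pi>' = "on (ext (h \<cdot> g) ?A) (\<lambda>_. fst)"
    note \<pi> = nat_trans_ext_fst[OF g A]
    \<comment> \<open>Taking first components turns the outer isomorphism into P_k of a projection,
      and that projection after the inner isomorphism is P_h of \<open>?\<pi>\<close>. In this form
      naturality of the composition isomorphism for \<open>k\<close> and \<open>h\<close>
      applies.\<close>
    have "fst (?l2 \<Gamma> (?l1 \<Gamma> e)) = ext_map k (ext (h \<cdot> g) ?A) ?\<pi>' \<Gamma> (?l1 \<Gamma> e)"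
      by (rule ext_comp_base(1)[OF k hg A \<Gamma> l1_in[OF \<Gamma> e]])
    also have "\<dots> = ext_map k (ext h (ext g ?A)) (ncomp (ext h (ext g ?A)) ?\<pi>' (ext_comp_iso h g ?A)) \<Gamma> e"
      unfolding l1_eq[OF \<Gamma> e]
      by (rule ext_map_ncomp[OF k nat_trans_ext_comp_iso[OF h g A] nat_trans_ext_fst[OF hg A] \<Gamma> e])
    also have "\<dots> = ext_map k (ext h (ext g ?A)) (ext_map h (ext g ?A) ?\<pi>) \<Gamma> e"
      by (rule ext_map_cong[OF \<Gamma> e])
         (simp add: ncomp_apply on_apply ext_comp_iso_in[OF h g A] ext_comp_base(1)[OF h g A])
    finally have "fst (?l2 \<Gamma> (?l1 \<Gamma> e)) = ext_map k (ext h (ext g ?A)) (ext_map h (ext g ?A) ?\<pi>) \<Gamma> e" .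
    then have "ext_comp_iso k h (Base g) \<Gamma> (fst (?l2 \<Gamma> (?l1 \<Gamma> e))) =
        ext_map (k \<cdot> h) (ext g ?A) ?\<pi> \<Gamma> (?r1 \<Gamma> e)"
      using ext_comp_iso_natural[OF k h G polynomialD(2)[OF g] \<pi> \<Gamma> e] by simp
    then show ?thesis using ext_comp_base(1)[OF kh g A \<Gamma> ext_comp_iso_in[OF k h G \<Gamma> e]] by simp
  qed
  have c0: "?l3 \<Gamma> (?l2 \<Gamma> (?l1 \<Gamma> e)) = ?r2 \<Gamma> (?r1 \<Gamma> e)"
    if \<Gamma>: "\<Gamma> \<in> Obj C" and e: "e \<in> El (ext k (ext h (ext g ?A))) \<Gamma>" for \<Gamma> e
  proof -
    note e1 = l1_in[OF \<Gamma> e]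
    have e2: "?l2 \<Gamma> (?l1 \<Gamma> e) \<in> El (ext (k \<cdot> (h \<cdot> g)) ?A) \<Gamma>" by (rule ext_comp_iso_in[OF k hg A \<Gamma> e1])
    have r1: "?r1 \<Gamma> e \<in> El (ext (k \<cdot> h) (ext g ?A)) \<Gamma>" by (rule ext_comp_iso_in[OF k h G \<Gamma> e])
    have r2: "?r2 \<Gamma> (?r1 \<Gamma> e) \<in> El (ext ((k \<cdot> h) \<cdot> g) ?A) \<Gamma>" by (rule ext_comp_iso_in[OF kh g A \<Gamma> r1])
    note l3s = hcomp_c0[OF a3 fc \<Gamma> e2]
    show ?thesis
    proof (rule ext_cell_eqI[OF a3 ext_fst[OF e2] l3s(2) r2 l3s(3)])
      show fr: "fst (?r2 \<Gamma> (?r1 \<Gamma> e)) = c0 (assoc k h g) \<Gamma> (fst (?l2 \<Gamma> (?l1 \<Gamma> e)))"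
        using fst_eq[OF \<Gamma> e] by (simp add: assoc_simps)
      fix \<Delta> \<sigma> w assume w: "(\<sigma>, w) \<in> El (fibre (k \<cdot> (h \<cdot> g)) \<Gamma> (fst (?l2 \<Gamma> (?l1 \<Gamma> e)))) \<Delta>"
      note \<Delta> = fibre_Obj[OF w]
      obtain E y E2 x d where ww: "w = (E, y, (E2, x, d))" by (cases w)
      have f1: "fst (?l1 \<Gamma> e) = fst e" unfolding l1_eq[OF \<Gamma> e] by (rule ext_map_fst[OF \<Gamma> e])
      have y: "(\<sigma>, y) \<in> El (fibre k \<Gamma> (fst e)) \<Delta>"
        and z: "(Ident C \<Delta>, (E2, x, d)) \<in> El (fibre (h \<cdot> g) \<Delta> (fst (snd (?l1 \<Gamma> e) \<Delta> (\<sigma>, y)))) \<Delta>"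
        using w ext_comp_fibre_iff[OF k hg A \<Gamma> e1] by (simp_all add: ww f1)
      have s1: "snd (?l1 \<Gamma> e) \<Delta> (\<sigma>, y) = ext_comp_iso h g ?A \<Delta> (snd e \<Delta> (\<sigma>, y))"
        unfolding l1_eq[OF \<Gamma> e] by (rule ext_map_eval[OF \<Gamma> e y])
      note ey = ext_eval[OF e y]
      have wi: "w \<in> El (Tot (k \<cdot> (h \<cdot> g))) \<Delta>" using w by (simp add: fibre_iff)
      have cw: "c1 (assoc k h g) \<Delta> w =
          (ext_comp_iso k h (Base g) \<Delta> E, (fst (ext_comp_iso k h (Base g) \<Delta> E), y, x), d)"
        using assoc_c1[OF \<Delta>] wi by (simp add: ww)
      have "snd (?l2 \<Gamma> (?l1 \<Gamma> e)) \<Delta> (\<sigma>, w) \<in> El ?A \<Delta>" by (rule ext_eval[OF e2 w])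
      then have "snd (?l3 \<Gamma> (?l2 \<Gamma> (?l1 \<Gamma> e))) \<Delta> (\<sigma>, c1 (assoc k h g) \<Delta> w) = snd (?l2 \<Gamma> (?l1 \<Gamma> e)) \<Delta> (\<sigma>, w)"
        using hcomp_c0_eval[OF a3 fc \<Gamma> e2 w] \<Delta> by (simp add: cid_def nid_apply)
      also have "\<dots> = snd (ext_comp_iso h g ?A \<Delta> (snd e \<Delta> (\<sigma>, y))) \<Delta> (Ident C \<Delta>, (E2, x, d))"
        using ext_comp_eval[OF k hg A \<Gamma> e1] w by (simp add: ww s1)
      also have "\<dots> = snd (snd (snd e \<Delta> (\<sigma>, y)) \<Delta> (Ident C \<Delta>, x)) \<Delta> (Ident C \<Delta>, d)"
        by (rule ext_comp_eval[OF h g A \<Delta> ey z[unfolded s1]])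
      finally have L: "snd (?l3 \<Gamma> (?l2 \<Gamma> (?l1 \<Gamma> e))) \<Delta> (\<sigma>, c1 (assoc k h g) \<Delta> w) =
          snd (snd (snd e \<Delta> (\<sigma>, y)) \<Delta> (Ident C \<Delta>, x)) \<Delta> (Ident C \<Delta>, d)" .
      let ?E = "ext_comp_iso k h (Base g) \<Delta> E"
      \<comment> \<open>Pushing \<open>w\<close> along the associator produces the point at which
        the right-hand composite is evaluated; \<open>fr\<close> identifies the two fibres.\<close>
      have wr: "(\<sigma>, (?E, (fst ?E, y, x), d)) \<in> El (fibre ((k \<cdot> h) \<cdot> g) \<Gamma> (fst (?r2 \<Gamma> (?r1 \<Gamma> e)))) \<Delta>"
        using fibre_push[OF a3 ext_fst[OF e2] w] by (simp add: fr cw)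
      have yx: "(\<sigma>, (fst ?E, y, x)) \<in> El (fibre (k \<cdot> h) \<Gamma> (fst (?r1 \<Gamma> e))) \<Delta>"
        by (rule ext_comp_fibre_iff[OF kh g A \<Gamma> r1, THEN iffD1, OF wr, THEN conjunct1])
      have "snd (?r2 \<Gamma> (?r1 \<Gamma> e)) \<Delta> (\<sigma>, c1 (assoc k h g) \<Delta> w) =
          snd (snd (?r1 \<Gamma> e) \<Delta> (\<sigma>, (fst ?E, y, x))) \<Delta> (Ident C \<Delta>, d)"
        unfolding cw by (rule ext_comp_eval[OF kh g A \<Gamma> r1 wr])
      also have "snd (?r1 \<Gamma> e) \<Delta> (\<sigma>, (fst ?E, y, x)) = snd (snd e \<Delta> (\<sigma>, y)) \<Delta> (Ident C \<Delta>, x)"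
        by (rule ext_comp_eval[OF k h G \<Gamma> e yx])
      finally show "snd (?l3 \<Gamma> (?l2 \<Gamma> (?l1 \<Gamma> e))) \<Delta> (\<sigma>, c1 (assoc k h g) \<Delta> w) =
          snd (?r2 \<Gamma> (?r1 \<Gamma> e)) \<Delta> (\<sigma>, c1 (assoc k h g) \<Delta> w)" using L by simp
    qed
  qed
  note l21 = ccell_ccomp[OF a2 l1]
  show ?thesis
  proof (rule cell_eqI[OF ccell_ccomp[OF l3 l21] ccell_ccomp[OF a5 a4]])
    fix \<Gamma> e assume \<Gamma>: "\<Gamma> \<in> Obj C" and e: "e \<in> El (Base (k \<cdot> (h \<cdot> (g \<cdot> f)))) \<Gamma>"
    then show "c0 ((assoc k h g \<star> cid f) \<odot> assoc k (h \<cdot> g) f \<odot> (cid k \<star> assoc h g f)) \<Gamma> e =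
        c0 (assoc (k \<cdot> h) g f \<odot> assoc k h (g \<cdot> f)) \<Gamma> e"
      using c0[OF \<Gamma>]
      by (simp add: ccomp_apply(1)[OF l21 \<Gamma>] ccomp_apply(1)[OF l1 \<Gamma>] ccomp_apply(1)[OF a4 \<Gamma>]
        assoc_simps pcomp_simps)
  next
    fix \<Gamma> v assume \<Gamma>: "\<Gamma> \<in> Obj C" and v: "v \<in> El (Tot (k \<cdot> (h \<cdot> (g \<cdot> f)))) \<Gamma>"
    obtain e y e2 x e3 d b where vv: "v = (e, y, (e2, x, (e3, d, b)))" by (cases v)
    note vi = v[unfolded vv]
    have e: "e \<in> El (ext k (ext h (ext g ?A))) \<Gamma>" and v2: "(e2, x, (e3, d, b)) \<in> El (Tot (h \<cdot> (g \<cdot> f))) \<Gamma>"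
      and y: "y \<in> El (Tot k) \<Gamma>"
      using vi by (auto simp: pcomp_assoc_iff[OF \<Gamma>] pcomp_simps)
    let ?i = "ext_comp_iso h g ?A \<Gamma> e2"
    have 1: "c1 (cid k \<star> assoc h g f) \<Gamma> v = (?l1 \<Gamma> e, y, (?i, (fst ?i, x, d), b))"
      using hcomp_c1[OF ic a1 \<Gamma> vi] y \<Gamma> assoc_c1[OF \<Gamma> v2] by (simp add: vv cid_def nid_apply)
    let ?e2 = "?l2 \<Gamma> (?l1 \<Gamma> e)"
    have i1: "(?l1 \<Gamma> e, y, (?i, (fst ?i, x, d), b)) \<in> El (Tot (k \<cdot> ((h \<cdot> g) \<cdot> f))) \<Gamma>"
      using ccell_in(2)[OF l1 \<Gamma> v] 1 by simp
    have 2: "c1 (assoc k (h \<cdot> g) f) \<Gamma> (?l1 \<Gamma> e, y, (?i, (fst ?i, x, d), b)) =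
        (?e2, (fst ?e2, y, (fst ?i, x, d)), b)" by (rule assoc_c1[OF \<Gamma> i1])
    have i2: "(?e2, (fst ?e2, y, (fst ?i, x, d)), b) \<in> El (Tot ((k \<cdot> (h \<cdot> g)) \<cdot> f)) \<Gamma>"
      using ccell_in(2)[OF a2 \<Gamma> i1] 2 by simp
    then have i2': "(fst ?e2, y, (fst ?i, x, d)) \<in> El (Tot (k \<cdot> (h \<cdot> g))) \<Gamma>" and b: "b \<in> El (Tot f) \<Gamma>"
      by (simp_all add: pcomp_iff[of ?e2])
    let ?j = "ext_comp_iso k h (Base g) \<Gamma> (fst ?e2)"
    have 3: "c1 (assoc k h g \<star> cid f) \<Gamma> (?e2, (fst ?e2, y, (fst ?i, x, d)), b) =
        (?l3 \<Gamma> ?e2, (?j, (fst ?j, y, x), d), b)"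
      using hcomp_c1[OF a3 fc \<Gamma> i2] assoc_c1[OF \<Gamma> i2'] b \<Gamma> by (simp add: cid_def nid_apply)
    let ?s = "?r1 \<Gamma> e"
    have 4: "c1 (assoc k h (g \<cdot> f)) \<Gamma> v = (?s, (fst ?s, y, x), (e3, d, b))"
      using assoc_c1[OF \<Gamma> vi] by (simp add: vv pcomp_simps)
    have 5: "c1 (assoc (k \<cdot> h) g f) \<Gamma> (?s, (fst ?s, y, x), (e3, d, b)) =
        (?r2 \<Gamma> ?s, (fst (?r2 \<Gamma> ?s), (fst ?s, y, x), d), b)"
      using ccell_in(2)[OF a4 \<Gamma> v] by (intro assoc_c1[OF \<Gamma>]) (simp add: 4)
    \<comment> \<open>The results of both routes store base components at two depths. The outer ones
      agree by \<open>fst_eq\<close>, and one further projection of that equation settles the inner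
      ones.\<close>
    have 6: "fst ?j = fst ?s"
      using fst_eq[OF \<Gamma> e] ext_comp_base(3)[OF kh g A \<Gamma> ext_comp_iso_in[OF k h G \<Gamma> e]] by simp
    show "c1 ((assoc k h g \<star> cid f) \<odot> assoc k (h \<cdot> g) f \<odot> (cid k \<star> assoc h g f)) \<Gamma> v =
        c1 (assoc (k \<cdot> h) g f \<odot> assoc k h (g \<cdot> f)) \<Gamma> v"
      using 1 2 3 4 5 6 c0[OF \<Gamma> e] fst_eq[OF \<Gamma> e]
      by (simp add: ccomp_apply(2)[OF l21 \<Gamma> v] ccomp_apply(2)[OF l1 \<Gamma> v] ccomp_apply(2)[OF a4 \<Gamma> v])
  qed
qed

section \<open>The unit cells and the triangle identity\<close>

lemma lunit_simps: "Dm (lunit f) = f" "Cd (lunit f) = pid \<cdot> f" "c0 (lunit f) = ext_unit_iso (Base f)"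
  by (simp_all add: lunit_def)

lemma lunit_c1: "\<Gamma> \<in> Obj C \<Longrightarrow> b \<in> El (Tot f) \<Gamma> \<Longrightarrow>
    c1 (lunit f) \<Gamma> b = (ext_unit_iso (Base f) \<Gamma> (Map f \<Gamma> b), (), b)"
  by (simp add: lunit_def on_apply)

lemma ccell_lunit:
  assumes f: "polynomial f"
  shows "ccell f (pid \<cdot> f) (lunit f)"
proof (rule ccellI)
  note ps = polynomialD[OF f]
  have u: "() \<in> El (Tot pid) \<Gamma>" "fst e = Map pid \<Gamma> ()" for \<Gamma> and e :: "unit \<times> 'z"
    by (simp_all add: pid_def one_def)
  \<comment> \<open>The requirement on \<open>b\<close> evaluates the Yoneda map of \<open>a\<close>
    at the identity, which returns \<open>a\<close>.\<close>
  have c1_iff: "(ext_unit_iso (Base f) \<Gamma> a, (), b) \<in> El (Tot (pid \<cdot> f)) \<Gamma> \<longleftrightarrow> b \<in> El (Tot f) \<Gamma> \<and> Map f \<Gamma> b = a"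
    if \<Gamma>: "\<Gamma> \<in> Obj C" and a: "a \<in> El (Base f) \<Gamma>" for \<Gamma> a b
    using ext_unit_iso_in[OF ps(2) \<Gamma> a] ext_unit_iso_inverse(1)[OF ps(2) \<Gamma> a] u
    by (auto simp: pcomp_iff)
  have Map_in: "Map f \<Gamma> b \<in> El (Base f) \<Gamma>" if "\<Gamma> \<in> Obj C" "b \<in> El (Tot f) \<Gamma>" for \<Gamma> b
    using nat_trans_in[OF ps(3)] that by blast
  show "polynomial f" by (rule f)
  show "polynomial (pid \<cdot> f)" by (rule polynomial_pcomp[OF polynomial_pid f])
  show nt0: "nat_trans (Base f) (Base (pid \<cdot> f)) (c0 (lunit f))"
    using nat_trans_ext_unit_iso[OF ps(2)] by (simp add: lunit_simps pcomp_simps)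
  have "nat_trans (Tot f) (Tot (pid \<cdot> f)) (on (Tot f) (c1 (lunit f)))"
  proof (rule nat_trans_onI[OF ps(1)])
    fix \<Gamma> b assume "\<Gamma> \<in> Obj C" "b \<in> El (Tot f) \<Gamma>"
    then show "c1 (lunit f) \<Gamma> b \<in> El (Tot (pid \<cdot> f)) \<Gamma>" by (simp add: lunit_c1 c1_iff Map_in)
  next
    fix \<Delta> \<Gamma> \<sigma> b assume s: "\<sigma> \<in> Hom C \<Delta> \<Gamma>" and b: "b \<in> El (Tot f) \<Gamma>"
    note o = Hom_Obj[OF s] and fs = polynomial_in[OF f s]
    show "c1 (lunit f) \<Delta> (Res (Tot f) \<sigma> b) = Res (Tot (pid \<cdot> f)) \<sigma> (c1 (lunit f) \<Gamma> b)"
      using o b fs nat_trans_natural[OF nt0 s]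
      by (simp add: lunit_c1 pcomp_simps lunit_simps)
  qed
  moreover have "on (Tot f) (c1 (lunit f)) = c1 (lunit f)" by (auto simp: lunit_def on_def fun_eq_iff)
  ultimately show "nat_trans (Tot f) (Tot (pid \<cdot> f)) (c1 (lunit f))" by simp
  fix \<Gamma> assume \<Gamma>: "\<Gamma> \<in> Obj C"
  show "Map (pid \<cdot> f) \<Gamma> (c1 (lunit f) \<Gamma> b) = c0 (lunit f) \<Gamma> (Map f \<Gamma> b)" if "b \<in> El (Tot f) \<Gamma>" for b
    using that \<Gamma> Map_in by (simp add: lunit_c1 lunit_simps pcomp_Map c1_iff)
  fix a y assume a: "a \<in> El (Base f) \<Gamma>" and y: "y \<in> El (Tot (pid \<cdot> f)) \<Gamma>"
    and eq: "Map (pid \<cdot> f) \<Gamma> y = c0 (lunit f) \<Gamma> a"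
  obtain e b where yy: "y = (e, (), b)" by (cases y) auto
  have e: "e = ext_unit_iso (Base f) \<Gamma> a" using eq y \<Gamma> by (simp add: yy pcomp_Map lunit_simps)
  have b: "b \<in> El (Tot f) \<Gamma>" "Map f \<Gamma> b = a" using y c1_iff[OF \<Gamma> a] by (simp_all add: yy e)
  show "\<exists>!b. b \<in> El (Tot f) \<Gamma> \<and> Map f \<Gamma> b = a \<and> c1 (lunit f) \<Gamma> b = y"
    by (rule ex1I[of _ b]) (use b \<Gamma> in \<open>auto simp: lunit_c1 yy e\<close>)
qed (simp_all add: lunit_simps)

lemma runit_simps: "Dm (runit f) = f" "Cd (runit f) = f \<cdot> pid"
  by (simp_all add: runit_def Let_def)

lemma runit_c1: "\<Gamma> \<in> Obj C \<Longrightarrow> b \<in> El (Tot f) \<Gamma> \<Longrightarrow>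
    c1 (runit f) \<Gamma> b = (c0 (runit f) \<Gamma> (Map f \<Gamma> b), b, ())"
  by (simp add: runit_def Let_def on_apply)

lemma runit_c0:
  assumes f: "polynomial f" and \<Gamma>: "\<Gamma> \<in> Obj C" and a: "a \<in> El (Base f) \<Gamma>"
  shows "c0 (runit f) \<Gamma> a \<in> El (ext f (Base pid)) \<Gamma>" and "fst (c0 (runit f) \<Gamma> a) = a"
proof -
  have r: "c0 (runit f) \<Gamma> a = (a, on (fibre f \<Gamma> a) (\<lambda>_ _. ()))" using \<Gamma> a by (simp add: runit_def Let_def on_apply)
  then show "fst (c0 (runit f) \<Gamma> a) = a" by simp
  have "nat_trans (fibre f \<Gamma> a) (Base pid) (on (fibre f \<Gamma> a) (\<lambda>_ _. ()))"
    by (rule nat_trans_fibreI[OF f \<Gamma> a]) (simp_all add: pid_def one_def)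
  then show "c0 (runit f) \<Gamma> a \<in> El (ext f (Base pid)) \<Gamma>" using a r by (simp add: ext_iff)
qed

text \<open>Functions into the one-element presheaf always agree, so only the first component is
  left to compare.\<close>

lemma ext_pid_eqI:
  "e \<in> El (ext f (Base pid)) \<Gamma> \<Longrightarrow> e' \<in> El (ext f (Base pid)) \<Gamma> \<Longrightarrow> fst e = fst e' \<Longrightarrow> e = e'"
  by (rule ext_eqI) auto

lemma ccell_runit:
  assumes f: "polynomial f"
  shows "ccell f (f \<cdot> pid) (runit f)"
proof (rule ccellI)
  note ps = polynomialD[OF f]
  have P1: "presheaf (Base pid)" by (simp add: pid_def presheaf_one)
  note PE = presheaf_ext[OF f P1]
  have c1_iff: "(e, b, ()) \<in> El (Tot (f \<cdot> pid)) \<Gamma> \<longleftrightarrow>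
      e \<in> El (ext f (Base pid)) \<Gamma> \<and> b \<in> El (Tot f) \<Gamma> \<and> Map f \<Gamma> b = fst e" for \<Gamma> e b
    by (simp add: pcomp_iff) (simp add: pid_def one_def)
  have Map_in: "Map f \<Gamma> b \<in> El (Base f) \<Gamma>" if "\<Gamma> \<in> Obj C" "b \<in> El (Tot f) \<Gamma>" for \<Gamma> b
    using nat_trans_in[OF ps(3)] that by blast
  note rc = runit_c0[OF f]
  show "polynomial f" by (rule f)
  show "polynomial (f \<cdot> pid)" by (rule polynomial_pcomp[OF f polynomial_pid])
  have c0_nat: "c0 (runit f) \<Delta> (Res (Base f) \<sigma> a) = Res (ext f (Base pid)) \<sigma> (c0 (runit f) \<Gamma> a)"
    if s: "\<sigma> \<in> Hom C \<Delta> \<Gamma>" and a: "a \<in> El (Base f) \<Gamma>" for \<Delta> \<Gamma> \<sigma> a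
    using Hom_Obj[OF s] rc[OF _ a] rc[OF _ polynomial_in(3)[OF f s a]]
    by (intro ext_pid_eqI) (auto simp: ext_Res_fst intro: presheaf_ResD[OF PE s])
  have "nat_trans (Base f) (Base (f \<cdot> pid)) (on (Base f) (c0 (runit f)))"
    by (rule nat_trans_onI[OF ps(2)]) (simp_all add: pcomp_simps rc c0_nat)
  moreover have "on (Base f) (c0 (runit f)) = c0 (runit f)"
    by (auto simp: runit_def Let_def on_def fun_eq_iff)
  ultimately show "nat_trans (Base f) (Base (f \<cdot> pid)) (c0 (runit f))" by simp
  have "nat_trans (Tot f) (Tot (f \<cdot> pid)) (on (Tot f) (c1 (runit f)))"
  proof (rule nat_trans_onI[OF ps(1)])
    fix \<Gamma> b assume "\<Gamma> \<in> Obj C" "b \<in> El (Tot f) \<Gamma>"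
    then show "c1 (runit f) \<Gamma> b \<in> El (Tot (f \<cdot> pid)) \<Gamma>"
      using rc[OF _ Map_in] by (simp add: runit_c1 c1_iff)
  next
    fix \<Delta> \<Gamma> \<sigma> b assume s: "\<sigma> \<in> Hom C \<Delta> \<Gamma>" and b: "b \<in> El (Tot f) \<Gamma>"
    have o: "\<Delta> \<in> Obj C" "\<Gamma> \<in> Obj C" using Hom_Obj[OF s] by auto
    note fs = polynomial_in[OF f s]
    show "c1 (runit f) \<Delta> (Res (Tot f) \<sigma> b) = Res (Tot (f \<cdot> pid)) \<sigma> (c1 (runit f) \<Gamma> b)"
      using b o fs c0_nat[OF s] by (simp add: runit_c1 pcomp_simps)
  qed
  moreover have "on (Tot f) (c1 (runit f)) = c1 (runit f)" by (auto simp: runit_def Let_def on_def fun_eq_iff)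
  ultimately show "nat_trans (Tot f) (Tot (f \<cdot> pid)) (c1 (runit f))" by simp
  fix \<Gamma> assume \<Gamma>: "\<Gamma> \<in> Obj C"
  have c1: "c1 (runit f) \<Gamma> b = (c0 (runit f) \<Gamma> (Map f \<Gamma> b), b, ())" if "b \<in> El (Tot f) \<Gamma>" for b
    using runit_c1[OF \<Gamma> that] .
  show "Map (f \<cdot> pid) \<Gamma> (c1 (runit f) \<Gamma> b) = c0 (runit f) \<Gamma> (Map f \<Gamma> b)" if b: "b \<in> El (Tot f) \<Gamma>" for b
    using c1[OF b] b pcomp_Map[OF \<Gamma>, of _ b "()" f pid] rc[OF \<Gamma> Map_in[OF \<Gamma> b]] by (simp add: c1_iff)
  fix a y assume a: "a \<in> El (Base f) \<Gamma>" and y: "y \<in> El (Tot (f \<cdot> pid)) \<Gamma>"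
    and eq: "Map (f \<cdot> pid) \<Gamma> y = c0 (runit f) \<Gamma> a"
  obtain e b where yy: "y = (e, b, ())" by (cases y) auto
  have e: "e = c0 (runit f) \<Gamma> a" using eq y \<Gamma> by (simp add: yy pcomp_Map)
  have b: "b \<in> El (Tot f) \<Gamma>" "Map f \<Gamma> b = a" using y rc(2)[OF \<Gamma> a] by (simp_all add: yy e c1_iff)
  show "\<exists>!b. b \<in> El (Tot f) \<Gamma> \<and> Map f \<Gamma> b = a \<and> c1 (runit f) \<Gamma> b = y"
    by (rule ex1I[of _ b]) (use b c1 in \<open>auto simp: yy e\<close>)
qed (simp_all add: runit_simps)

text \<open>First components are functions into the terminal presheaf and agree at once; the
  functions over them agree because a Yoneda map evaluated at the identity returns the original
  value of \<open>e\<close>.\<close>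

lemma assoc_triangle:
  assumes g: "polynomial g" and f: "polynomial f"
  shows "assoc g pid f \<odot> (cid g \<star> lunit f) = runit g \<star> cid f"
proof -
  let ?A = "Base f"
  note A = polynomialD(2)[OF f] and i = polynomial_pid
  note gc = ccell_cid[OF g] and fc = ccell_cid[OF f] and lu = ccell_lunit[OF f] and ru = ccell_runit[OF g]
  note l = ccell_hcomp[OF gc lu] and r = ccell_hcomp[OF ru fc] and a = ccell_assoc[OF g i f]
  let ?l = "c0 (cid g \<star> lunit f)" and ?r = "c0 (runit g \<star> cid f)" and ?i = "ext_comp_iso g pid ?A"
  have l_eq: "?l \<Gamma> e = ext_map g ?A (ext_unit_iso ?A) \<Gamma> e"
    if "\<Gamma> \<in> Obj C" "e \<in> El (ext g ?A) \<Gamma>" for \<Gamma> e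
    using hcomp_cid_c0[OF g lu that] by (simp add: lunit_simps)
  have l_in: "?l \<Gamma> e \<in> El (ext g (ext pid ?A)) \<Gamma>" if "\<Gamma> \<in> Obj C" "e \<in> El (ext g ?A) \<Gamma>" for \<Gamma> e
    unfolding l_eq[OF that] by (rule ext_map_in[OF g nat_trans_ext_unit_iso[OF A] that])
  have fst_eq: "fst (?i \<Gamma> (?l \<Gamma> e)) = c0 (runit g) \<Gamma> (fst e)"
    if \<Gamma>: "\<Gamma> \<in> Obj C" and e: "e \<in> El (ext g ?A) \<Gamma>" for \<Gamma> e
    using ext_comp_base[OF g i A \<Gamma> l_in[OF \<Gamma> e]] runit_c0[OF g \<Gamma> ext_fst[OF e]]
    by (intro ext_pid_eqI) (simp_all add: l_eq[OF \<Gamma> e] ext_map_fst[OF \<Gamma> e])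
  have c0: "?i \<Gamma> (?l \<Gamma> e) = ?r \<Gamma> e" if \<Gamma>: "\<Gamma> \<in> Obj C" and e: "e \<in> El (ext g ?A) \<Gamma>" for \<Gamma> e
  proof (rule ext_cell_eqI[OF ru ext_fst[OF e] ext_comp_iso_in[OF g i A \<Gamma> l_in[OF \<Gamma> e]]
        hcomp_c0(2)[OF ru fc \<Gamma> e] fst_eq[OF \<Gamma> e] hcomp_c0(3)[OF ru fc \<Gamma> e]])
    fix \<Delta> \<sigma> d assume d: "(\<sigma>, d) \<in> El (fibre g \<Gamma> (fst e)) \<Delta>"
    note \<Delta> = fibre_Obj[OF d] and ed = ext_eval[OF e d] and li = l_in[OF \<Gamma> e]
    have di: "d \<in> El (Tot g) \<Delta>" "Map g \<Delta> d \<in> El (Base g) \<Delta>"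
      using d nat_trans_in[OF polynomialD(3)[OF g] \<Delta>, of d] by (simp_all add: fibre_iff)
    have cd: "c1 (runit g) \<Delta> d = (c0 (runit g) \<Delta> (Map g \<Delta> d), d, ())" by (rule runit_c1[OF \<Delta> di(1)])
    have "snd (?i \<Gamma> (?l \<Gamma> e)) \<Delta> (\<sigma>, c1 (runit g) \<Delta> d) = snd (snd (?l \<Gamma> e) \<Delta> (\<sigma>, d)) \<Delta> (Ident C \<Delta>, ())"
      using fibre_push[OF ru ext_fst[OF e] d] ext_comp_eval[OF g i A \<Gamma> li] by (simp add: cd fst_eq[OF \<Gamma> e])
    also have "\<dots> = snd e \<Delta> (\<sigma>, d)"
      using ext_unit_iso_inverse(1)[OF A \<Delta> ed] by (simp add: l_eq[OF \<Gamma> e] ext_map_eval[OF \<Gamma> e d])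
    also have "\<dots> = snd (?r \<Gamma> e) \<Delta> (\<sigma>, c1 (runit g) \<Delta> d)"
      using hcomp_c0_eval[OF ru fc \<Gamma> e d] ed \<Delta> by (simp add: cid_def nid_apply)
    finally show "snd (?i \<Gamma> (?l \<Gamma> e)) \<Delta> (\<sigma>, c1 (runit g) \<Delta> d) = snd (?r \<Gamma> e) \<Delta> (\<sigma>, c1 (runit g) \<Delta> d)" .
  qed
  show ?thesis
  proof (rule cell_eqI[OF ccell_ccomp[OF a l] r])
    fix \<Gamma> e assume \<Gamma>: "\<Gamma> \<in> Obj C" and e: "e \<in> El (Base (g \<cdot> f)) \<Gamma>"
    then show "c0 (assoc g pid f \<odot> (cid g \<star> lunit f)) \<Gamma> e = c0 (runit g \<star> cid f) \<Gamma> e"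
      using c0[OF \<Gamma>] by (simp add: ccomp_apply(1)[OF l \<Gamma>] assoc_simps pcomp_simps)
  next
    fix \<Gamma> x assume \<Gamma>: "\<Gamma> \<in> Obj C" and x: "x \<in> El (Tot (g \<cdot> f)) \<Gamma>"
    obtain e d b where xx: "x = (e, d, b)" by (cases x)
    note xi = x[unfolded xx]
    have e: "e \<in> El (ext g ?A) \<Gamma>" and d: "d \<in> El (Tot g) \<Gamma>" "Map g \<Gamma> d = fst e" and b: "b \<in> El (Tot f) \<Gamma>"
      using xi by (simp_all add: pcomp_iff)
    have 1: "c1 (cid g \<star> lunit f) \<Gamma> x = (?l \<Gamma> e, d, (ext_unit_iso ?A \<Gamma> (Map f \<Gamma> b), (), b))"
      using hcomp_c1[OF gc lu \<Gamma> xi] d b \<Gamma> by (simp add: xx lunit_c1 cid_def nid_apply)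
    have 2: "c1 (runit g \<star> cid f) \<Gamma> x = (?r \<Gamma> e, (c0 (runit g) \<Gamma> (fst e), d, ()), b)"
      using hcomp_c1[OF ru fc \<Gamma> xi] runit_c1[OF \<Gamma> d(1)] d b \<Gamma>
      by (simp add: xx cid_def nid_apply)
    show "c1 (assoc g pid f \<odot> (cid g \<star> lunit f)) \<Gamma> x = c1 (runit g \<star> cid f) \<Gamma> x"
      using ccell_in(2)[OF l \<Gamma> x] c0[OF \<Gamma> e] fst_eq[OF \<Gamma> e]
      by (simp add: ccomp_apply(2)[OF l \<Gamma> x] 1 2 assoc_c1[OF \<Gamma>])
  qed
qed

section \<open>The calculus of cartesian cells\<close>

lemma cell_boundary:
  "Dm (\<psi> \<odot> \<phi>) = Dm \<phi>" "Cd (\<psi> \<odot> \<phi>) = Cd \<psi>" "Dm (cid f) = f" "Cd (cid f) = f"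
  "Dm (lift_cell p \<phi>) = ext_poly p (Dm \<phi>)" "Cd (lift_cell p \<phi>) = ext_poly p (Cd \<phi>)"
  "Dm (lift_unit \<eta> f) = f" "Cd (lift_unit \<eta> f) = ext_poly (Cd \<eta>) f"
  "Dm (lift_mult p \<mu> f) = ext_poly p (ext_poly p f)" "Cd (lift_mult p \<mu> f) = ext_poly p f"
  by (simp_all add: ccomp_def cid_def lift_cell_def lift_unit_def lift_mult_def)

lemmas boundary = cell_boundary hcomp_boundary assoc_simps(1,2) lunit_simps(1,2) runit_simps

text \<open>From here on boundaries are computed instead of being passed around as in \<open>ccell f g \<phi>\<close>: the facts below
  have no variables that occur in the premises only, so that the simplifier can apply them.\<close>

lemma cartesian_cid: "polynomial f \<Longrightarrow> cartesian (cid f)"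
  using ccell_cid ccellD(1) by blast

lemma cartesian_assoc: "polynomial h \<Longrightarrow> polynomial g \<Longrightarrow> polynomial f \<Longrightarrow> cartesian (assoc h g f)"
  using ccell_assoc ccellD(1) by blast

lemma cartesian_units: "polynomial f \<Longrightarrow> cartesian (lunit f)" "polynomial f \<Longrightarrow> cartesian (runit f)"
  using ccell_lunit ccell_runit ccellD(1) by blast+

lemma cartesian_ccomp: "cartesian \<psi> \<Longrightarrow> cartesian \<phi> \<Longrightarrow> Cd \<phi> = Dm \<psi> \<Longrightarrow> cartesian (\<psi> \<odot> \<phi>)"
  using ccell_ccomp[of "Dm \<psi>" "Cd \<psi>" \<psi> "Dm \<phi>" \<phi>] by (simp add: ccell_def)

lemma cartesian_hcomp: "cartesian \<psi> \<Longrightarrow> cartesian \<phi> \<Longrightarrow> cartesian (\<psi> \<star> \<phi>)"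
  using ccell_hcomp[of "Dm \<psi>" "Cd \<psi>" \<psi> "Dm \<phi>" "Cd \<phi>" \<phi>] by (simp add: ccell_def)

lemma cartesian_lift_cell: "polynomial p \<Longrightarrow> cartesian \<phi> \<Longrightarrow> cartesian (lift_cell p \<phi>)"
  using ccell_lift_cell[of p "Dm \<phi>" "Cd \<phi>" \<phi>] by (simp add: ccell_def)

lemma cartesian_lift_unit: "cartesian \<eta> \<Longrightarrow> Dm \<eta> = pid \<Longrightarrow> polynomial f \<Longrightarrow> cartesian (lift_unit \<eta> f)"
  using ccell_lift_unit[of "Cd \<eta>" \<eta> f] by (simp add: ccell_def)

lemma cartesian_lift_mult:
  "cartesian \<mu> \<Longrightarrow> Dm \<mu> = p \<cdot> p \<Longrightarrow> Cd \<mu> = p \<Longrightarrow> polynomial p \<Longrightarrow> polynomial f \<Longrightarrow> cartesian (lift_mult p \<mu> f)"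
  using ccell_lift_mult[of p \<mu> f] by (simp add: ccell_def)

lemmas cart_intros = cartesian_cid cartesian_assoc cartesian_units cartesian_ccomp cartesian_hcomp
  cartesian_lift_cell cartesian_lift_unit cartesian_lift_mult polynomial_pcomp polynomial_ext_poly polynomial_pid

lemma cart_assoc:
  "cartesian \<phi> \<Longrightarrow> cartesian \<psi> \<Longrightarrow> Cd \<phi> = Dm \<psi> \<Longrightarrow> (\<chi> \<odot> \<psi>) \<odot> \<phi> = \<chi> \<odot> \<psi> \<odot> \<phi>"
  using ccomp_assoc[of "Dm \<phi>" "Dm \<psi>" \<phi> "Cd \<psi>" \<psi> \<chi>] by (simp add: ccell_def)

lemma cart_lift_ccomp: "polynomial p \<Longrightarrow> cartesian \<psi> \<Longrightarrow> cartesian \<phi> \<Longrightarrow> Cd \<phi> = Dm \<psi> \<Longrightarrow>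
    lift_cell p (\<psi> \<odot> \<phi>) = lift_cell p \<psi> \<odot> lift_cell p \<phi>"
  using lift_cell_ccomp[of p "Dm \<psi>" "Cd \<psi>" \<psi> "Dm \<phi>" \<phi>] by (simp add: ccell_def)

text \<open>Interchange, with the identity written as \<open>cid f \<odot> cid f\<close>.\<close>

lemma cart_hcomp_ccomp:
  assumes "polynomial f" "cartesian \<psi>" "cartesian \<phi>" "Cd \<phi> = Dm \<psi>"
  shows "cid f \<star> (\<psi> \<odot> \<phi>) = (cid f \<star> \<psi>) \<odot> (cid f \<star> \<phi>)" "(\<psi> \<odot> \<phi>) \<star> cid f = (\<psi> \<star> cid f) \<odot> (\<phi> \<star> cid f)"
proof -
  note i = ccell_cid[OF assms(1)]
  have "ccell (Dm \<phi>) (Cd \<phi>) \<phi>" "ccell (Cd \<phi>) (Cd \<psi>) \<psi>" using assms by (simp_all add: ccell_def)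
  from hcomp_ccomp[OF i this(1) i this(2)] hcomp_ccomp[OF this(1) i this(2) i]
  show "cid f \<star> (\<psi> \<odot> \<phi>) = (cid f \<star> \<psi>) \<odot> (cid f \<star> \<phi>)"
    "(\<psi> \<odot> \<phi>) \<star> cid f = (\<psi> \<star> cid f) \<odot> (\<phi> \<star> cid f)" by (simp_all add: ccomp_cid[OF i])
qed

text \<open>The target polynomials enter through equations, so that an associator with explicit
  indices matches and its boundary conditions are left to simplification.\<close>

lemma cart_assoc_natural:
  "cartesian \<chi> \<Longrightarrow> cartesian \<psi> \<Longrightarrow> cartesian \<phi> \<Longrightarrow> Cd \<chi> = h \<Longrightarrow> Cd \<psi> = g \<Longrightarrow> Cd \<phi> = f \<Longrightarrow>
    assoc h g f \<odot> (\<chi> \<star> (\<psi> \<star> \<phi>)) = ((\<chi> \<star> \<psi>) \<star> \<phi>) \<odot> assoc (Dm \<chi>) (Dm \<psi>) (Dm \<phi>)"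
  by (rule hcomp_assoc_natural) (simp_all add: ccell_def)

section \<open>Boundaries of whiskered and lifted adjustments\<close>

text \<open>Whiskering is defined as the unique adjustment between the evident composites, so it has
  the expected boundary as soon as these are parallel pullback squares. The variants below hold for
  the same reason.\<close>

lemma adjustment_lwhisk:
  "adjustment \<phi> \<psi> \<alpha> \<Longrightarrow> cartesian \<chi> \<Longrightarrow> Dm \<chi> = Cd \<phi> \<Longrightarrow> adjustment (\<chi> \<odot> \<phi>) (\<chi> \<odot> \<psi>) (\<chi> \<circ>\<^sub>l \<alpha>)"
  using adjustmentD[of \<phi> \<psi> \<alpha>]
  by (simp add: lwhisk_def adjustment_the_adj cartesian_ccomp boundary)

lemma adjustment_rwhisk:
  "adjustment \<phi> \<psi> \<alpha> \<Longrightarrow> cartesian \<chi> \<Longrightarrow> Cd \<chi> = Dm \<phi> \<Longrightarrow> adjustment (\<phi> \<odot> \<chi>) (\<psi> \<odot> \<chi>) (\<alpha> \<circ>\<^sub>r \<chi>)"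
  using adjustmentD[of \<phi> \<psi> \<alpha>]
  by (simp add: rwhisk_def adjustment_the_adj cartesian_ccomp boundary)

lemma adjustment_hlwhisk:
  "adjustment \<phi> \<psi> \<alpha> \<Longrightarrow> polynomial g \<Longrightarrow> adjustment (cid g \<star> \<phi>) (cid g \<star> \<psi>) (g \<star>\<^sub>l \<alpha>)"
  using adjustmentD[of \<phi> \<psi> \<alpha>]
  by (simp add: hlwhisk_def adjustment_the_adj cartesian_hcomp cartesian_cid boundary)

lemma adjustment_hrwhisk:
  "adjustment \<phi> \<psi> \<alpha> \<Longrightarrow> polynomial f \<Longrightarrow> adjustment (\<phi> \<star> cid f) (\<psi> \<star> cid f) (\<alpha> \<star>\<^sub>r f)"
  using adjustmentD[of \<phi> \<psi> \<alpha>]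
  by (simp add: hrwhisk_def adjustment_the_adj cartesian_hcomp cartesian_cid boundary)

lemma adjustment_lift:
  "adjustment \<phi> \<psi> \<alpha> \<Longrightarrow> polynomial p \<Longrightarrow> adjustment (lift_cell p \<phi>) (lift_cell p \<psi>) (lift_adj p \<alpha>)"
  using adjustmentD[of \<phi> \<psi> \<alpha>]
  by (simp add: lift_adj_def adjustment_the_adj cartesian_lift_cell boundary)

section \<open>Pseudomonads and pseudoalgebras from their underlying cells\<close>

lemma polynomial_pseudomonadI:
  assumes p: "polynomial p" and \<eta>: "ccell pid p \<eta>" and \<mu>: "ccell (p \<cdot> p) p \<mu>"
  shows "\<exists>\<alpha> lam rho. polynomial_pseudomonad C p \<eta> \<mu> \<alpha> lam rho"
proof -
  let ?i = "cid p" and ?a = "assoc p p p"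
  let ?\<phi> = "\<mu> \<odot> (?i \<star> \<mu>)" and ?\<psi> = "\<mu> \<odot> (\<mu> \<star> ?i) \<odot> ?a"
  let ?\<kappa> = "\<mu> \<odot> (?i \<star> \<eta>) \<odot> runit p" and ?\<omega> = "\<mu> \<odot> (\<eta> \<star> ?i) \<odot> lunit p"
  have c: "cartesian \<eta>" "Dm \<eta> = pid" "Cd \<eta> = p" "cartesian \<mu>" "Dm \<mu> = p \<cdot> p" "Cd \<mu> = p"
    using \<eta> \<mu> by (simp_all add: ccell_def)
  note s = c p boundary cart_intros
  define \<alpha> where "\<alpha> = the_adj ?\<phi> ?\<psi>"
  define lam where "lam = the_adj ?\<kappa> ?i"
  define rho where "rho = the_adj ?\<omega> ?i"
  have inv: "inv_adjustment ?\<phi> ?\<psi> \<alpha>" "inv_adjustment ?\<kappa> ?i lam" "inv_adjustment ?\<omega> ?i rho"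
    unfolding \<alpha>_def lam_def rho_def by (rule inv_adjustment_the_adj; simp add: s)+
  then have \<alpha>: "adjustment ?\<phi> ?\<psi> \<alpha>" and lam: "adjustment ?\<kappa> ?i lam" and rho: "adjustment ?\<omega> ?i rho"
    by (simp_all add: inv_adjustment_def)
  note split = cart_hcomp_ccomp cart_assoc
  \<comment> \<open>Naturality of the associator at the multiplication and the unit. Identities on
    \<open>p \<cdot> p\<close> are split into \<open>?i \<star> ?i\<close> to bring them into the
    form that naturality expects.\<close>
  have nat: "?a \<odot> (?i \<star> (\<mu> \<star> ?i)) = ((?i \<star> \<mu>) \<star> ?i) \<odot> assoc p (p \<cdot> p) p"
    "?a \<odot> (?i \<star> (?i \<star> \<mu>)) = (cid (p \<cdot> p) \<star> \<mu>) \<odot> assoc p p (p \<cdot> p)"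
    "?a \<odot> (\<mu> \<star> cid (p \<cdot> p)) = ((\<mu> \<star> ?i) \<star> ?i) \<odot> assoc (p \<cdot> p) p p"
    "?a \<odot> (?i \<star> (\<eta> \<star> ?i)) = ((?i \<star> \<eta>) \<star> ?i) \<odot> assoc p pid p"
    by (simp_all add: s cart_assoc_natural hcomp_cid flip: hcomp_cid)
  let ?X = "(?i \<star> (\<mu> \<star> ?i)) \<odot> (?i \<star> ?a)" and ?Y = "assoc p (p \<cdot> p) p \<odot> (?i \<star> ?a)"
    and ?Z = "?i \<star> (?i \<star> \<mu>)" and ?W = "(\<mu> \<star> cid (p \<cdot> p)) \<odot> assoc p p (p \<cdot> p)"
    and ?T = "(?i \<star> (\<eta> \<star> ?i)) \<odot> (?i \<star> lunit p)"
  let ?U = "\<mu> \<odot> (\<mu> \<star> ?i) \<odot> (cid (p \<cdot> p) \<star> \<mu>) \<odot> assoc p p (p \<cdot> p)"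
    and ?V = "\<mu> \<odot> (?i \<star> \<mu>) \<odot> (\<mu> \<star> cid (p \<cdot> p)) \<odot> assoc p p (p \<cdot> p)"
  \<comment> \<open>In a composite nested to the right, two adjacent cells are not a subterm unless
    they come last. The equation is therefore extended by a further cell \<open>\<phi>\<close>
    before it can rewrite.\<close>
  have reassoc: "\<chi> \<odot> \<psi> \<odot> \<phi> = \<chi>' \<odot> \<psi>' \<odot> \<phi>" if "\<chi> \<odot> \<psi> = \<chi>' \<odot> \<psi>'" "cartesian \<phi>" "cartesian \<psi>" "cartesian \<psi>'"
    "Cd \<phi> = Dm \<psi>" "Cd \<phi> = Dm \<psi>'" for \<chi> \<psi> \<chi>' \<psi>' \<phi>
    using that cart_assoc by metis
  \<comment> \<open>These equations glue consecutive 3-cells: \<open>e1\<close> to \<open>e6\<close>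
    for the pentagon law, \<open>e7\<close> and \<open>e8\<close> for the unit law. Where no
    naturality is cited, distributing whiskering over composition and rebracketing suffice.\<close>
  have e1: "\<mu> \<odot> (?i \<star> ?\<phi>) = ?\<phi> \<odot> ?Z" by (simp add: s split)
  have e2: "\<mu> \<odot> (?i \<star> ?\<psi>) = ?\<phi> \<odot> ?X" by (simp add: s split)
  have e3: "?\<psi> \<odot> ?X = (\<mu> \<odot> (?\<phi> \<star> ?i)) \<odot> ?Y"
    by (simp add: s split nat(1)[THEN reassoc])
  have e4: "?\<psi> \<odot> ?Z = ?U" by (simp add: s split nat(2))
  have e5: "?V = ?\<phi> \<odot> ?W" by (simp add: s split)
  \<comment> \<open>The common end of both sides of the law, where the bracketings of a fourfold
    composite are reconciled by the pentagon identity for the associators.\<close>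
  have e6: "(\<mu> \<odot> (?\<psi> \<star> ?i)) \<odot> ?Y = ?\<psi> \<odot> ?W"
    by (simp add: s split nat(3)[THEN reassoc] assoc_pentagon)
  have e7: "?\<phi> \<odot> ?T = \<mu> \<odot> (?i \<star> ?\<omega>)" by (simp add: s split)
  \<comment> \<open>Moving the unit past the associator leaves an associator with a middle index
    \<open>pid\<close>, which the triangle identity converts into a right unit.\<close>
  have e8: "?\<psi> \<odot> ?T = \<mu> \<odot> (?\<kappa> \<star> ?i)"
    by (simp add: s split nat(4)[THEN reassoc] assoc_triangle)
  have "polynomial_pseudomonad C p \<eta> \<mu> \<alpha> lam rho"
  proof (unfold_locales)
    have t1: "adjustment (\<mu> \<odot> (?i \<star> ?\<phi>)) (\<mu> \<odot> (?i \<star> ?\<psi>)) (\<mu> \<circ>\<^sub>l (p \<star>\<^sub>l \<alpha>))"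
      by (intro adjustment_lwhisk adjustment_hlwhisk \<alpha>) (simp_all add: s)
    have t2: "adjustment (?\<phi> \<odot> ?X) (?\<psi> \<odot> ?X) (\<alpha> \<circ>\<^sub>r ?X)"
      by (intro adjustment_rwhisk \<alpha>) (simp_all add: s)
    have t3: "adjustment ((\<mu> \<odot> (?\<phi> \<star> ?i)) \<odot> ?Y) ((\<mu> \<odot> (?\<psi> \<star> ?i)) \<odot> ?Y) ((\<mu> \<circ>\<^sub>l (\<alpha> \<star>\<^sub>r p)) \<circ>\<^sub>r ?Y)"
      by (intro adjustment_rwhisk adjustment_lwhisk adjustment_hrwhisk \<alpha>) (simp_all add: s)
    have u1: "adjustment (?\<phi> \<odot> ?Z) (?\<psi> \<odot> ?Z) (\<alpha> \<circ>\<^sub>r ?Z)"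
      by (intro adjustment_rwhisk \<alpha>) (simp_all add: s)
    have u2: "adjustment ?U ?V (the_adj ?U ?V)" by (intro adjustment_the_adj) (simp_all add: s)
    have u3: "adjustment (?\<phi> \<odot> ?W) (?\<psi> \<odot> ?W) (\<alpha> \<circ>\<^sub>r ?W)"
      by (intro adjustment_rwhisk \<alpha>) (simp_all add: s)
    show "(\<mu> \<circ>\<^sub>l (p \<star>\<^sub>l \<alpha>) \<then> \<alpha> \<circ>\<^sub>r ?X \<then> (\<mu> \<circ>\<^sub>l (\<alpha> \<star>\<^sub>r p)) \<circ>\<^sub>r ?Y) =
        (\<alpha> \<circ>\<^sub>r ?Z \<then> the_adj ?U ?V \<then> \<alpha> \<circ>\<^sub>r ?W)"
      by (rule adjustment_unique[OF
            adjustment_athen[OF adjustment_athen[OF t1[unfolded e1 e2] t2[unfolded e3]] t3[unfolded e6]]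
            adjustment_athen[OF adjustment_athen[OF u1[unfolded e4] u2] u3[folded e5]]])
    have v1: "adjustment (?\<phi> \<odot> ?T) (?\<psi> \<odot> ?T) (\<alpha> \<circ>\<^sub>r ?T)"
      by (intro adjustment_rwhisk \<alpha>) (simp_all add: s)
    \<comment> \<open>Both sides of the unit law end at \<open>\<mu> \<odot> (?i \<star> ?i)\<close>
      as it stands, so this cell is left in that form.\<close>
    have v2: "adjustment (\<mu> \<odot> (?\<kappa> \<star> ?i)) (\<mu> \<odot> (?i \<star> ?i)) (\<mu> \<circ>\<^sub>l (lam \<star>\<^sub>r p))"
      by (intro adjustment_lwhisk adjustment_hrwhisk lam) (simp_all add: s)
    have v3: "adjustment (\<mu> \<odot> (?i \<star> ?\<omega>)) (\<mu> \<odot> (?i \<star> ?i)) (\<mu> \<circ>\<^sub>l (p \<star>\<^sub>l rho))"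
      by (intro adjustment_lwhisk adjustment_hlwhisk rho) (simp_all add: s)
    show "(\<alpha> \<circ>\<^sub>r ?T \<then> \<mu> \<circ>\<^sub>l (lam \<star>\<^sub>r p)) = \<mu> \<circ>\<^sub>l (p \<star>\<^sub>l rho)"
      by (rule adjustment_unique[OF adjustment_athen[OF v1[unfolded e7 e8] v2] v3])
  qed (use c p inv in simp_all)
  then show ?thesis by blast
qed

end

context polynomial_pseudomonad
begin

text \<open>Lifting is strictly functorial, so expanding lifted composites and rebracketing already
  makes consecutive boundaries coincide.\<close>

lemma polynomial_pseudoalgebraI:
  assumes \<zeta>: "ccell (ext_poly p f) f \<zeta>" and f: "polynomial f"
  shows "\<exists>\<sigma> \<tau>. polynomial_pseudoalgebra C p \<eta> \<mu> \<alpha> lam rho f \<zeta> \<sigma> \<tau>"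
proof -
  let ?P = "lift_cell p" and ?m = "lift_mult p \<mu>" and ?h = "lift_unit \<eta> f" and ?f = "ext_poly p f"
  have c: "cartesian \<zeta>" "Dm \<zeta> = ?f" "Cd \<zeta> = f" using \<zeta> by (simp_all add: ccell_def)
  note s = c f poly_p cart_\<eta> cart_\<mu> boundary cart_intros
  define \<sigma> where "\<sigma> = the_adj (\<zeta> \<odot> ?P \<zeta>) (\<zeta> \<odot> ?m f)"
  define \<tau> where "\<tau> = the_adj (\<zeta> \<odot> ?h) (cid f)"
  have inv: "inv_adjustment (\<zeta> \<odot> ?P \<zeta>) (\<zeta> \<odot> ?m f) \<sigma>" "inv_adjustment (\<zeta> \<odot> ?h) (cid f) \<tau>"
    unfolding \<sigma>_def \<tau>_def by (rule inv_adjustment_the_adj; simp add: s)+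
  then have \<sigma>: "adjustment (\<zeta> \<odot> ?P \<zeta>) (\<zeta> \<odot> ?m f) \<sigma>" and \<tau>: "adjustment (\<zeta> \<odot> ?h) (cid f) \<tau>"
    by (simp_all add: inv_adjustment_def)
  note split = cart_lift_ccomp cart_assoc
  let ?A = "the_adj (?m f \<odot> ?P (?m f)) (?m f \<odot> ?m ?f)"
    and ?N = "the_adj (?m f \<odot> ?P (?P \<zeta>)) (?P \<zeta> \<odot> ?m ?f)"
    and ?L = "the_adj (?m f \<odot> ?P ?h) (cid ?f)"
  have "polynomial_pseudoalgebra C p \<eta> \<mu> \<alpha> lam rho f \<zeta> \<sigma> \<tau>"
  proof (unfold_locales)
    have t1: "adjustment (\<zeta> \<odot> ?P \<zeta> \<odot> ?P (?P \<zeta>)) (\<zeta> \<odot> ?P \<zeta> \<odot> ?P (?m f)) (\<zeta> \<circ>\<^sub>l lift_adj p \<sigma>)"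
      using adjustment_lwhisk[OF adjustment_lift[OF \<sigma> poly_p] c(1)] by (simp add: s split)
    have t2: "adjustment (\<zeta> \<odot> ?P \<zeta> \<odot> ?P (?m f)) (\<zeta> \<odot> ?m f \<odot> ?P (?m f)) (\<sigma> \<circ>\<^sub>r ?P (?m f))"
      using adjustment_rwhisk[OF \<sigma>, of "?P (?m f)"] by (simp add: s split)
    \<comment> \<open>The associativity 3-cell of the lifted pseudomonad enters through
      \<open>the_adj\<close>, for which it suffices that the two cells are parallel pullback
      squares. The pseudonaturality 3-cell in \<open>u2\<close> is treated in the same way.\<close>
    have t3: "adjustment (\<zeta> \<odot> ?m f \<odot> ?P (?m f)) (\<zeta> \<odot> ?m f \<odot> ?m ?f) (\<zeta> \<circ>\<^sub>l ?A)"
      by (intro adjustment_lwhisk adjustment_the_adj) (simp_all add: s)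
    have u1: "adjustment (\<zeta> \<odot> ?P \<zeta> \<odot> ?P (?P \<zeta>)) (\<zeta> \<odot> ?m f \<odot> ?P (?P \<zeta>)) (\<sigma> \<circ>\<^sub>r ?P (?P \<zeta>))"
      using adjustment_rwhisk[OF \<sigma>, of "?P (?P \<zeta>)"] by (simp add: s split)
    have u2: "adjustment (\<zeta> \<odot> ?m f \<odot> ?P (?P \<zeta>)) (\<zeta> \<odot> ?P \<zeta> \<odot> ?m ?f) (\<zeta> \<circ>\<^sub>l ?N)"
      by (intro adjustment_lwhisk adjustment_the_adj) (simp_all add: s)
    have u3: "adjustment (\<zeta> \<odot> ?P \<zeta> \<odot> ?m ?f) (\<zeta> \<odot> ?m f \<odot> ?m ?f) (\<sigma> \<circ>\<^sub>r ?m ?f)"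
      using adjustment_rwhisk[OF \<sigma>, of "?m ?f"] by (simp add: s split)
    show "(\<zeta> \<circ>\<^sub>l lift_adj p \<sigma> \<then> \<sigma> \<circ>\<^sub>r ?P (?m f) \<then> \<zeta> \<circ>\<^sub>l ?A) =
        (\<sigma> \<circ>\<^sub>r ?P (?P \<zeta>) \<then> \<zeta> \<circ>\<^sub>l ?N \<then> \<sigma> \<circ>\<^sub>r ?m ?f)"
      by (rule adjustment_unique[OF adjustment_athen[OF adjustment_athen[OF t1 t2] t3]
            adjustment_athen[OF adjustment_athen[OF u1 u2] u3]])
    have v1: "adjustment (\<zeta> \<odot> ?P \<zeta> \<odot> ?P ?h) (\<zeta> \<odot> ?m f \<odot> ?P ?h) (\<sigma> \<circ>\<^sub>r ?P ?h)"
      using adjustment_rwhisk[OF \<sigma>, of "?P ?h"] by (simp add: s split)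
    have v2: "adjustment (\<zeta> \<odot> ?m f \<odot> ?P ?h) (\<zeta> \<odot> cid ?f) (\<zeta> \<circ>\<^sub>l ?L)"
      by (intro adjustment_lwhisk adjustment_the_adj) (simp_all add: s)
    \<comment> \<open>Since lifting preserves identities strictly, the lifted \<open>\<tau>\<close>
      ends at \<open>cid ?f\<close>, the cell at which the other side ends.\<close>
    have v3: "adjustment (\<zeta> \<odot> ?P \<zeta> \<odot> ?P ?h) (\<zeta> \<odot> cid ?f) (\<zeta> \<circ>\<^sub>l lift_adj p \<tau>)"
      using adjustment_lwhisk[OF adjustment_lift[OF \<tau> poly_p] c(1)]
      by (simp add: s split lift_cell_cid)
    show "(\<sigma> \<circ>\<^sub>r ?P ?h \<then> \<zeta> \<circ>\<^sub>l ?L) = \<zeta> \<circ>\<^sub>l lift_adj p \<tau>"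
      by (rule adjustment_unique[OF adjustment_athen[OF v1 v2] v3])
  qed (use c f inv in simp_all)
  then show ?thesis by blast
qed

end

section \<open>Type formers of a natural model as cartesian cells\<close>

text \<open>Type formers are stated through the two maps of a square, structures through whole
  cells; once the boundary is fixed, a cell is the same as its two maps.\<close>

lemma (in category) ex_cartesian_iff_ccell:
  "(\<exists>h k. cartesian \<lparr>Dm = f, Cd = g, c0 = h, c1 = k\<rparr>) \<longleftrightarrow> (\<exists>\<phi>. ccell f g \<phi>)"
proof
  assume "\<exists>\<phi>. ccell f g \<phi>"
  then obtain \<phi> where "cartesian \<phi>" "Dm \<phi> = f" "Cd \<phi> = g" by (auto simp: ccell_def)
  then show "\<exists>h k. cartesian \<lparr>Dm = f, Cd = g, c0 = h, c1 = k\<rparr>" by (cases \<phi>) auto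
qed (auto simp: ccell_def)

theorem theorem4p1:
  fixes C :: "('o, 'm) cat"
    and p :: "('o, 'm, 't, 'u) polynomial"
  assumes "natural_model C dia p cext cproj cvar"
  shows "(natural_model.supports_unit_type C p \<and> natural_model.supports_sum_types C p \<longleftrightarrow>
            (\<exists>\<eta> \<mu> \<alpha> lam rho. polynomial_pseudomonad C p \<eta> \<mu> \<alpha> lam rho)) \<and>
         (\<forall>\<eta> \<mu> \<alpha> lam rho. polynomial_pseudomonad C p \<eta> \<mu> \<alpha> lam rho \<longrightarrow>
            (natural_model.supports_product_types C p \<longleftrightarrow>
             (\<exists>\<zeta> \<sigma> \<tau>. polynomial_pseudoalgebra C p \<eta> \<mu> \<alpha> lam rho p \<zeta> \<sigma> \<tau>)))"
proof -
  interpret natural_model C dia p cext cproj cvar by (rule assms)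
  note supports = supports_unit_type_def supports_sum_types_def supports_product_types_def
    ex_cartesian_iff_ccell
  \<comment> \<open>For the implications from structures to types: forgetting the 3-cells leaves the
    required pullback squares.\<close>
  have cells: "ccell pid p \<eta> \<and> ccell (p \<cdot> p) p \<mu>" if "polynomial_pseudomonad C p \<eta> \<mu> \<alpha> lam rho"
    for \<eta> \<mu> \<alpha> lam rho
    using polynomial_pseudomonad.cart_\<eta>[OF that] polynomial_pseudomonad.cart_\<mu>[OF that]
    by (simp add: ccell_def)
  have alg: "ccell (ext_poly p p) p \<zeta>" if "polynomial_pseudoalgebra C p \<eta> \<mu> \<alpha> lam rho p \<zeta> \<sigma> \<tau>"
    for \<eta> \<mu> \<alpha> lam rho \<zeta> \<sigma> \<tau>
    using polynomial_pseudoalgebra.cart_\<zeta>[OF that] by (simp add: ccell_def)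
  show ?thesis
  proof (intro conjI allI impI)
    show "supports_unit_type \<and> supports_sum_types \<longleftrightarrow>
        (\<exists>\<eta> \<mu> \<alpha> lam rho. polynomial_pseudomonad C p \<eta> \<mu> \<alpha> lam rho)"
      unfolding supports using cells polynomial_pseudomonadI[OF poly_p] by blast
  next
    fix \<eta> \<mu> \<alpha> lam rho assume P: "polynomial_pseudomonad C p \<eta> \<mu> \<alpha> lam rho"
    \<comment> \<open>The square for product types involves \<open>p\<close> alone, so the
      equivalence is obtained for whichever pseudomonad structure on \<open>p\<close> has been
      fixed.\<close>
    show "supports_product_types \<longleftrightarrow>
        (\<exists>\<zeta> \<sigma> \<tau>. polynomial_pseudoalgebra C p \<eta> \<mu> \<alpha> lam rho p \<zeta> \<sigma> \<tau>)"
      unfolding supports using alg polynomial_pseudomonad.polynomial_pseudoalgebraI[OF P _ poly_p] by blast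
  qed
qed

end
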